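(* Let (P1), (P1'), (P2), (P2'), (P3), (P3'), (P4), (P4'), (P5), (P6), (P7), (P8) be the twelve conditions, defined in the context, on a weight $w$ associated to a basis $\mathcal{B}$ in a measure space $(X,\Sigma,\mu)$. For two of these conditions (PA) and (PB), say that the implication $(\mathrm{PA})\Rightarrow(\mathrm{PB})$ holds for general bases if, for every $\sigma$-finite measure space $(X,\Sigma,\mu)$, every basis $\mathcal{B}\subset\Sigma$ and every weight $w$ associated to $\mathcal{B}$, if $w$ satisfies (PA) then $w$ satisfies (PB). Say that it fails for general bases otherwise, that is, if there exist a $\sigma$-finite measure space $(X,\Sigma,\mu)$, a basis $\mathcal{B}\subset\Sigma$ and a weight $w$ associated to $\mathcal{B}$ such that $w$ satisfies (PA) and does not satisfy (PB). Then the following complete classification is valid. (i) The equivalences $(\mathrm{P1})\Leftrightarrow(\mathrm{P1'})$, $(\mathrm{P2})\Leftrightarrow(\mathrm{P2'})$, $(\mathrm{P3})\Leftrightarrow(\mathrm{P3'})$, $(\mathrm{P4})\Leftrightarrow(\mathrm{P4'})$ hold for general bases (both implications hold in each case). (ii) Among the eight conditions (P1), (P2), (P3), (P4), (P5), (P6), (P7), (P8), the following implications between distinct conditions hold for general bases: - $(\mathrm{P1})\Rightarrow(\mathrm{P2})$, $(\mathrm{P1})\Rightarrow(\mathrm{P4})$, $(\mathrm{P1})\Rightarrow(\mathrm{P5})$; - $(\mathrm{P2})\Rightarrow(\mathrm{P4})$, $(\mathrm{P2})\Rightarrow(\mathrm{P5})$; - $(\mathrm{P3})\Rightarrow(\mathrm{P4})$,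 $(\mathrm{P3})\Rightarrow(\mathrm{P6})$; - $(\mathrm{P5})\Rightarrow(\mathrm{P4})$; - $(\mathrm{P6})\Rightarrow(\mathrm{P4})$; - $(\mathrm{P8})\Rightarrow(\mathrm{P3})$, $(\mathrm{P8})\Rightarrow(\mathrm{P4})$, $(\mathrm{P8})\Rightarrow(\mathrm{P6})$. (iii) For every ordered pair of distinct conditions (PA), (PB) among (P1), (P2), (P3), (P4), (P5), (P6), (P7), (P8) that is not listed in (ii), the implication $(\mathrm{PA})\Rightarrow(\mathrm{PB})$ fails for general bases. Explicitly, the following fail: - from (P1): to (P3), (P6), (P7), (P8); - from (P2): to (P1), (P3), (P6), (P7), (P8); - from (P3): to (P1), (P2), (P5), (P7), (P8); - from (P4): to (P1), (P2), (P3), (P5), (P6), (P7), (P8); - from (P5): to (P1), (P2), (P3), (P6), (P7), (P8); - from (P6): to (P1), (P2), (P3), (P5), (P7), (P8); - from (P7): to (P1), (P2), (P3), (P4), (P5), (P6), (P8); - from (P8): to (P1), (P2), (P5), (P7).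
   Context: Setting. $(X,\Sigma,\mu)$ is a measure space with $\sigma$-finite measure $\mu:\Sigma\to[0,\infty]$; for $E\in\Sigma$ write $|E|:=\mu(E)$. A basis $\mathcal{B}$ is a collection of sets $B\in\Sigma$ with $|B|\in(0,\infty)$ whose elements cover $X$ except for a set of $\mu$-measure zero. A weight associated to $\mathcal{B}$ is a $\mu$-measurable function $w:X\to[0,\infty)$ such that $\int_B w\,d\mu<\infty$ for all $B\in\mathcal{B}$; it is also understood that $\int_B w\,d\mu>0$ for all $B\in\mathcal{B}$, so that the quotients below make sense. Notation. For measurable $E\subset X$, $w(E):=\int_E w\,d\mu$. For $B\in\mathcal{B}$, $w_B:=w(B)/|B|$ is the average of $w$ in $B$, and $m(w;B):=\inf\{t: |\{x\in B: w(x)>t\}|<|B|/2\}$ is the median of $w$ in $B$. The maximal operator associated to $\mathcal{B}$ is $\mathcal{M}^{\mathcal{B}}f(x):=\sup_{x\in B\in\mathcal{B}}\frac{1}{|B|}\int_B f\,d\mu$ for $x\in X$. $\chi_B$ is the indicator function of $B$, and $\log^+ t:=\max(\log t,0)$ with $\log^+0=0$. For $p\in(1,\infty)$, $p'$ is defined by $\frac1p+\frac1{p'}=1$. Usual conventions: $0^{1-p'}=\infty$, $\log 0=-\infty$, $\exp(-\infty)=0$. Conditions on $w$ (constants may depend on $X,\mu,\mathcal{B},w$, but not on $B$, $E$, $s$, $\lambda$): (P1) There exist $p\in(1,\infty)$ and $C>0$ such that $\left(\frac{1}{|B|}\int_B w\,d\mu\right)\left(\frac{1}{|B|}\int_B w^{1-p'}\,d\mu\right)^{p-1}\le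 C$ for all $B\in\mathcal{B}$. (P1') There exist $\delta,C>0$ such that $\frac{|E|}{|B|}\le C\left(\frac{w(E)}{w(B)}\right)^{\delta}$ for all $B\in\mathcal{B}$ and all $\mu$-measurable $E\subset B$. (P2) There exists $C>0$ such that $\frac{1}{|B|}\int_B w\,d\mu\le C\exp\left(\frac{1}{|B|}\int_B\log w\,d\mu\right)$ for all $B\in\mathcal{B}$. (P2') There exists $C>0$ such that $\frac{1}{|B|}\int_B w\,d\mu\le C\left(\frac{1}{|B|}\int_B w^s\,d\mu\right)^{1/s}$ for every $s\in(0,1)$ and all $B\in\mathcal{B}$. (P3) There exist $q\in(1,\infty)$ and $C>0$ such that $\left(\frac{1}{|B|}\int_B w^q\,d\mu\right)^{1/q}\le\frac{C}{|B|}\int_B w\,d\mu$ for all $B\in\mathcal{B}$. (P3') There exist $\delta,C>0$ such that $\frac{w(E)}{w(B)}\le C\left(\frac{|E|}{|B|}\right)^{\delta}$ for all $B\in\mathcal{B}$ and all $\mu$-measurable $E\subset B$. (P4) There exist $\alpha,\beta\in(0,1)$ such that, for all $B\in\mathcal{B}$ and all $\mu$-measurable $E\subset B$, $|E|<\alpha|B|$ implies $w(E)\le\beta w(B)$. (P4') There exist $\alpha,\beta\in(0,1)$ such that $|\{x\in B: w(x)\le\alpha w_B\}|\le\beta|B|$ for all $B\in\mathcal{B}$. (P5) There exists $C>0$ such that $w_B\le C\,m(w;B)$ for all $B\in\mathcal{B}$. (P6) There exists $C>0$ such that $\int_B w\log^+\frac{w}{w_B}\,d\mu\le C\,w(B)$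 for all $B\in\mathcal{B}$. (P7) There exists $C>0$ such that $\int_B\mathcal{M}^{\mathcal{B}}(w\chi_B)\,d\mu\le C\,w(B)$ for all $B\in\mathcal{B}$. (P8) There exist $C,\beta>0$ such that $w(\{x\in B: w(x)\ge\lambda\})\le C\lambda\,|\{x\in B: w(x)\ge\beta\lambda\}|$ for all $B\in\mathcal{B}$ and every $\lambda>w_B$. *)

theory Defs
  imports "HOL-Analysis.Analysis"
begin

text \<open>Powers and logarithms with values at the end points:
  \<open>0\<^sup>a = \<infinity>\<close> for \<open>a < 0\<close>, \<open>\<infinity>\<^sup>a = \<infinity>\<close> for \<open>a > 0\<close>, \<open>\<infinity>\<^sup>a = 0\<close> for \<open>a < 0\<close>,
  \<open>log 0 = -\<infinity>\<close>, \<open>exp (-\<infinity>) = 0\<close>. In the last branch of \<open>epowr\<close> the library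
  conventions \<open>enn2real \<infinity> = 0\<close> and \<open>0 powr a = 0\<close> give the remaining values.\<close>

definition epowr :: "ennreal \<Rightarrow> real \<Rightarrow> ennreal" where
  "epowr x a =
     (if a = 0 then 1
      else if (x = 0 \<and> a < 0) \<or> (x = \<infinity> \<and> a > 0) then \<infinity>
      else ennreal (enn2real x powr a))"

definition elog :: "real \<Rightarrow> ereal" where
  "elog t = (if t = 0 then -\<infinity> else ereal (ln t))"

definition eexp :: "ereal \<Rightarrow> ennreal" where
  "eexp y = (case y of ereal r \<Rightarrow> ennreal (exp r) | PInfty \<Rightarrow> \<infinity> | MInfty \<Rightarrow> 0)"

definition log_plus :: "real \<Rightarrow> real" where
  "log_plus t = (if t = 0 then 0 else max (ln t) 0)"

definition basis :: "'a measure \<Rightarrow> 'a set set \<Rightarrow> bool" where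
  "basis M \<B> \<longleftrightarrow>
     \<B> \<subseteq> sets M \<and> (\<forall>B\<in>\<B>. 0 < emeasure M B \<and> emeasure M B < \<infinity>) \<and> (AE x in M. x \<in> \<Union>\<B>)"

text \<open>\<open>wint M w E\<close> is \<open>w(E)\<close>, and \<open>avg M B f\<close> is the average of \<open>f\<close> in \<open>B\<close>.\<close>

definition wint :: "'a measure \<Rightarrow> ('a \<Rightarrow> real) \<Rightarrow> 'a set \<Rightarrow> ennreal" where
  "wint M w E = (\<integral>\<^sup>+x\<in>E. ennreal (w x) \<partial>M)"

definition avg :: "'a measure \<Rightarrow> 'a set \<Rightarrow> ('a \<Rightarrow> ennreal) \<Rightarrow> ennreal" where
  "avg M B f = (\<integral>\<^sup>+x\<in>B. f x \<partial>M) / emeasure M B"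

definition wavg :: "'a measure \<Rightarrow> ('a \<Rightarrow> real) \<Rightarrow> 'a set \<Rightarrow> ennreal" where
  "wavg M w B = wint M w B / emeasure M B"

definition weight :: "'a measure \<Rightarrow> 'a set set \<Rightarrow> ('a \<Rightarrow> real) \<Rightarrow> bool" where
  "weight M \<B> w \<longleftrightarrow>
     w \<in> borel_measurable M \<and> (\<forall>x\<in>space M. 0 \<le> w x) \<and>
     (\<forall>B\<in>\<B>. 0 < wint M w B \<and> wint M w B < \<infinity>)"

text \<open>The average of \<open>log w\<close> in \<open>B\<close> is an extended real: the integral is the difference
  of the integrals of the positive and negative parts (\<open>e2ennreal\<close> maps negative
  arguments to 0). For a weight the former is finite, since \<open>log\<^sup>+ w \<le> w\<close>, so no
  \<open>\<infinity> - \<infinity>\<close> occurs.\<close>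

definition log_avg :: "'a measure \<Rightarrow> ('a \<Rightarrow> real) \<Rightarrow> 'a set \<Rightarrow> ereal" where
  "log_avg M w B =
     (enn2ereal (\<integral>\<^sup>+x\<in>B. e2ennreal (elog (w x)) \<partial>M)
      - enn2ereal (\<integral>\<^sup>+x\<in>B. e2ennreal (- elog (w x)) \<partial>M)) / enn2ereal (emeasure M B)"

definition median :: "'a measure \<Rightarrow> ('a \<Rightarrow> real) \<Rightarrow> 'a set \<Rightarrow> real" where
  "median M w B = Inf {t. emeasure M {x\<in>B. w x > t} < emeasure M B / 2}"

definition maximal :: "'a measure \<Rightarrow> 'a set set \<Rightarrow> ('a \<Rightarrow> ennreal) \<Rightarrow> 'a \<Rightarrow> ennreal" where
  "maximal M \<B> f x = (SUP B\<in>{B\<in>\<B>. x \<in> B}. avg M B f)"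

datatype condition = P1 | P1' | P2 | P2' | P3 | P3' | P4 | P4' | P5 | P6 | P7 | P8

fun satisfies :: "condition \<Rightarrow> 'a measure \<Rightarrow> 'a set set \<Rightarrow> ('a \<Rightarrow> real) \<Rightarrow> bool" where
  "satisfies P1 M \<B> w \<longleftrightarrow>
     (\<exists>p p' C. 1 < p \<and> 1 / p + 1 / p' = 1 \<and> 0 < C \<and>
       (\<forall>B\<in>\<B>. wavg M w B * epowr (avg M B (\<lambda>x. epowr (ennreal (w x)) (1 - p'))) (p - 1)
               \<le> ennreal C))"
| "satisfies P1' M \<B> w \<longleftrightarrow>
     (\<exists>\<delta>>0. \<exists>C>0. \<forall>B\<in>\<B>. \<forall>E\<in>sets M. E \<subseteq> B \<longrightarrow>
       emeasure M E / emeasure M B \<le> ennreal C * epowr (wint M w E / wint M w B) \<delta>)"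
| "satisfies P2 M \<B> w \<longleftrightarrow>
     (\<exists>C>0. \<forall>B\<in>\<B>. wavg M w B \<le> ennreal C * eexp (log_avg M w B))"
| "satisfies P2' M \<B> w \<longleftrightarrow>
     (\<exists>C>0. \<forall>s. 0 < s \<and> s < 1 \<longrightarrow> (\<forall>B\<in>\<B>.
       wavg M w B \<le> ennreal C * epowr (avg M B (\<lambda>x. epowr (ennreal (w x)) s)) (1 / s)))"
| "satisfies P3 M \<B> w \<longleftrightarrow>
     (\<exists>q>1. \<exists>C>0. \<forall>B\<in>\<B>.
       epowr (avg M B (\<lambda>x. epowr (ennreal (w x)) q)) (1 / q) \<le> ennreal C * wavg M w B)"
| "satisfies P3' M \<B> w \<longleftrightarrow>
     (\<exists>\<delta>>0. \<exists>C>0. \<forall>B\<in>\<B>. \<forall>E\<in>sets M. E \<subseteq> B \<longrightarrow>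
       wint M w E / wint M w B \<le> ennreal C * epowr (emeasure M E / emeasure M B) \<delta>)"
| "satisfies P4 M \<B> w \<longleftrightarrow>
     (\<exists>\<alpha> \<beta>. 0 < \<alpha> \<and> \<alpha> < 1 \<and> 0 < \<beta> \<and> \<beta> < 1 \<and>
       (\<forall>B\<in>\<B>. \<forall>E\<in>sets M. E \<subseteq> B \<longrightarrow>
         emeasure M E < ennreal \<alpha> * emeasure M B \<longrightarrow> wint M w E \<le> ennreal \<beta> * wint M w B))"
| "satisfies P4' M \<B> w \<longleftrightarrow>
     (\<exists>\<alpha> \<beta>. 0 < \<alpha> \<and> \<alpha> < 1 \<and> 0 < \<beta> \<and> \<beta> < 1 \<and>
       (\<forall>B\<in>\<B>. emeasure M {x\<in>B. ennreal (w x) \<le> ennreal \<alpha> * wavg M w B}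
               \<le> ennreal \<beta> * emeasure M B))"
| "satisfies P5 M \<B> w \<longleftrightarrow>
     (\<exists>C>0. \<forall>B\<in>\<B>. wavg M w B \<le> ennreal (C * median M w B))"
| "satisfies P6 M \<B> w \<longleftrightarrow>
     (\<exists>C>0. \<forall>B\<in>\<B>.
       (\<integral>\<^sup>+x\<in>B. ennreal (w x * log_plus (w x / enn2real (wavg M w B))) \<partial>M)
         \<le> ennreal C * wint M w B)"
| "satisfies P7 M \<B> w \<longleftrightarrow>
     (\<exists>C>0. \<forall>B\<in>\<B>.
       (\<integral>\<^sup>+x\<in>B. maximal M \<B> (\<lambda>y. ennreal (w y) * indicator B y) x \<partial>M)
         \<le> ennreal C * wint M w B)"
| "satisfies P8 M \<B> w \<longleftrightarrow>
     (\<exists>C>0. \<exists>\<beta>>0. \<forall>B\<in>\<B>. \<forall>l. ennreal l > wavg M w B \<longrightarrow>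
       wint M w {x\<in>B. w x \<ge> l} \<le> ennreal (C * l) * emeasure M {x\<in>B. w x \<ge> \<beta> * l})"

text \<open>A type argument records the type of the points of \<open>X\<close>, since HOL has no
  quantification over types inside a formula.\<close>

definition holds_for_general_bases :: "'a itself \<Rightarrow> condition \<Rightarrow> condition \<Rightarrow> bool" where
  "holds_for_general_bases T PA PB \<longleftrightarrow>
     (\<forall>(M :: 'a measure) \<B> w. sigma_finite_measure M \<and> basis M \<B> \<and> weight M \<B> w \<longrightarrow>
       satisfies PA M \<B> w \<longrightarrow> satisfies PB M \<B> w)"

definition fails_for_general_bases :: "'a itself \<Rightarrow> condition \<Rightarrow> condition \<Rightarrow> bool" where
  "fails_for_general_bases T PA PB \<longleftrightarrow>
     (\<exists>(M :: 'a measure) \<B> w. sigma_finite_measure M \<and> basis M \<B> \<and> weight M \<B> w \<and>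
       satisfies PA M \<B> w \<and> \<not> satisfies PB M \<B> w)"

definition main_conditions :: "condition set" where
  "main_conditions = {P1, P2, P3, P4, P5, P6, P7, P8}"

definition valid_implications :: "(condition \<times> condition) set" where
  "valid_implications =
     {(P1, P2), (P1, P4), (P1, P5),
      (P2, P4), (P2, P5),
      (P3, P4), (P3, P6),
      (P5, P4),
      (P6, P4),
      (P8, P3), (P8, P4), (P8, P6)}"

definition failing_implications :: "(condition \<times> condition) set" where
  "failing_implications =
     {P1} \<times> {P3, P6, P7, P8} \<union>
     {P2} \<times> {P1, P3, P6, P7, P8} \<union>
     {P3} \<times> {P1, P2, P5, P7, P8} \<union>
     {P4} \<times> {P1, P2, P3, P5, P6, P7, P8} \<union>
     {P5} \<times> {P1, P2, P3, P6, P7, P8} \<union>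
     {P6} \<times> {P1, P2, P3, P5, P7, P8} \<union>
     {P7} \<times> {P1, P2, P3, P4, P5, P6, P8} \<union>
     {P8} \<times> {P1, P2, P5, P7}"

end

theory Submission
  imports Defs "HOL-Probability.Probability_Measure"
begin

text \<open>For \<open>B \<in> \<B>\<close> normalise: let \<open>N\<close> be the uniform probability on \<open>B\<close>, \<open>v = w / w\<^sub>B\<close>, and \<open>\<nu> = v N\<close>,
  again a probability. Every condition becomes a statement about the pair \<open>(N, v)\<close> with constants
  uniform in \<open>B\<close>: (P1) bounds \<open>\<integral> v powr (-r) dN\<close>, (P3) bounds \<open>\<integral> v powr e d\<nu>\<close>, and (P1'), (P3')
  compare \<open>N E\<close> with powers of \<open>\<nu> E\<close> and conversely. Since \<open>N = (1 / v) \<nu>\<close>, the pair (P1), (P1') is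
  the pair (P3), (P3') for \<open>(\<nu>, 1 / v)\<close>. The chain (P1), (P2), (P5), (P4) rests on Jensen's inequality
  in the form \<open>ln x \<le> x - 1\<close>, and (P8) implies (P3) because the tail \<open>\<nu> {v \<ge> \<lambda>}\<close> decays geometrically.

  All but one of the counterexamples are disjoint unions of two-atom blocks, for which (P7) is
  automatic. To violate (P7) under (P1) or (P8), one adds to each block many small sets that share
  the atom with the largest value.\<close>

section \<open>Densities of mean one\<close>

text \<open>The ratios in the conditions are invariant under scaling \<open>w\<close>, so all that
  has to be watched on the positive side is that each constant obtained for \<open>(N, v)\<close>
  depends only on the constants assumed, never on \<open>B\<close>. (P7) is the exception: its
  maximal function sees how the sets of the basis overlap, which no statement about a single pair
  \<open>(N, v)\<close> can express. Hence it is automatic on a disjoint basis, whatever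
  \<open>w\<close> does there, and can be destroyed by enlarging the basis while (P1) and (P8)
  survive.

  A single block of finitely many atoms with positive values satisfies all eight conditions with
  some constants. A counterexample therefore needs either a zero of the weight or a sequence of
  blocks whose constants degenerate; in the latter case the parameter \<open>k n\<close> tends to
  infinity and an assumed uniform constant is beaten by choosing \<open>n\<close> large.

  Nine refuted implications are enough. A failure from (PA) to (PB) persists when (PA) is replaced
  by one of its consequences and (PB) by a condition that implies it, and with the valid
  implications this fills the whole table.\<close>

lemma power_powr_swap: "0 < (x::real) \<Longrightarrow> (x ^ n) powr a = (x powr a) ^ n"
  using powr_realpow[of x n] powr_realpow[of "x powr a" n] powr_powr_swap[of x n a] by simp

text \<open>Layer-cake on the scale \<open>K ^ i\<close>: between consecutive levels
  \<open>u powr e\<close> is at most \<open>(K powr e) ^ Suc i\<close>, and the tail weights this by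
  \<open>\<rho> ^ i\<close>, which leaves a geometric series of ratio
  \<open>K powr e * \<rho>\<close>. It is applied to \<open>\<nu>\<close>, with tails coming from
  (P3') and from (P8).\<close>

lemma (in prob_space) nn_integral_powr_le_of_geometric_tail:
  fixes u :: "'a \<Rightarrow> real"
  assumes [measurable]: "u \<in> borel_measurable M" and nonneg: "\<And>x. x \<in> space M \<Longrightarrow> 0 \<le> u x"
    and K: "1 < K" and e: "0 < e" and C: "0 \<le> C" and \<rho>: "0 \<le> \<rho>" "K powr e * \<rho> < 1"
    and tail: "\<And>i. prob {x\<in>space M. K ^ i < u x} \<le> C * \<rho> ^ i"
  shows "(\<integral>\<^sup>+x. ennreal (u x powr e) \<partial>M) \<le> ennreal (1 + C * K powr e / (1 - K powr e * \<rho>))"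
proof -
  let ?L = "\<lambda>i. {x\<in>space M. K ^ i < u x}"
  have pw: "ennreal (u x powr e) \<le> 1 + (\<Sum>i. ennreal ((K powr e) ^ Suc i) * indicator (?L i) x)"
    if x: "x \<in> space M" for x
  proof (cases "u x \<le> 1")
    case True
    then have "u x powr e \<le> 1 powr e"
      using nonneg[OF x] e by (intro powr_mono2) auto
    then have "ennreal (u x powr e) \<le> 1" by simp
    then show ?thesis by (rule order_trans) simp
  next
    case False
    \<comment> \<open>\<open>u x\<close> lies in \<open>(K ^ i, K ^ n]\<close> with
      \<open>n = Suc i\<close>, so the single term of index \<open>i\<close> already dominates
      \<open>u x powr e\<close>.\<close>
    define n where "n = (LEAST n. u x \<le> K ^ n)"
    obtain n0 where "u x < K ^ n0" using real_arch_pow[OF K] by blast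
    then have n: "u x \<le> K ^ n" unfolding n_def by (metis LeastI less_imp_le)
    with False obtain i where i: "n = Suc i" by (cases n) auto
    have "\<not> u x \<le> K ^ i" using not_less_Least[of i "\<lambda>n. u x \<le> K ^ n"] i n_def by auto
    then have xi: "x \<in> ?L i" using x by auto
    have "u x powr e \<le> (K ^ Suc i) powr e"
      using nonneg[OF x] n i e by (intro powr_mono2) auto
    also have "\<dots> = (K powr e) ^ Suc i"
      using K by (intro power_powr_swap) simp
    finally have "ennreal (u x powr e) \<le> ennreal ((K powr e) ^ Suc i) * indicator (?L i) x"
      using xi by (simp add: ennreal_leI del: power_Suc)
    also have "\<dots> \<le> (\<Sum>i. ennreal ((K powr e) ^ Suc i) * indicator (?L i) x)"
      using sum_le_suminf[OF summableI, of "{i}" "\<lambda>i. ennreal ((K powr e) ^ Suc i) * indicator (?L i) x"]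
      by (simp only: finite.intros sum.insert sum.empty empty_iff not_False_eq_True add_0_right zero_le simp_thms)
    finally have *: "ennreal (u x powr e) \<le> (\<Sum>i. ennreal ((K powr e) ^ Suc i) * indicator (?L i) x)" .
    show ?thesis by (rule add_increasing[OF zero_le_one *])
  qed
  have sums: "(\<lambda>i. C * K powr e * (K powr e * \<rho>) ^ i) sums (C * K powr e * (1 / (1 - K powr e * \<rho>)))"
    using \<rho> by (intro sums_mult geometric_sums) simp
  have "(\<integral>\<^sup>+x. ennreal (u x powr e) \<partial>M)
      \<le> (\<integral>\<^sup>+x. 1 + (\<Sum>i. ennreal ((K powr e) ^ Suc i) * indicator (?L i) x) \<partial>M)"
    by (intro nn_integral_mono pw)
  also have "\<dots> = (\<integral>\<^sup>+x. 1 \<partial>M) + (\<integral>\<^sup>+x. (\<Sum>i. ennreal ((K powr e) ^ Suc i) * indicator (?L i) x) \<partial>M)"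
    by (rule nn_integral_add) measurable
  also have "(\<integral>\<^sup>+x. (\<Sum>i. ennreal ((K powr e) ^ Suc i) * indicator (?L i) x) \<partial>M)
      = (\<Sum>i. \<integral>\<^sup>+x. ennreal ((K powr e) ^ Suc i) * indicator (?L i) x \<partial>M)"
    by (rule nn_integral_suminf) measurable
  also have "\<dots> = (\<Sum>i. ennreal ((K powr e) ^ Suc i) * emeasure M (?L i))"
    by (intro suminf_cong nn_integral_cmult_indicator) measurable
  also have "\<dots> \<le> (\<Sum>i. ennreal (C * K powr e * (K powr e * \<rho>) ^ i))"
  proof (intro suminf_le summableI)
    fix i
    have "ennreal ((K powr e) ^ Suc i) * emeasure M (?L i)
        = ennreal ((K powr e) ^ Suc i * prob (?L i))"
      unfolding emeasure_eq_measure by (rule ennreal_mult[symmetric]) (rule zero_le_power, simp, simp)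
    also have "\<dots> \<le> ennreal ((K powr e) ^ Suc i * (C * \<rho> ^ i))"
      by (intro ennreal_leI mult_left_mono tail zero_le_power) simp
    also have "(K powr e) ^ Suc i * (C * \<rho> ^ i) = C * K powr e * (K powr e * \<rho>) ^ i"
      by (simp add: power_mult_distrib)
    finally show "ennreal ((K powr e) ^ Suc i) * emeasure M (?L i)
        \<le> ennreal (C * K powr e * (K powr e * \<rho>) ^ i)" .
  qed
  also have "\<dots> = ennreal (\<Sum>i. C * K powr e * (K powr e * \<rho>) ^ i)"
    using C \<rho>(1) sums_summable[OF sums] by (intro suminf_ennreal2) (auto intro!: mult_nonneg_nonneg)
  also have "(\<Sum>i. C * K powr e * (K powr e * \<rho>) ^ i) = C * K powr e / (1 - K powr e * \<rho>)"
    using sums_unique[OF sums] by simp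
  also have "(\<integral>\<^sup>+x. 1 \<partial>M) = ennreal 1" by (simp add: emeasure_space_1)
  also have "ennreal 1 + ennreal (C * K powr e / (1 - K powr e * \<rho>))
      = ennreal (1 + C * K powr e / (1 - K powr e * \<rho>))"
    using C \<rho> by (intro ennreal_plus[symmetric]) (auto intro!: mult_nonneg_nonneg)
  finally show ?thesis by (auto intro: add_left_mono)
qed

locale mean_one = prob_space +
  fixes v :: "'a \<Rightarrow> real"
  assumes measurable_v [measurable]: "v \<in> borel_measurable M"
    and nonneg: "x \<in> space M \<Longrightarrow> 0 \<le> v x"
    and mean: "(\<integral>\<^sup>+x. ennreal (v x) \<partial>M) = 1"
begin

abbreviation \<nu> where "\<nu> \<equiv> density M (\<lambda>x. ennreal (v x))"

lemma emeasure_\<nu>: "E \<in> sets M \<Longrightarrow> emeasure \<nu> E = (\<integral>\<^sup>+x. ennreal (v x) * indicator E x \<partial>M)"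
  by (simp add: emeasure_density)

sublocale \<nu>: prob_space \<nu>
  by (rule prob_spaceI) (simp add: emeasure_density mean cong: nn_integral_cong)

lemma \<nu>_le_mult_prob:
  assumes "E \<in> sets M" "\<And>x. x \<in> E \<Longrightarrow> v x \<le> T" "0 \<le> T"
  shows "measure \<nu> E \<le> T * prob E"
proof -
  have "emeasure \<nu> E \<le> (\<integral>\<^sup>+x. ennreal T * indicator E x \<partial>M)"
    unfolding emeasure_\<nu>[OF assms(1)] using assms(2)
    by (intro nn_integral_mono) (auto split: split_indicator intro: ennreal_leI)
  also have "\<dots> = ennreal (T * prob E)"
    using assms by (simp add: nn_integral_cmult_indicator emeasure_eq_measure ennreal_mult)
  finally show ?thesis using assms(3) by (simp add: \<nu>.emeasure_eq_measure)
qed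

lemma mult_prob_le_\<nu>:
  assumes "E \<in> sets M" "\<And>x. x \<in> E \<Longrightarrow> T \<le> v x" "0 \<le> T"
  shows "T * prob E \<le> measure \<nu> E"
proof -
  have "ennreal (T * prob E) = (\<integral>\<^sup>+x. ennreal T * indicator E x \<partial>M)"
    using assms by (simp add: nn_integral_cmult_indicator emeasure_eq_measure ennreal_mult)
  also have "\<dots> \<le> emeasure \<nu> E"
    unfolding emeasure_\<nu>[OF assms(1)] using assms(2)
    by (intro nn_integral_mono) (auto split: split_indicator intro: ennreal_leI)
  finally show ?thesis using assms(3) by (simp add: \<nu>.emeasure_eq_measure)
qed

text \<open>Split at a threshold \<open>T\<close>: below it the density bounds \<open>\<nu>\<close>
  by \<open>T * prob\<close>, above it Chebyshev's inequality under \<open>\<nu>\<close> uses the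
  moment.\<close>

lemma \<nu>_le_of_moment:
  assumes e: "0 < e" and C: "0 \<le> C" "(\<integral>\<^sup>+x. ennreal (v x powr e) \<partial>\<nu>) \<le> ennreal C"
    and E: "E \<in> sets M"
  shows "measure \<nu> E \<le> (1 + C) * prob E powr (e / (1 + e))"
proof (cases "prob E = 0")
  case True
  then have "E \<in> null_sets M" using E by (auto simp: emeasure_eq_measure)
  then have "emeasure \<nu> E = 0"
    unfolding emeasure_\<nu>[OF E] by (rule nn_integral_null_set)
  then show ?thesis using True by (simp add: \<nu>.emeasure_eq_measure)
next
  case False
  then have pos: "0 < prob E" by (simp add: zero_less_measure_iff)
  \<comment> \<open>This threshold balances the two parts: \<open>T * prob E\<close> and the
    Chebyshev factor \<open>T powr (- e)\<close> both equal
    \<open>prob E powr (e / (1 + e))\<close>.\<close>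
  define T where "T = prob E powr (- 1 / (1 + e))"
  have T: "0 < T" using pos by (simp add: T_def)
  have [measurable]: "E \<in> sets M" by fact
  let ?A = "{x\<in>space M. x \<in> E \<and> v x \<le> T}" and ?B = "{x\<in>space M. T < v x}"
  have "ennreal (T powr e * measure \<nu> ?B) = (\<integral>\<^sup>+x. ennreal (T powr e) * indicator ?B x \<partial>\<nu>)"
    by (subst nn_integral_cmult_indicator) (auto simp: \<nu>.emeasure_eq_measure ennreal_mult)
  also have "\<dots> \<le> (\<integral>\<^sup>+x. ennreal (v x powr e) \<partial>\<nu>)"
    using T e by (intro nn_integral_mono) (auto split: split_indicator intro!: ennreal_leI powr_mono2)
  also note C(2)
  finally have B: "T powr e * measure \<nu> ?B \<le> C" using C(1) by simp
  have "measure \<nu> E \<le> measure \<nu> (?A \<union> ?B)"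
    using sets.sets_into_space[OF E] by (intro \<nu>.finite_measure_mono) auto
  also have "\<dots> \<le> measure \<nu> ?A + measure \<nu> ?B"
    by (intro measure_Un_le) auto
  also have "measure \<nu> ?A \<le> T * prob ?A"
    using T by (intro \<nu>_le_mult_prob) auto
  also have "\<dots> \<le> T * prob E"
    using T by (intro mult_left_mono finite_measure_mono) auto
  also have "T * prob E = prob E powr (e / (1 + e))"
  proof -
    have "T * prob E = prob E powr (- 1 / (1 + e)) * prob E powr 1" using pos by (simp add: T_def)
    also have "\<dots> = prob E powr (- 1 / (1 + e) + 1)" by (simp only: powr_add)
    also have "- 1 / (1 + e) + 1 = e / (1 + e)" using e by (simp add: field_simps)
    finally show ?thesis .
  qed
  also have "measure \<nu> ?B \<le> C * prob E powr (e / (1 + e))"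
  proof -
    have "T powr e = prob E powr (- (e / (1 + e)))" by (simp add: T_def powr_powr)
    then have "T powr e * prob E powr (e / (1 + e)) = 1"
      using pos by (simp add: powr_minus)
    then have "measure \<nu> ?B = (T powr e * measure \<nu> ?B) * prob E powr (e / (1 + e))"
      by (simp add: algebra_simps)
    also have "\<dots> \<le> C * prob E powr (e / (1 + e))" by (intro mult_right_mono B) simp
    finally show ?thesis .
  qed
  finally show ?thesis by (simp add: algebra_simps)
qed

text \<open>Applying the hypothesis to the level sets \<open>{v > \<lambda>}\<close>, where \<open>\<lambda> prob \<le> \<nu>\<close>, turns it into
  the tail bound \<open>\<nu> {v > \<lambda>} \<le> A \<lambda> powr (-\<theta>)\<close>.\<close>

lemma moment_le_of_\<nu>_le:
  fixes \<delta> C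
  defines "d \<equiv> min \<delta> (1/2)"
  defines "\<theta> \<equiv> d / (1 - d)" and "A \<equiv> C powr (1 / (1 - d))"
  assumes \<delta>: "0 < \<delta>" and C: "0 < C"
    and le: "\<And>E. E \<in> sets M \<Longrightarrow> measure \<nu> E \<le> C * prob E powr \<delta>"
  shows "(\<integral>\<^sup>+x. ennreal (v x powr (\<theta> / 2)) \<partial>\<nu>)
    \<le> ennreal (1 + A * 2 powr (\<theta> / 2) / (1 - 2 powr (- \<theta> / 2)))"
proof -
  \<comment> \<open>Lowering \<open>\<delta>\<close> to \<open>d\<close> only weakens the bound,
    since \<open>prob\<close> is at most 1; \<open>d < 1\<close> is what later lets
    \<open>F powr d\<close> be absorbed into \<open>F\<close>.\<close>
  have d: "0 < d" "d < 1" "d \<le> \<delta>" using \<delta> by (auto simp: d_def)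
  then have \<theta>: "0 < \<theta>" by (simp add: \<theta>_def)
  have tail: "measure \<nu> {x\<in>space M. l < v x} \<le> A * l powr (-\<theta>)" if l: "0 < l" for l
  proof -
    define F where "F = measure \<nu> {x\<in>space M. l < v x}"
    define P where "P = prob {x\<in>space M. l < v x}"
    have lP: "l * P \<le> F" unfolding F_def P_def using l by (intro mult_prob_le_\<nu>) auto
    show ?thesis
    proof (cases "F = 0")
      case True then show ?thesis unfolding F_def A_def by simp
    next
      case False
      then have F: "0 < F" unfolding F_def by (simp add: zero_less_measure_iff)
      have "F \<le> C * P powr \<delta>" unfolding F_def P_def by (intro le) auto
      also have "\<dots> \<le> C * P powr d"
        using d C unfolding P_def by (intro mult_left_mono powr_mono') auto
      also have "\<dots> \<le> C * (F / l) powr d"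
        using lP l d C by (intro mult_left_mono powr_mono2) (auto simp: P_def field_simps)
      also have "\<dots> = C * l powr (-d) * F powr d"
        using F l by (simp add: powr_divide powr_minus field_simps)
      finally have "F * F powr (-d) \<le> C * l powr (-d) * F powr d * F powr (-d)"
        by (intro mult_right_mono) auto
      also have "\<dots> = C * l powr (-d)" using F by (simp add: powr_minus field_simps)
      also have "F * F powr (-d) = F powr (1 - d)"
        using F by (simp add: powr_diff powr_minus field_simps)
      finally have "(F powr (1 - d)) powr (1 / (1 - d)) \<le> (C * l powr (-d)) powr (1 / (1 - d))"
        using d by (intro powr_mono2) auto
      then show ?thesis
        using F d C l by (simp add: powr_powr powr_mult A_def \<theta>_def F_def)
    qed
  qed
  \<comment> \<open>Half of the decay exponent \<open>\<theta>\<close> is spent on the moment; the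
    other half keeps the dyadic series convergent.\<close>
  have \<rho>: "2 powr (\<theta> / 2) * 2 powr (- \<theta>) = (2::real) powr (- \<theta> / 2)"
    by (simp flip: powr_add)
  have "(\<integral>\<^sup>+x. ennreal (v x powr (\<theta> / 2)) \<partial>\<nu>)
    \<le> ennreal (1 + A * 2 powr (\<theta> / 2) / (1 - 2 powr (\<theta> / 2) * 2 powr (- \<theta>)))"
  proof (rule \<nu>.nn_integral_powr_le_of_geometric_tail)
    fix i
    show "measure \<nu> {x \<in> space \<nu>. 2 ^ i < v x} \<le> A * (2 powr (- \<theta>)) ^ i"
      using tail[of "2 ^ i"] by (simp add: power_powr_swap)
    show "2 powr (\<theta> / 2) * 2 powr (- \<theta>) < (1::real)" unfolding \<rho>
      using \<theta> powr_less_mono[of "-\<theta>/2" 0 "2::real"] by simp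
    show "u \<in> space \<nu> \<Longrightarrow> 0 \<le> v u" for u using nonneg by simp
    show "0 < \<theta> / 2" using \<theta> by simp
    show "0 \<le> A" by (simp add: A_def)
  qed simp_all
  then show ?thesis unfolding \<rho> .
qed

end

section \<open>Negative moments, by duality\<close>

lemma epowr_ennreal_neg:
  assumes "0 \<le> x" "0 < r"
  shows "epowr (ennreal x) (- r) = (if x = 0 then \<infinity> else ennreal ((1 / x) powr r))"
  using assms by (auto simp: epowr_def powr_minus_divide powr_divide)

context mean_one
begin

text \<open>Positivity matters: where \<open>v\<close> vanishes, \<open>\<nu>\<close> has no mass
  and no density with respect to it could recover \<open>M\<close>.\<close>

lemma dual:
  assumes pos: "AE x in M. 0 < v x"
  shows "mean_one \<nu> (\<lambda>x. 1 / v x)" "density \<nu> (\<lambda>x. ennreal (1 / v x)) = M"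
proof -
  have eq: "AE x in M. ennreal (v x) * ennreal (1 / v x) = 1"
    using pos by eventually_elim (simp flip: ennreal_mult)
  show "density \<nu> (\<lambda>x. ennreal (1 / v x)) = M"
    by (subst density_density_eq) (auto simp: density_cong[OF _ _ eq] density_1)
  have "(\<integral>\<^sup>+x. ennreal (1 / v x) \<partial>\<nu>) = (\<integral>\<^sup>+x. ennreal (v x) * ennreal (1 / v x) \<partial>M)"
    by (subst nn_integral_density) auto
  also have "\<dots> = (\<integral>\<^sup>+x. 1 \<partial>M)" by (rule nn_integral_cong_AE[OF eq])
  finally show "mean_one \<nu> (\<lambda>x. 1 / v x)"
    by unfold_locales (auto simp: emeasure_space_1 nonneg)
qed

text \<open>The integrand is infinite wherever \<open>v\<close> is zero, so a finite integral makes
  that set null.\<close>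

lemma AE_pos_of_neg_moment:
  assumes "0 < r" "(\<integral>\<^sup>+x. epowr (ennreal (v x)) (- r) \<partial>M) \<le> ennreal C"
  shows "AE x in M. 0 < v x"
proof -
  have eq: "(\<integral>\<^sup>+x. epowr (ennreal (v x)) (- r) \<partial>M)
      = (\<integral>\<^sup>+x. (if v x = 0 then \<infinity> else ennreal ((1 / v x) powr r)) \<partial>M)"
    using assms(1) by (intro nn_integral_cong epowr_ennreal_neg nonneg)
  then have "(\<integral>\<^sup>+x. (if v x = 0 then \<infinity> else ennreal ((1 / v x) powr r)) \<partial>M) \<noteq> \<infinity>"
    using assms(2) by (auto simp: top_unique)
  then have "AE x in M. (if v x = 0 then \<infinity> else ennreal ((1 / v x) powr r)) \<noteq> \<infinity>"
    by (intro nn_integral_PInf_AE) simp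
  then show ?thesis
    using AE_space by eventually_elim (use nonneg in \<open>auto simp: order_less_le split: if_splits\<close>)
qed

lemma nn_integral_epowr_neg:
  assumes "0 < r" "AE x in M. 0 < v x"
  shows "(\<integral>\<^sup>+x. epowr (ennreal (v x)) (- r) \<partial>M) = (\<integral>\<^sup>+x. ennreal ((1 / v x) powr r) \<partial>M)"
  using assms(2) by (intro nn_integral_cong_AE, eventually_elim) (simp add: epowr_ennreal_neg assms(1))

text \<open>This is \<open>\<nu>_le_of_moment\<close> for the pair \<open>(\<nu>, 1 / v)\<close>: by
  \<open>dual\<close>, \<open>M\<close> takes the place of the weighted measure and the negative
  moment of \<open>v\<close> becomes a positive one.\<close>

lemma prob_le_of_neg_moment:
  assumes r: "0 < r" and C: "0 \<le> C" "(\<integral>\<^sup>+x. epowr (ennreal (v x)) (- r) \<partial>M) \<le> ennreal C"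
    and E: "E \<in> sets M"
  shows "prob E \<le> (1 + C) * measure \<nu> E powr (r / (1 + r))"
proof -
  note pos = AE_pos_of_neg_moment[OF r C(2)]
  interpret d: mean_one \<nu> "\<lambda>x. 1 / v x" by (rule dual[OF pos])
  show ?thesis
    using d.\<nu>_le_of_moment[OF r C(1)] C(2) E
    by (simp add: dual(2)[OF pos] nn_integral_epowr_neg[OF r pos])
qed

lemma neg_moment_le_of_prob_le:
  fixes \<delta> C
  defines "d \<equiv> min \<delta> (1/2)"
  defines "\<theta> \<equiv> d / (1 - d)" and "A \<equiv> C powr (1 / (1 - d))"
  assumes \<delta>: "0 < \<delta>" and C: "0 < C"
    and le: "\<And>E. E \<in> sets M \<Longrightarrow> prob E \<le> C * measure \<nu> E powr \<delta>"
  shows "(\<integral>\<^sup>+x. epowr (ennreal (v x)) (- (\<theta> / 2)) \<partial>M)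
    \<le> ennreal (1 + A * 2 powr (\<theta> / 2) / (1 - 2 powr (- \<theta> / 2)))"
proof -
  have \<theta>: "0 < \<theta>" using \<delta> by (auto simp: \<theta>_def d_def)
  \<comment> \<open>Duality needs \<open>v\<close> positive first: the zero set has
    \<open>\<nu>\<close>-measure 0, and since \<open>0 powr \<delta> = 0\<close> the hypothesis
    makes it null for \<open>M\<close> as well.\<close>
  let ?Z = "{x\<in>space M. v x \<le> 0}"
  have "measure \<nu> ?Z \<le> 0 * prob ?Z" by (intro \<nu>_le_mult_prob) auto
  then have "prob ?Z \<le> 0" using le[of ?Z] by (simp add: measure_le_0_iff)
  then have "emeasure M ?Z = 0" by (simp add: emeasure_eq_measure measure_le_0_iff)
  then have pos: "AE x in M. 0 < v x"
    by (subst AE_iff_measurable[OF _ refl]) (auto simp: not_less)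
  interpret d: mean_one \<nu> "\<lambda>x. 1 / v x" by (rule dual[OF pos])
  have "0 < \<theta> / 2" using \<theta> by simp
  then show ?thesis
    using d.moment_le_of_\<nu>_le[OF \<delta> C] le
    unfolding dual(2)[OF pos] nn_integral_epowr_neg[OF \<open>0 < \<theta> / 2\<close> pos] d_def[symmetric]
      \<theta>_def[symmetric] A_def[symmetric] by simp
qed

section \<open>Quantitative absolute continuity and L log L\<close>

text \<open>Otherwise the complement of the level set is so small that \<open>\<nu>\<close> gives it
  at most \<open>\<beta>\<close>. The level set then carries at least \<open>1 - \<beta>\<close>,
  whereas the bound on \<open>v\<close> there allows only half of that.\<close>

lemma prob_le_of_absolute_continuity:
  assumes \<alpha>: "0 < \<alpha>" "\<alpha> < 1" and \<beta>: "0 < \<beta>" "\<beta> < 1"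
    and ac: "\<And>E. E \<in> sets M \<Longrightarrow> prob E < \<alpha> \<Longrightarrow> measure \<nu> E \<le> \<beta>"
  shows "prob {x\<in>space M. v x \<le> (1 - \<beta>) / 2} \<le> 1 - \<alpha> / 2"
proof (rule ccontr)
  let ?A = "{x\<in>space M. v x \<le> (1 - \<beta>) / 2}"
  assume "\<not> prob ?A \<le> 1 - \<alpha> / 2"
  then have "prob (space M - ?A) < \<alpha>" using \<alpha> by (subst prob_compl) auto
  then have "measure \<nu> (space \<nu> - ?A) \<le> \<beta>" by (intro ac) auto
  then have "1 - measure \<nu> ?A \<le> \<beta>" by (subst (asm) \<nu>.prob_compl) auto
  moreover have "measure \<nu> ?A \<le> (1 - \<beta>) / 2 * prob ?A"
    using \<beta> by (intro \<nu>_le_mult_prob) auto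
  then have "measure \<nu> ?A \<le> (1 - \<beta>) / 2 * 1"
    by (rule order_trans) (use \<beta> in \<open>intro mult_left_mono; auto\<close>)
  ultimately show False using \<beta> by argo
qed

text \<open>Outside both \<open>E\<close> and the low level set there remains mass at least
  \<open>(1 - \<beta>) / 2\<close>, on which \<open>v\<close> exceeds \<open>\<alpha>\<close>; this
  much of \<open>\<nu>\<close> cannot lie in \<open>E\<close>.\<close>

lemma absolute_continuity_of_prob_le:
  assumes \<alpha>: "0 < \<alpha>" and le: "prob {x\<in>space M. v x \<le> \<alpha>} \<le> \<beta>"
    and E: "E \<in> sets M" "prob E < (1 - \<beta>) / 2"
  shows "measure \<nu> E \<le> 1 - \<alpha> * (1 - \<beta>) / 2"
proof -
  let ?A = "{x\<in>space M. v x \<le> \<alpha>}"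
  note [measurable] = E(1)
  have "1 - prob ?A = prob (space M - ?A)" by (subst prob_compl) auto
  also have "\<dots> \<le> prob ((space M - ?A - E) \<union> E)" by (intro finite_measure_mono) auto
  also have "\<dots> \<le> prob (space M - ?A - E) + prob E" by (intro measure_Un_le) auto
  finally have "(1 - \<beta>) / 2 \<le> prob (space M - ?A - E)" using le E(2) by simp
  then have "\<alpha> * ((1 - \<beta>) / 2) \<le> \<alpha> * prob (space M - ?A - E)"
    using \<alpha> by simp
  also have "\<dots> \<le> measure \<nu> (space M - ?A - E)"
    using \<alpha> by (intro mult_prob_le_\<nu>) auto
  also have "\<dots> \<le> measure \<nu> (space \<nu> - E)" by (intro \<nu>.finite_measure_mono) auto
  also have "\<dots> = 1 - measure \<nu> E" by (subst \<nu>.prob_compl) auto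
  finally show ?thesis by simp
qed

text \<open>Above \<open>T = exp (4 * C)\<close> the logarithm is at least \<open>4 * C\<close>, so
  the part of \<open>\<nu>\<close> there is at most 1/4. Below \<open>T\<close>, smallness of
  \<open>prob E\<close> gives another 1/4.\<close>

lemma absolute_continuity_of_LlogL:
  assumes C: "0 < C" and le: "(\<integral>\<^sup>+x. ennreal (v x * log_plus (v x)) \<partial>M) \<le> ennreal C"
    and E: "E \<in> sets M" "prob E < exp (- 4 * C) / 4"
  shows "measure \<nu> E \<le> 1 / 2"
proof -
  define T where "T = exp (4 * C)"
  note [measurable] = E(1)
  let ?A = "{x\<in>space M. x \<in> E \<and> v x \<le> T}" and ?B = "{x\<in>space M. T < v x}"
  have "ennreal (4 * C * measure \<nu> ?B) = ennreal (4 * C) * (\<integral>\<^sup>+x. ennreal (v x) * indicator ?B x \<partial>M)"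
    using C by (simp add: ennreal_mult flip: emeasure_\<nu> \<nu>.emeasure_eq_measure)
  also have "\<dots> = (\<integral>\<^sup>+x. ennreal (4 * C) * (ennreal (v x) * indicator ?B x) \<partial>M)"
    by (rule nn_integral_cmult[symmetric]) simp
  also have "\<dots> \<le> (\<integral>\<^sup>+x. ennreal (v x * log_plus (v x)) \<partial>M)"
  proof (intro nn_integral_mono)
    fix x assume "x \<in> space M"
    show "ennreal (4 * C) * (ennreal (v x) * indicator ?B x) \<le> ennreal (v x * log_plus (v x))"
    proof (cases "x \<in> ?B")
      case True
      then have x: "T < v x" "0 < v x" using less_trans[of 0 T "v x"] by (auto simp: T_def)
      then have "4 * C \<le> log_plus (v x)"
        by (simp add: log_plus_def T_def le_max_iff_disj ln_ge_iff)
      then have "4 * C * v x \<le> v x * log_plus (v x)" using x by (simp add: mult.commute)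
      then show ?thesis using True x C by (simp add: ennreal_leI flip: ennreal_mult)
    qed simp
  qed
  also note le
  finally have B: "measure \<nu> ?B \<le> 1 / 4" using C by simp
  have "measure \<nu> E \<le> measure \<nu> (?A \<union> ?B)"
    using sets.sets_into_space[OF E(1)] by (intro \<nu>.finite_measure_mono) auto
  also have "\<dots> \<le> measure \<nu> ?A + measure \<nu> ?B"
    by (intro measure_Un_le) auto
  also have "measure \<nu> ?A \<le> T * prob ?A"
    by (intro \<nu>_le_mult_prob) (auto simp: T_def)
  also have "\<dots> \<le> T * prob E"
    by (intro mult_left_mono finite_measure_mono) (auto simp: T_def)
  also have "\<dots> \<le> T * (exp (- 4 * C) / 4)"
    using E(2) by (intro mult_left_mono) (auto simp: T_def)
  also have "\<dots> = 1 / 4" by (simp add: T_def exp_minus)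
  finally show ?thesis using B by simp
qed

text \<open>A logarithm is dominated by any power: \<open>ln y \<le> y - 1\<close> at
  \<open>y = v x powr e\<close> yields \<open>log_plus (v x) \<le> v x powr e / e\<close>.\<close>

lemma LlogL_of_moment:
  assumes e: "0 < e" and C: "(\<integral>\<^sup>+x. ennreal (v x powr e) \<partial>\<nu>) \<le> ennreal C"
  shows "(\<integral>\<^sup>+x. ennreal (v x * log_plus (v x)) \<partial>M) \<le> ennreal (C / e)"
proof -
  have "(\<integral>\<^sup>+x. ennreal (v x * log_plus (v x)) \<partial>M)
      \<le> (\<integral>\<^sup>+x. ennreal (1 / e) * (ennreal (v x) * ennreal (v x powr e)) \<partial>M)"
  proof (intro nn_integral_mono)
    fix x assume "x \<in> space M"
    then have x: "0 \<le> v x" by (rule nonneg)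
    have "log_plus (v x) \<le> v x powr e / e"
    proof (cases "v x = 0")
      case False
      then have "e * ln (v x) \<le> v x powr e"
        using ln_le_minus_one[of "v x powr e"] x by (simp add: ln_powr)
      then show ?thesis using e False by (simp add: log_plus_def field_simps)
    qed (simp add: log_plus_def)
    then have "v x * log_plus (v x) \<le> v x * (v x powr e / e)" using x by (rule mult_left_mono)
    then show "ennreal (v x * log_plus (v x)) \<le> ennreal (1 / e) * (ennreal (v x) * ennreal (v x powr e))"
      using x e by (simp add: ennreal_leI mult.commute flip: ennreal_mult)
  qed
  also have "\<dots> = ennreal (1 / e) * (\<integral>\<^sup>+x. ennreal (v x powr e) \<partial>\<nu>)"
    by (simp add: nn_integral_cmult nn_integral_density)
  also have "\<dots> \<le> ennreal (1 / e) * ennreal C" by (rule mult_left_mono[OF C]) simp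
  also have "\<dots> = ennreal (C / e)" using e by (simp flip: ennreal_mult')
  finally show ?thesis .
qed

end

text \<open>The levels \<open>\<mu> / b ^ j\<close> below \<open>v\<close> sum to at most \<open>v / (1 - b)\<close>. Adding up the hypothesis
  at \<open>J\<close> consecutive levels therefore bounds \<open>J \<nu> {v \<ge> \<mu> / b ^ J}\<close> by a fixed multiple of
  \<open>\<nu> {v \<ge> \<mu>}\<close>: the tail halves after \<open>J\<close> levels.\<close>

lemma sum_levels_le:
  fixes b :: real
  assumes b: "0 < b" "b < 1" and \<mu>: "0 < \<mu>"
  shows "(\<Sum>j<J. \<mu> / b ^ j * indicator {x. \<mu> / b ^ j \<le> x} t) \<le> t / (1 - b) * indicator {x. \<mu> \<le> x} t"
proof (cases "\<mu> \<le> t")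
  case False
  have "\<mu> \<le> \<mu> / b ^ j" for j
    using b \<mu> by (simp add: le_divide_eq power_le_one mult_left_le)
  then have "\<not> \<mu> / b ^ j \<le> t" for j using False order_trans by blast
  then show ?thesis using False by simp
next
  case True
  have full: "(\<Sum>j<Suc J. \<mu> / b ^ j) \<le> \<mu> / b ^ J / (1 - b)" for J
  proof (induction J)
    case 0 then show ?case using b \<mu> by (simp add: le_divide_eq mult_left_le)
  next
    case (Suc J)
    have "\<mu> / b ^ J / (1 - b) + \<mu> / b ^ Suc J = \<mu> / b ^ Suc J / (1 - b)"
      using b \<mu> by (simp add: field_simps)
    with Suc show ?case by simp
  qed
  have "(\<Sum>j<J. \<mu> / b ^ j * indicator {x. \<mu> / b ^ j \<le> x} t) \<le> t / (1 - b)"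
  proof (induction J)
    case 0 then show ?case using True \<mu> b by simp
  next
    case (Suc J)
    \<comment> \<open>If the new top level is below \<open>t\<close>, the whole sum is bounded by
      its largest term over \<open>1 - b\<close>; if not, the new term vanishes.\<close>
    show ?case
    proof (cases "\<mu> / b ^ J \<le> t")
      case True
      have "(\<Sum>j<Suc J. \<mu> / b ^ j * indicator {x. \<mu> / b ^ j \<le> x} t) \<le> (\<Sum>j<Suc J. \<mu> / b ^ j)"
        using b \<mu> by (intro sum_mono) (auto split: split_indicator)
      also have "\<dots> \<le> \<mu> / b ^ J / (1 - b)" by (rule full)
      also have "\<dots> \<le> t / (1 - b)" using True b by (intro divide_right_mono) auto
      finally show ?thesis .
    qed (use Suc in simp)
  qed
  then show ?thesis using True by simp
qed

context mean_one
begin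

lemma moment_le_of_weak_type:
  fixes C \<beta>
  defines "b \<equiv> min \<beta> (1/2)"
  defines "J \<equiv> nat \<lceil>2 * C / (b * (1 - b))\<rceil>"
  assumes C: "0 < C" and \<beta>: "0 < \<beta>"
    and weak: "\<And>l. 1 < l \<Longrightarrow>
      measure \<nu> {x\<in>space M. l \<le> v x} \<le> C * l * prob {x\<in>space M. \<beta> * l \<le> v x}"
  shows "(\<integral>\<^sup>+x. ennreal (v x powr (ln 2 / (2 * ln (1 / b ^ J)))) \<partial>\<nu>)
    \<le> ennreal (1 + sqrt 2 / (1 - sqrt 2 / 2))"
proof -
  have b: "0 < b" "b \<le> \<beta>" "b < 1" using \<beta> by (auto simp: b_def)
  have J: "2 * C / (b * (1 - b)) \<le> real J" unfolding J_def by linarith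
  have "0 < 2 * C / (b * (1 - b))" using C b by simp
  with J have "0 < J" using of_nat_0_less_iff[of J, where ?'a = real] by linarith
  let ?F = "\<lambda>l. measure \<nu> {x\<in>space M. l \<le> v x}" and ?P = "\<lambda>l. prob {x\<in>space M. l \<le> v x}"
  \<comment> \<open>Shrinking \<open>\<beta>\<close> to \<open>b\<close> enlarges the set on the
    right, so the hypothesis survives with a ratio below 1.\<close>
  have weak': "?F l \<le> C * l * ?P (b * l)" if "1 < l" for l
  proof -
    have "b * l \<le> \<beta> * l" using that b by simp
    then have "prob {x\<in>space M. \<beta> * l \<le> v x} \<le> ?P (b * l)"
      by (intro finite_measure_mono) (auto intro: order_trans)
    then have "C * l * prob {x\<in>space M. \<beta> * l \<le> v x} \<le> C * l * ?P (b * l)"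
      using C that by (intro mult_left_mono) auto
    with weak[OF that] show ?thesis by simp
  qed
  have levels: "(\<Sum>j<J. \<mu> / b ^ j * ?P (\<mu> / b ^ j)) \<le> ?F \<mu> / (1 - b)" if \<mu>: "1 \<le> \<mu>" for \<mu>
  proof -
    have pos: "0 < \<mu> / b ^ j" for j using b \<mu> by simp
    have "ennreal (\<Sum>j<J. \<mu> / b ^ j * ?P (\<mu> / b ^ j))
        = (\<Sum>j<J. ennreal (\<mu> / b ^ j * ?P (\<mu> / b ^ j)))"
      by (intro sum_ennreal[symmetric] mult_nonneg_nonneg less_imp_le[OF pos] measure_nonneg)
    also have "\<dots> = (\<Sum>j<J. ennreal (\<mu> / b ^ j) * emeasure M {x\<in>space M. \<mu> / b ^ j \<le> v x})"
      by (intro sum.cong refl)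
        (simp only: emeasure_eq_measure ennreal_mult[OF less_imp_le[OF pos] measure_nonneg])
    also have "\<dots> = (\<Sum>j<J. \<integral>\<^sup>+x. ennreal (\<mu> / b ^ j) * indicator {x\<in>space M. \<mu> / b ^ j \<le> v x} x \<partial>M)"
      by (intro sum.cong refl nn_integral_cmult_indicator[symmetric]) measurable
    also have "\<dots> = (\<integral>\<^sup>+x. (\<Sum>j<J. ennreal (\<mu> / b ^ j) * indicator {x\<in>space M. \<mu> / b ^ j \<le> v x} x) \<partial>M)"
      by (rule nn_integral_sum[symmetric]) measurable
    also have "\<dots> \<le> (\<integral>\<^sup>+x. ennreal (1 / (1 - b)) * (ennreal (v x) * indicator {x\<in>space M. \<mu> \<le> v x} x) \<partial>M)"
    proof (intro nn_integral_mono)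
      fix x assume x: "x \<in> space M"
      have "(\<Sum>j<J. ennreal (\<mu> / b ^ j) * indicator {x\<in>space M. \<mu> / b ^ j \<le> v x} x)
          = (\<Sum>j<J. ennreal (\<mu> / b ^ j * indicator {t. \<mu> / b ^ j \<le> t} (v x)))"
        using x by (intro sum.cong) (auto split: split_indicator)
      also have "\<dots> = ennreal (\<Sum>j<J. \<mu> / b ^ j * indicator {t. \<mu> / b ^ j \<le> t} (v x))"
        by (intro sum_ennreal mult_nonneg_nonneg less_imp_le[OF pos] indicator_pos_le)
      also have "\<dots> \<le> ennreal (v x / (1 - b) * indicator {t. \<mu> \<le> t} (v x))"
        using b \<mu> by (intro ennreal_leI sum_levels_le) auto
      also have "\<dots> = ennreal (1 / (1 - b)) * (ennreal (v x) * indicator {x\<in>space M. \<mu> \<le> v x} x)"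
        using x nonneg[OF x] b by (auto simp flip: ennreal_mult split: split_indicator)
      finally show "(\<Sum>j<J. ennreal (\<mu> / b ^ j) * indicator {x\<in>space M. \<mu> / b ^ j \<le> v x} x)
        \<le> ennreal (1 / (1 - b)) * (ennreal (v x) * indicator {x\<in>space M. \<mu> \<le> v x} x)" .
    qed
    also have "\<dots> = ennreal (1 / (1 - b)) * emeasure \<nu> {x\<in>space M. \<mu> \<le> v x}"
      by (subst nn_integral_cmult) (auto simp: emeasure_\<nu>)
    also have "\<dots> = ennreal (?F \<mu> / (1 - b))"
      using b by (simp add: \<nu>.emeasure_eq_measure flip: ennreal_mult)
    finally show ?thesis using b by simp
  qed
  have half: "?F (\<mu> / b ^ J) \<le> ?F \<mu> / 2" if \<mu>: "1 \<le> \<mu>" for \<mu>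
  proof -
    \<comment> \<open>The weak type inequality moves one level down, so it is used at
      \<open>\<mu> / b ^ Suc j\<close>. The extra factor also makes that level exceed 1, as the
      hypothesis demands, even for \<open>\<mu> = 1\<close>.\<close>
    have step: "?F (\<mu> / b ^ J) \<le> C / b * (\<mu> / b ^ j * ?P (\<mu> / b ^ j))" if j: "j < J" for j
    proof -
      have "b ^ J \<le> b ^ Suc j" using j b by (intro power_decreasing) auto
      then have "\<mu> / b ^ Suc j \<le> \<mu> / b ^ J" using b \<mu> by (intro divide_left_mono) auto
      then have "?F (\<mu> / b ^ J) \<le> ?F (\<mu> / b ^ Suc j)"
        by (intro \<nu>.finite_measure_mono) (auto intro: order_trans)
      also have "\<dots> \<le> C * (\<mu> / b ^ Suc j) * ?P (b * (\<mu> / b ^ Suc j))"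
      proof (rule weak')
        have "0 < b ^ Suc j" "b ^ Suc j < 1" using b by (auto intro: power_Suc_less_one simp del: power_Suc)
        then show "1 < \<mu> / b ^ Suc j" using \<mu> by (simp add: less_divide_eq del: power_Suc)
      qed
      also have "b * (\<mu> / b ^ Suc j) = \<mu> / b ^ j" using b by simp
      finally show ?thesis using b by (simp add: field_simps)
    qed
    \<comment> \<open>Averaging \<open>J\<close> copies of the same quantity over the levels:
      \<open>J\<close> was chosen at least \<open>2 * C / (b * (1 - b))\<close> so that the total
      constant is absorbed and 1/2 is left.\<close>
    have "real J * ?F (\<mu> / b ^ J) = (\<Sum>j<J. ?F (\<mu> / b ^ J))" by simp
    also have "\<dots> \<le> (\<Sum>j<J. C / b * (\<mu> / b ^ j * ?P (\<mu> / b ^ j)))" by (intro sum_mono step) simp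
    also have "\<dots> = C / b * (\<Sum>j<J. \<mu> / b ^ j * ?P (\<mu> / b ^ j))" by (simp add: sum_distrib_left)
    also have "\<dots> \<le> C / b * (?F \<mu> / (1 - b))" using C b by (intro mult_left_mono levels[OF \<mu>]) auto
    also have "\<dots> = 2 * C / (b * (1 - b)) * (?F \<mu> / 2)" by simp
    also have "\<dots> \<le> real J * (?F \<mu> / 2)" by (intro mult_right_mono J) simp
    finally show ?thesis using \<open>0 < J\<close> by simp
  qed
  define K where "K = 1 / b ^ J"
  have K: "1 < K" using b \<open>0 < J\<close> by (simp add: K_def power_less_one_iff)
  have tail: "?F (K ^ i) \<le> (1 / 2) ^ i" for i
  proof (induction i)
    case (Suc i)
    have "?F (K ^ Suc i) = ?F (K ^ i / b ^ J)" by (simp add: K_def)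
    also have "\<dots> \<le> ?F (K ^ i) / 2" using K by (intro half one_le_power) simp
    also have "\<dots> \<le> (1 / 2) ^ Suc i" using Suc by simp
    finally show ?case .
  qed simp
  \<comment> \<open>Chosen so that \<open>K powr e = sqrt 2\<close>; with the tail ratio 1/2 the
    series has ratio \<open>sqrt 2 / 2 < 1\<close>.\<close>
  define e where "e = ln 2 / (2 * ln K)"
  have e: "0 < e" using K by (simp add: e_def)
  have "K powr e = exp (ln 2 / 2)" using K by (simp add: powr_def e_def)
  also have "\<dots> = sqrt 2" using powr_half_sqrt[of 2] by (simp add: powr_def)
  finally have Ke: "K powr e = sqrt 2" .
  have "(\<integral>\<^sup>+x. ennreal (v x powr e) \<partial>\<nu>)
      \<le> ennreal (1 + 1 * K powr e / (1 - K powr e * (1 / 2)))"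
  proof (rule \<nu>.nn_integral_powr_le_of_geometric_tail)
    show "measure \<nu> {x \<in> space \<nu>. K ^ i < v x} \<le> 1 * (1 / 2) ^ i" for i
    proof -
      have "measure \<nu> {x \<in> space \<nu>. K ^ i < v x} \<le> ?F (K ^ i)"
        by (intro \<nu>.finite_measure_mono) auto
      with tail[of i] show ?thesis by simp
    qed
    show "K powr e * (1 / 2) < 1" unfolding Ke using real_sqrt_less_mono[of 2 4] by simp
    show "x \<in> space \<nu> \<Longrightarrow> 0 \<le> v x" for x using nonneg by simp
  qed (use K e in simp_all)
  then show ?thesis unfolding Ke by (simp add: e_def K_def)
qed

section \<open>Logarithmic means, power means and the median\<close>

text \<open>Jensen's inequality, by integrating the tangent bound for \<open>ln\<close> at
  \<open>J\<close>. The sign of \<open>t\<close> is free: negative \<open>t\<close> serves (P1),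
  positive \<open>t\<close> serves (P2').\<close>

lemma ln_integral_le_of_moment:
  assumes pos: "AE x in M. 0 < v x" and int: "integrable M (\<lambda>x. ln (v x))"
    and J: "0 < J" "(\<integral>\<^sup>+x. ennreal (v x powr t) \<partial>M) \<le> ennreal J"
  shows "t * (\<integral>x. ln (v x) \<partial>M) \<le> ln J"
proof -
  have fin: "(\<integral>\<^sup>+x. ennreal (v x powr t) \<partial>M) < \<infinity>"
    using J(2) by (rule order_le_less_trans) simp
  then have intt: "integrable M (\<lambda>x. v x powr t)"
    by (intro integrableI_nonneg) auto
  have "ennreal (\<integral>x. v x powr t \<partial>M) = (\<integral>\<^sup>+x. ennreal (v x powr t) \<partial>M)"
    by (rule nn_integral_eq_integral[symmetric, OF intt]) simp
  with J(2) have "ennreal (\<integral>x. v x powr t \<partial>M) \<le> ennreal J" by simp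
  then have le: "(\<integral>x. v x powr t \<partial>M) \<le> J" using J(1) by simp
  have "(\<integral>x. t * ln (v x) \<partial>M) \<le> (\<integral>x. v x powr t / J - 1 + ln J \<partial>M)"
  proof (rule integral_mono_AE)
    show "AE x in M. t * ln (v x) \<le> v x powr t / J - 1 + ln J"
      using pos
    proof eventually_elim
      case (elim x)
      then have "ln (v x powr t / J) = t * ln (v x) - ln J" using J by (simp add: ln_div ln_powr)
      then show ?case using ln_le_minus_one[of "v x powr t / J"] elim J by simp
    qed
  qed (use int intt in auto)
  also have "\<dots> = (\<integral>x. v x powr t \<partial>M) / J - 1 + ln J"
    using intt by (simp add: prob_space)
  also have "\<dots> \<le> ln J" using le J by simp
  finally show ?thesis by simp
qed

lemma integrable_v: "integrable M v" and integral_v: "(\<integral>x. v x \<partial>M) = 1"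
proof -
  have ae: "AE x in M. 0 \<le> v x" using AE_space by eventually_elim (rule nonneg)
  show "integrable M v" using ae mean by (intro integrableI_nonneg) auto
  then show "(\<integral>x. v x \<partial>M) = 1"
    using nn_integral_eq_integral[OF _ ae] mean by simp
qed

text \<open>If the set where \<open>v\<close> is below \<open>exp (- 2 * k - 2)\<close> filled more
  than half, then \<open>ln v \<le> v - (2 * k + 2)\<close> there and \<open>ln v \<le> v\<close>
  elsewhere would integrate to less than \<open>1 - (k + 1) = - k\<close>.\<close>

lemma median_of_ln_integral:
  assumes pos: "AE x in M. 0 < v x" and int: "integrable M (\<lambda>x. ln (v x))"
    and k: "0 \<le> k" "- k \<le> (\<integral>x. ln (v x) \<partial>M)"
  shows "1 / 2 \<le> prob {x\<in>space M. exp (- 2 * k - 2) < v x}"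
proof (rule ccontr)
  let ?c = "exp (- 2 * k - 2)"
  let ?A = "{x\<in>space M. v x \<le> ?c}"
  assume "\<not> ?thesis"
  then have "prob {x\<in>space M. ?c < v x} < 1 / 2" by simp
  moreover have "prob {x\<in>space M. ?c < v x} = 1 - prob ?A"
    by (subst prob_compl[symmetric]) (auto intro!: arg_cong[where f = prob])
  ultimately have A: "1 / 2 < prob ?A" by simp
  have "(\<integral>x. ln (v x) \<partial>M) \<le> (\<integral>x. v x - (2 * k + 2) * indicator ?A x \<partial>M)"
  proof (rule integral_mono_AE[OF int])
    show "integrable M (\<lambda>x. v x - (2 * k + 2) * indicator ?A x)"
      using integrable_v by (auto simp: emeasure_eq_measure)
    show "AE x in M. ln (v x) \<le> v x - (2 * k + 2) * indicator ?A x"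
      using pos
    proof eventually_elim
      case (elim x)
      show ?case
      proof (cases "x \<in> ?A")
        case True
        then have "ln (v x) \<le> ln ?c" using elim by (subst ln_le_cancel_iff) auto
        then show ?thesis using True elim by simp
      qed (use less_imp_le[OF ln_less_self[OF elim]] in simp)
    qed
  qed
  also have "\<dots> = 1 - (2 * k + 2) * prob ?A"
    using integrable_v by (subst Bochner_Integration.integral_diff) (auto simp: integral_v emeasure_eq_measure)
  also have "\<dots> < 1 - (2 * k + 2) * (1 / 2)"
    using A k by (intro diff_strict_left_mono mult_strict_left_mono) auto
  finally show False using k by argo
qed

text \<open>\<open>v\<close> controls the positive part of \<open>ln v\<close> and
  \<open>v powr (- r) / r\<close> the negative one, which gives integrability; the bound is Jensen
  with \<open>t = - r\<close>.\<close>

lemma ln_integral_ge_of_neg_moment: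
  assumes r: "0 < r" and pos: "AE x in M. 0 < v x" and C: "0 < C"
    and le: "(\<integral>\<^sup>+x. ennreal (v x powr (- r)) \<partial>M) \<le> ennreal C"
  shows "integrable M (\<lambda>x. ln (v x))" "- (ln C / r) \<le> (\<integral>x. ln (v x) \<partial>M)"
proof -
  have "(\<integral>\<^sup>+x. ennreal (v x powr (- r)) \<partial>M) < \<infinity>"
    using le by (rule order_le_less_trans) simp
  then have intr: "integrable M (\<lambda>x. v x powr (- r))"
    by (intro integrableI_nonneg) auto
  show int: "integrable M (\<lambda>x. ln (v x))"
  proof (rule Bochner_Integration.integrable_bound)
    show "integrable M (\<lambda>x. v x + v x powr (- r) / r)" using integrable_v intr by auto
    show "AE x in M. norm (ln (v x)) \<le> norm (v x + v x powr (- r) / r)"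
      using pos
    proof eventually_elim
      case (elim x)
      have "- r * ln (v x) \<le> v x powr (- r)"
        using ln_le_minus_one[of "v x powr (- r)"] elim by (simp add: ln_powr)
      then have "- ln (v x) \<le> v x powr (- r) / r" using r by (simp add: field_simps)
      moreover have "0 \<le> v x powr (- r) / r" using r by simp
      ultimately have "\<bar>ln (v x)\<bar> \<le> v x + v x powr (- r) / r"
        using elim ln_less_self[OF elim] by linarith
      then show ?case by simp
    qed
  qed simp
  show "- (ln C / r) \<le> (\<integral>x. ln (v x) \<partial>M)"
    using ln_integral_le_of_moment[OF pos int C le] r by (simp add: field_simps)
qed

lemma power_mean_ge_of_ln_integral:
  assumes pos: "AE x in M. 0 < v x" and int: "integrable M (\<lambda>x. ln (v x))"
    and s: "0 < s" and k: "- k \<le> (\<integral>x. ln (v x) \<partial>M)"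
  shows "ennreal (exp (- k * s)) \<le> (\<integral>\<^sup>+x. ennreal (v x powr s) \<partial>M)"
proof (cases "(\<integral>\<^sup>+x. ennreal (v x powr s) \<partial>M)")
  case (real J)
  have "J \<noteq> 0"
  proof
    assume "J = 0"
    with real have "(\<integral>\<^sup>+x. ennreal (v x powr s) \<partial>M) = 0" by simp
    then have "AE x in M. ennreal (v x powr s) = 0" by (subst (asm) nn_integral_0_iff_AE) auto
    with pos have "AE x in M. False" by eventually_elim simp
    then show False by simp
  qed
  with real have J: "0 < J" by simp
  have "s * (- k) \<le> s * (\<integral>x. ln (v x) \<partial>M)" using k s by (intro mult_left_mono) auto
  also have "\<dots> \<le> ln J" using real by (intro ln_integral_le_of_moment[OF pos int J]) simp
  finally have "exp (- k * s) \<le> J" using J by (simp add: mult.commute ln_ge_iff)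
  then show ?thesis using real by (simp add: ennreal_leI)
qed simp

text \<open>Let \<open>s\<close> tend to 0. Since \<open>(v powr s - 1) / s\<close> tends to
  \<open>ln v\<close>, the functions \<open>\<phi> s\<close> tend to \<open>v - 1 - ln v\<close>.
  They are nonnegative by Bernoulli's inequality, and as \<open>v\<close> has mean one their
  integrals are at most \<open>ln C\<close>. Fatou's lemma then gives integrability of
  \<open>ln v\<close> and the bound together.\<close>

lemma ln_integral_ge_of_power_mean:
  assumes C: "0 < C"
    and le: "\<And>s. 0 < s \<Longrightarrow> s < 1 \<Longrightarrow> ennreal (C powr (- s)) \<le> (\<integral>\<^sup>+x. ennreal (v x powr s) \<partial>M)"
  shows "AE x in M. 0 < v x" "integrable M (\<lambda>x. ln (v x))" "- ln C \<le> (\<integral>x. ln (v x) \<partial>M)"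
proof -
  define \<phi> where "\<phi> s x = v x - 1 - (v x powr s - 1) / s" for s x
  have bernoulli: "v x powr s \<le> 1 + s * (v x - 1)" if "0 < s" "s < 1" "x \<in> space M" for s x
  proof (cases "v x = 0")
    case False
    then show ?thesis
      using nonneg[OF \<open>x \<in> space M\<close>] \<open>0 < s\<close> \<open>s < 1\<close>
        convex_onD[OF exp_convex, of s 0 "ln (v x)"] by (simp add: powr_def algebra_simps)
  qed (use that in simp)
  have \<phi>_nonneg: "0 \<le> \<phi> s x" if "0 < s" "s < 1" "x \<in> space M" for s x
    using bernoulli[OF that] \<open>0 < s\<close> by (simp add: \<phi>_def field_simps)
  have \<phi>_int: "(\<integral>\<^sup>+x. ennreal (\<phi> s x) \<partial>M) \<le> ennreal (ln C)" "0 \<le> ln C" if s: "0 < s" "s < 1" for s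
  proof -
    have ints: "integrable M (\<lambda>x. v x powr s)"
    proof (rule Bochner_Integration.integrable_bound)
      show "integrable M (\<lambda>x. 1 + v x)" using integrable_v by simp
      show "AE x in M. norm (v x powr s) \<le> norm (1 + v x)"
        using AE_space
      proof eventually_elim
        case (elim x)
        have "v x powr s \<le> 1 + s * (v x - 1)" by (rule bernoulli[OF s elim])
        also have "\<dots> \<le> 1 + v x"
          using s nonneg[OF elim] mult_right_mono[of s 1 "v x"] by (simp add: algebra_simps)
        finally show ?case using nonneg[OF elim] by simp
      qed
    qed simp
    have "ennreal (C powr (- s)) \<le> ennreal (\<integral>x. v x powr s \<partial>M)"
      using le[OF s] nn_integral_eq_integral[OF ints] by simp
    then have "C powr (- s) \<le> (\<integral>x. v x powr s \<partial>M)" by (simp add: ennreal_le_iff)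
    moreover have "1 - s * ln C \<le> C powr (- s)"
      using exp_ge_add_one_self[of "- s * ln C"] C by (simp add: powr_def)
    ultimately have "1 - (\<integral>x. v x powr s \<partial>M) \<le> s * ln C" by simp
    then have "- (((\<integral>x. v x powr s \<partial>M) - 1) / s) \<le> ln C" using s by (simp add: field_simps)
    moreover have "integrable M (\<phi> s)" unfolding \<phi>_def using ints integrable_v by auto
    moreover have "(\<integral>x. \<phi> s x \<partial>M) = - (((\<integral>x. v x powr s \<partial>M) - 1) / s)"
      unfolding \<phi>_def using ints integrable_v by (simp add: integral_v prob_space)
    moreover have ae: "AE x in M. 0 \<le> \<phi> s x" using AE_space by eventually_elim (rule \<phi>_nonneg[OF s])
    moreover have "0 \<le> (\<integral>x. \<phi> s x \<partial>M)" by (rule integral_nonneg_AE[OF ae])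
    ultimately show "(\<integral>\<^sup>+x. ennreal (\<phi> s x) \<partial>M) \<le> ennreal (ln C)" "0 \<le> ln C"
      by (simp_all add: nn_integral_eq_integral ennreal_leI)
  qed
  \<comment> \<open>A sequence tending to 0 inside \<open>(0, 1)\<close> already from
    \<open>n = 0\<close>.\<close>
  define s where "s n = 1 / real (n + 2)" for n
  have s: "0 < s n" "s n < 1" for n by (auto simp: s_def)
  show pos: "AE x in M. 0 < v x"
  proof -
    let ?Z = "{x\<in>space M. v x = 0}"
    \<comment> \<open>Where \<open>v\<close> is zero, \<open>\<phi> (s n)\<close> equals
      \<open>1 / s n - 1 = n + 1\<close>; the uniform bound on the integrals forces this set to be
      null.\<close>
    have "(real n) * prob ?Z \<le> \<bar>ln C\<bar>" for n
    proof -
      have "ennreal (real n * prob ?Z) = (\<integral>\<^sup>+x. ennreal (real n) * indicator ?Z x \<partial>M)"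
        by (subst nn_integral_cmult_indicator) (auto simp: emeasure_eq_measure ennreal_mult)
      also have "\<dots> \<le> (\<integral>\<^sup>+x. ennreal (\<phi> (s n) x) \<partial>M)"
        by (intro nn_integral_mono) (auto simp: \<phi>_def s_def split: split_indicator intro!: ennreal_leI)
      also have "\<dots> \<le> ennreal (ln C)" by (rule \<phi>_int(1)[OF s])
      also have "\<dots> \<le> ennreal \<bar>ln C\<bar>" by (intro ennreal_leI) simp
      finally show ?thesis by simp
    qed
    then have "prob ?Z \<le> 0"
      using reals_Archimedean3[of "prob ?Z"] by (metis not_le)
    then have "emeasure M ?Z = 0" by (simp add: emeasure_eq_measure measure_le_0_iff)
    then have "AE x in M. v x \<noteq> 0" by (subst AE_iff_measurable[OF _ refl]) auto
    then show ?thesis using AE_space by eventually_elim (use nonneg in \<open>auto simp: order_less_le\<close>)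
  qed
  have lim: "AE x in M. liminf (\<lambda>n. ennreal (\<phi> (s n) x)) = ennreal (v x - 1 - ln (v x))"
    using pos
  proof eventually_elim
    case (elim x)
    have "((\<lambda>h. v x powr h) has_real_derivative ln (v x) * v x powr 0) (at 0)"
      using elim by (auto intro!: derivative_eq_intros)
    then have "((\<lambda>h. (v x powr h - 1) / h) \<longlongrightarrow> ln (v x)) (at 0)"
      using elim by (simp add: DERIV_def)
    moreover have "filterlim s (at 0) sequentially"
    proof -
      have "s \<longlonglongrightarrow> 0" unfolding s_def
        using LIMSEQ_ignore_initial_segment[OF lim_inverse_n, of 2] by (simp add: inverse_eq_divide)
      then show ?thesis using s by (auto simp: filterlim_at order_less_imp_not_eq2)
    qed
    ultimately have "(\<lambda>n. (v x powr s n - 1) / s n) \<longlonglongrightarrow> ln (v x)"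
      by (rule filterlim_compose)
    then have "(\<lambda>n. ennreal (\<phi> (s n) x)) \<longlonglongrightarrow> ennreal (v x - 1 - ln (v x))"
      unfolding \<phi>_def by (intro tendsto_intros)
    then show ?case by (intro lim_imp_Liminf) auto
  qed
  have "(\<integral>\<^sup>+x. ennreal (v x - 1 - ln (v x)) \<partial>M) = (\<integral>\<^sup>+x. liminf (\<lambda>n. ennreal (\<phi> (s n) x)) \<partial>M)"
    using lim by (intro nn_integral_cong_AE) (auto elim: eventually_mono)
  also have "\<dots> \<le> liminf (\<lambda>n. \<integral>\<^sup>+x. ennreal (\<phi> (s n) x) \<partial>M)"
    by (rule nn_integral_liminf) (simp add: \<phi>_def)
  also have "\<dots> \<le> liminf (\<lambda>n. ennreal (ln C))"
    by (intro Liminf_mono always_eventually allI \<phi>_int(1) s)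
  also have "\<dots> = ennreal (ln C)" by (simp add: Liminf_const)
  finally have fatou: "(\<integral>\<^sup>+x. ennreal (v x - 1 - ln (v x)) \<partial>M) \<le> ennreal (ln C)" .
  have ae: "AE x in M. 0 \<le> v x - 1 - ln (v x)"
    using pos by eventually_elim (use ln_le_minus_one in auto)
  have "(\<integral>\<^sup>+x. ennreal (v x - 1 - ln (v x)) \<partial>M) < \<infinity>"
    using fatou by (rule order_le_less_trans) simp
  then have int: "integrable M (\<lambda>x. v x - 1 - ln (v x))"
    by (intro integrableI_nonneg ae) auto
  have "integrable M (\<lambda>x. (v x - 1) - (v x - 1 - ln (v x)))"
    by (rule Bochner_Integration.integrable_diff[OF _ int]) (use integrable_v in simp)
  moreover have "(\<lambda>x. (v x - 1) - (v x - 1 - ln (v x))) = (\<lambda>x. ln (v x))" by auto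
  ultimately show intl: "integrable M (\<lambda>x. ln (v x))" by (simp only:)
  have "ennreal (\<integral>x. v x - 1 - ln (v x) \<partial>M) \<le> ennreal (ln C)"
    using fatou nn_integral_eq_integral[OF int ae] by simp
  \<comment> \<open>\<open>ln C\<close> must be known to be nonnegative here, since
    \<open>ennreal\<close> truncates negative reals to 0; any admissible \<open>s\<close> provides
    this.\<close>
  then have "(\<integral>x. v x - 1 - ln (v x) \<partial>M) \<le> ln C"
    using \<phi>_int(2)[of "1/2"] by simp
  then show "- ln C \<le> (\<integral>x. ln (v x) \<partial>M)"
    using intl integrable_v by (simp add: integral_v prob_space)
qed

end

section \<open>Weights and bases\<close>

lemma epowr_ennreal: "0 \<le> x \<Longrightarrow> 0 < a \<Longrightarrow> epowr (ennreal x) a = ennreal (x powr a)"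
  by (auto simp: epowr_def)

lemma epowr_top: "0 < a \<Longrightarrow> epowr \<infinity> a = \<infinity>"
  by (simp add: epowr_def)

lemma epowr_le_iff:
  assumes "0 < a" "0 \<le> c"
  shows "epowr x a \<le> ennreal c \<longleftrightarrow> x \<le> ennreal (c powr (1 / a))"
proof (cases x)
  case (real y)
  have "y powr a \<le> c \<longleftrightarrow> y \<le> c powr (1 / a)"
  proof
    assume "y powr a \<le> c"
    then have "(y powr a) powr (1 / a) \<le> c powr (1 / a)" using assms by (intro powr_mono2) auto
    then show "y \<le> c powr (1 / a)" using assms real by (simp add: powr_powr)
  next
    assume "y \<le> c powr (1 / a)"
    then have "y powr a \<le> (c powr (1 / a)) powr a" using assms real by (intro powr_mono2) auto
    then show "y powr a \<le> c" using assms by (simp add: powr_powr)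
  qed
  then show ?thesis using real assms by (simp add: epowr_ennreal)
next
  case top
  then show ?thesis using assms epowr_top by (simp add: top_unique)
qed

lemma ennreal_le_epowr_iff:
  assumes "0 < a" "0 \<le> c"
  shows "ennreal c \<le> epowr x a \<longleftrightarrow> ennreal (c powr (1 / a)) \<le> x"
proof (cases x)
  case (real y)
  have "c \<le> y powr a \<longleftrightarrow> c powr (1 / a) \<le> y"
  proof
    assume "c \<le> y powr a"
    then have "c powr (1 / a) \<le> (y powr a) powr (1 / a)" using assms by (intro powr_mono2) auto
    then show "c powr (1 / a) \<le> y" using assms real by (simp add: powr_powr)
  next
    assume "c powr (1 / a) \<le> y"
    then have "(c powr (1 / a)) powr a \<le> y powr a" using assms real by (intro powr_mono2) auto
    then show "c \<le> y powr a" using assms by (simp add: powr_powr)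
  qed
  then show ?thesis using real assms by (simp add: epowr_ennreal)
next
  case top
  then show ?thesis using assms epowr_top by simp
qed

lemma epowr_mult_pos:
  assumes "0 < a" "0 \<le> x"
  shows "epowr (ennreal (a * x)) t = ennreal (a powr t) * epowr (ennreal x) t"
proof (cases "x = 0")
  case True
  then show ?thesis using assms by (auto simp: epowr_def ennreal_mult_top)
next
  case False
  then have "0 < x" "0 < a * x" using assms by auto
  then show ?thesis using assms by (auto simp: epowr_def powr_mult simp flip: ennreal_mult')
qed

lemma ennreal_mult_divide_cancel: "0 < c \<Longrightarrow> ennreal c * (x / ennreal c) = x"
  by (cases x) (auto simp: divide_ennreal ennreal_top_divide ennreal_mult_top simp flip: ennreal_mult)

lemma borel_measurable_epowr [measurable (raw)]:
  assumes [measurable]: "f \<in> borel_measurable M"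
  shows "(\<lambda>x. epowr (f x) a) \<in> borel_measurable M"
proof (cases "a = 0")
  case False
  have "(\<lambda>x. epowr (f x) a)
      = (\<lambda>x. if f x = (if a < 0 then 0 else \<infinity>) then \<infinity> else ennreal (enn2real (f x) powr a))"
    using False by (auto simp: epowr_def)
  also have "\<dots> \<in> borel_measurable M" by measurable
  finally show ?thesis .
qed (simp add: epowr_def)

lemma borel_measurable_log_plus [measurable (raw)]:
  assumes [measurable]: "f \<in> borel_measurable M"
  shows "(\<lambda>x. log_plus (f x)) \<in> borel_measurable M"
  unfolding log_plus_def by measurable

locale weighted_basis =
  fixes M :: "'a measure" and \<B> :: "'a set set" and w :: "'a \<Rightarrow> real"
  assumes basis: "basis M \<B>" and weight: "weight M \<B> w"
begin

definition N :: "'a set \<Rightarrow> 'a measure" where "N B = uniform_measure M B"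
definition a :: "'a set \<Rightarrow> real" where "a B = enn2real (wavg M w B)"
definition v :: "'a set \<Rightarrow> 'a \<Rightarrow> real" where "v B x = w x / a B"
abbreviation \<omega> :: "'a set \<Rightarrow> 'a measure" where "\<omega> B \<equiv> density (N B) (\<lambda>x. ennreal (v B x))"

lemma w_measurable [measurable]: "w \<in> borel_measurable M" and w_nonneg: "x \<in> space M \<Longrightarrow> 0 \<le> w x"
  using weight by (auto simp: weight_def)

lemma sets_N [simp, measurable_cong]: "sets (N B) = sets M" and space_N [simp]: "space (N B) = space M"
  by (simp_all add: N_def)

lemma v_measurable [measurable]: "v B \<in> borel_measurable M"
  unfolding v_def by measurable

context
  fixes B assumes B: "B \<in> \<B>"
begin

lemma B_sets [measurable]: "B \<in> sets M"
  using basis B by (auto simp: basis_def)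

lemma B_measure: "0 < measure M B" "emeasure M B = ennreal (measure M B)"
proof -
  have "0 < emeasure M B" "emeasure M B < \<infinity>" using basis B by (auto simp: basis_def)
  then show "emeasure M B = ennreal (measure M B)" by (intro emeasure_eq_ennreal_measure) auto
  with \<open>0 < emeasure M B\<close> show "0 < measure M B" by simp
qed

lemma prob_space_N: "prob_space (N B)"
  unfolding N_def using B_measure by (intro prob_space_uniform_measure) auto

lemma avg_eq: "f \<in> borel_measurable M \<Longrightarrow> avg M B f = (\<integral>\<^sup>+x. f x \<partial>N B)"
  unfolding avg_def N_def using B_measure by (subst nn_integral_uniform_measure) auto

lemma wavg_eq: "wavg M w B = ennreal (a B)" and a_pos: "0 < a B"
proof -
  have w: "0 < wint M w B" "wint M w B < \<infinity>" using weight B by (auto simp: weight_def)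
  then obtain c where c: "wint M w B = ennreal c" "0 < c"
    by (cases "wint M w B") auto
  then have "wavg M w B = ennreal (c / measure M B)"
    using B_measure by (simp add: wavg_def divide_ennreal)
  then show "wavg M w B = ennreal (a B)" "0 < a B"
    using c B_measure by (simp_all add: a_def)
qed

lemma wint_eq: "wint M w B = ennreal (a B * measure M B)"
proof -
  have "wint M w B = wint M w B / emeasure M B * emeasure M B"
    using B_measure by (simp add: ennreal_mult_divide_cancel mult.commute)
  then show ?thesis
    using wavg_eq a_pos B_measure by (simp add: wavg_def ennreal_mult)
qed

lemma w_eq: "w x = a B * v B x"
  using a_pos by (simp add: v_def)

lemma mean_one: "mean_one (N B) (v B)"
proof -
  interpret prob_space "N B" by (rule prob_space_N)
  show ?thesis
  proof
    show "x \<in> space (N B) \<Longrightarrow> 0 \<le> v B x" for x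
      using a_pos w_nonneg by (simp add: v_def)
    have "(\<integral>\<^sup>+x. ennreal (v B x) \<partial>N B) = (\<integral>\<^sup>+x. ennreal (1 / a B) * ennreal (w x) \<partial>N B)"
      using a_pos w_nonneg by (intro nn_integral_cong) (simp add: v_def flip: ennreal_mult)
    also have "\<dots> = ennreal (1 / a B) * wavg M w B"
      using avg_eq[of "\<lambda>x. ennreal (w x)"] by (simp add: nn_integral_cmult avg_def wavg_def wint_def)
    also have "\<dots> = 1" using a_pos by (simp add: wavg_eq flip: ennreal_mult)
    finally show "(\<integral>\<^sup>+x. ennreal (v B x) \<partial>N B) = 1" .
  qed measurable
qed

interpretation mean_one "N B" "v B" by (rule mean_one)

lemma emeasure_Int: "E \<in> sets M \<Longrightarrow> emeasure M (E \<inter> B) = ennreal (measure (N B) E * measure M B)"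
  using B_measure unfolding ennreal_mult[OF measure_nonneg measure_nonneg] emeasure_eq_measure[symmetric]
  by (simp add: N_def Int_commute mult.commute ennreal_mult_divide_cancel)

lemma nn_integral_Int:
  assumes "f \<in> borel_measurable M"
  shows "(\<integral>\<^sup>+x\<in>B. f x \<partial>M) = ennreal (measure M B) * (\<integral>\<^sup>+x. f x \<partial>N B)"
proof -
  have "(\<integral>\<^sup>+x. f x \<partial>N B) = (\<integral>\<^sup>+x\<in>B. f x \<partial>M) / ennreal (measure M B)"
    using avg_eq[OF assms] B_measure by (simp add: avg_def)
  then show ?thesis
    using B_measure by (simp add: ennreal_mult_divide_cancel)
qed

lemma wint_Int:
  assumes [measurable]: "E \<in> sets M"
  shows "wint M w (E \<inter> B) = ennreal (measure (\<omega> B) E * (a B * measure M B))"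
proof -
  have "wint M w (E \<inter> B) = (\<integral>\<^sup>+x\<in>B. ennreal (w x) * indicator E x \<partial>M)"
    unfolding wint_def by (intro nn_integral_cong) (auto split: split_indicator)
  also have "\<dots> = ennreal (measure M B) * (\<integral>\<^sup>+x. ennreal (w x) * indicator E x \<partial>N B)"
    by (rule nn_integral_Int) measurable
  also have "(\<integral>\<^sup>+x. ennreal (w x) * indicator E x \<partial>N B)
      = (\<integral>\<^sup>+x. ennreal (a B) * (ennreal (v B x) * indicator E x) \<partial>N B)"
    using a_pos nonneg by (intro nn_integral_cong) (simp add: w_eq ennreal_mult ac_simps)
  also have "\<dots> = ennreal (a B) * emeasure (\<omega> B) E"
    by (subst nn_integral_cmult) (auto simp: emeasure_\<nu>)
  finally show ?thesis
    using a_pos by (simp add: \<nu>.emeasure_eq_measure ennreal_mult ac_simps)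
qed

lemma emeasure_ratio:
  assumes "E \<in> sets M" "E \<subseteq> B"
  shows "emeasure M E / emeasure M B = ennreal (measure (N B) E)"
proof -
  have "E = E \<inter> B" using assms by blast
  then have "emeasure M E = ennreal (measure (N B) E * measure M B)" using emeasure_Int[OF assms(1)] by simp
  then show ?thesis using B_measure by (simp add: divide_ennreal)
qed

lemma wint_ratio:
  assumes "E \<in> sets M" "E \<subseteq> B"
  shows "wint M w E / wint M w B = ennreal (measure (\<omega> B) E)"
proof -
  have "E = E \<inter> B" using assms by blast
  then have "wint M w E = ennreal (measure (\<omega> B) E * (a B * measure M B))"
    using wint_Int[OF assms(1)] by simp
  then show ?thesis using B_measure a_pos wint_eq by (simp add: divide_ennreal)
qed

text \<open>\<open>N B\<close> ignores everything outside \<open>B\<close>, so the restriction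
  \<open>E \<subseteq> B\<close> in the conditions can be traded for all of
  \<open>sets M\<close>.\<close>

lemma prob_Int: "E \<in> sets M \<Longrightarrow> measure (N B) (E \<inter> B) = measure (N B) E"
  using emeasure_Int[of E] emeasure_Int[of "E \<inter> B"] B_measure(1) by (simp add: Int_assoc)

lemma \<omega>_Int: "E \<in> sets M \<Longrightarrow> measure (\<omega> B) (E \<inter> B) = measure (\<omega> B) E"
  using wint_Int[of E] wint_Int[of "E \<inter> B"] B_measure(1) a_pos by (simp add: Int_assoc)

lemma level_eq: "{x\<in>B. P (w x)} = {x\<in>space M. P (a B * v B x)} \<inter> B"
  using sets.sets_into_space[OF B_sets] by (auto simp: w_eq)

lemma avg_epowr: "avg M B (\<lambda>x. epowr (ennreal (w x)) t)
    = ennreal (a B powr t) * (\<integral>\<^sup>+x. epowr (ennreal (v B x)) t \<partial>N B)"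
proof -
  have "avg M B (\<lambda>x. epowr (ennreal (w x)) t) = (\<integral>\<^sup>+x. epowr (ennreal (w x)) t \<partial>N B)"
    by (rule avg_eq) measurable
  also have "\<dots> = (\<integral>\<^sup>+x. ennreal (a B powr t) * epowr (ennreal (v B x)) t \<partial>N B)"
    using a_pos nonneg by (intro nn_integral_cong) (simp add: w_eq epowr_mult_pos)
  also have "\<dots> = ennreal (a B powr t) * (\<integral>\<^sup>+x. epowr (ennreal (v B x)) t \<partial>N B)"
    by (rule nn_integral_cmult) measurable
  finally show ?thesis .
qed

lemma log_avg_eq:
  assumes pos: "AE x in N B. 0 < v B x" and int: "integrable (N B) (\<lambda>x. ln (v B x))"
  shows "log_avg M w B = ereal (ln (a B) + (\<integral>x. ln (v B x) \<partial>N B))"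
proof -
  have pos': "AE x in N B. 0 < w x" using pos by eventually_elim (use a_pos in \<open>simp add: w_eq\<close>)
  have eq: "AE x in N B. ln (w x) = ln (a B) + ln (v B x)"
    using pos by eventually_elim (use a_pos in \<open>simp add: w_eq ln_mult\<close>)
  have intw: "integrable (N B) (\<lambda>x. ln (w x))"
    using int by (subst integrable_cong_AE[OF _ _ eq]) auto
  have "(\<integral>x. ln (w x) \<partial>N B) = (\<integral>x. ln (a B) + ln (v B x) \<partial>N B)"
    using eq by (intro integral_cong_AE) auto
  also have "\<dots> = ln (a B) + (\<integral>x. ln (v B x) \<partial>N B)"
    using int prob_space by simp
  finally have I: "(\<integral>x. ln (w x) \<partial>N B) = ln (a B) + (\<integral>x. ln (v B x) \<partial>N B)" .
  obtain P Q where PQ: "0 \<le> P" "0 \<le> Q" "(\<integral>x. ln (w x) \<partial>N B) = P - Q"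
    "(\<integral>\<^sup>+x. ennreal (ln (w x)) \<partial>N B) = ennreal P" "(\<integral>\<^sup>+x. ennreal (- ln (w x)) \<partial>N B) = ennreal Q"
    using integrableE[OF intw] by metis
  have "(\<integral>\<^sup>+x\<in>B. e2ennreal (elog (w x)) \<partial>M) = ennreal (measure M B) * (\<integral>\<^sup>+x. e2ennreal (elog (w x)) \<partial>N B)"
    by (rule nn_integral_Int) (simp add: elog_def)
  also have "(\<integral>\<^sup>+x. e2ennreal (elog (w x)) \<partial>N B) = (\<integral>\<^sup>+x. ennreal (ln (w x)) \<partial>N B)"
    by (intro nn_integral_cong_AE, use pos' in eventually_elim) (simp add: elog_def ennreal.abs_eq)
  finally have 1: "(\<integral>\<^sup>+x\<in>B. e2ennreal (elog (w x)) \<partial>M) = ennreal (measure M B * P)"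
    using PQ by (simp add: ennreal_mult)
  have "(\<integral>\<^sup>+x\<in>B. e2ennreal (- elog (w x)) \<partial>M) = ennreal (measure M B) * (\<integral>\<^sup>+x. e2ennreal (- elog (w x)) \<partial>N B)"
    by (rule nn_integral_Int) (simp add: elog_def)
  also have "(\<integral>\<^sup>+x. e2ennreal (- elog (w x)) \<partial>N B) = (\<integral>\<^sup>+x. ennreal (- ln (w x)) \<partial>N B)"
    by (intro nn_integral_cong_AE, use pos' in eventually_elim) (simp add: elog_def ennreal.abs_eq)
  finally have 2: "(\<integral>\<^sup>+x\<in>B. e2ennreal (- elog (w x)) \<partial>M) = ennreal (measure M B * Q)"
    using PQ by (simp add: ennreal_mult)
  show ?thesis
    unfolding log_avg_def 1 2 B_measure(2) I[symmetric] PQ(3) using PQ(1,2) B_measure(1)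
    by (simp add: field_simps)
qed

text \<open>The positive part of \<open>ln w\<close> always has a finite integral, because
  \<open>ln w \<le> w\<close>. So if \<open>ln v\<close> is not integrable or \<open>v\<close> has a
  nonnull zero set, the negative part is infinite, \<open>log_avg\<close> is
  \<open>-\<infinity>\<close>, and the right side is 0 while the average of \<open>w\<close> is
  positive.\<close>

lemma log_avg_le_iff:
  assumes C: "0 < C"
  shows "wavg M w B \<le> ennreal C * eexp (log_avg M w B) \<longleftrightarrow>
    (AE x in N B. 0 < v B x) \<and> integrable (N B) (\<lambda>x. ln (v B x)) \<and> - ln C \<le> (\<integral>x. ln (v B x) \<partial>N B)"
    (is "?L \<longleftrightarrow> ?pos \<and> ?int \<and> ?I")
proof (cases "?pos \<and> ?int")
  case True
  let ?i = "\<integral>x. ln (v B x) \<partial>N B"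
  have "ennreal C * eexp (log_avg M w B) = ennreal (C * exp (ln (a B) + ?i))"
    using True C by (simp add: log_avg_eq eexp_def ennreal_mult)
  also have "C * exp (ln (a B) + ?i) = a B * exp (ln C + ?i)" using C a_pos by (simp add: exp_add)
  finally have "?L \<longleftrightarrow> a B \<le> a B * exp (ln C + ?i)"
    using a_pos by (simp add: wavg_eq)
  also have "\<dots> \<longleftrightarrow> 0 \<le> ln C + ?i" using a_pos by simp
  finally show ?thesis using True by auto
next
  case False
  have P: "(\<integral>\<^sup>+x\<in>B. e2ennreal (elog (w x)) \<partial>M) \<noteq> \<infinity>"
  proof -
    have "(\<integral>\<^sup>+x\<in>B. e2ennreal (elog (w x)) \<partial>M) \<le> wint M w B"
      unfolding wint_def
    proof (intro nn_integral_mono mult_right_mono)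
      fix x assume "x \<in> space M"
      then have "0 \<le> w x" by (rule w_nonneg)
      show "e2ennreal (elog (w x)) \<le> ennreal (w x)"
      proof (cases "w x = 0")
        case False
        then have "ln (w x) \<le> w x" using \<open>0 \<le> w x\<close> less_imp_le[OF ln_less_self[of "w x"]] by simp
        then have "ennreal (ln (w x)) \<le> ennreal (w x)" by (rule ennreal_leI)
        then show ?thesis using False by (simp add: elog_def ennreal.abs_eq)
      qed (simp add: elog_def e2ennreal_neg)
    qed simp
    then show ?thesis unfolding wint_eq by (auto simp: top_unique)
  qed
  have "(\<integral>\<^sup>+x\<in>B. e2ennreal (- elog (w x)) \<partial>M) = \<infinity>"
  proof (rule ccontr)
    \<comment> \<open>A finite negative part would make \<open>v\<close> positive almost everywhere
      and \<open>ln v\<close> integrable, which is the excluded case.\<close>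
    assume "\<not> ?thesis"
    then have top: "(\<integral>\<^sup>+x. e2ennreal (- elog (w x)) \<partial>N B) \<noteq> \<infinity>"
      using B_measure(1) by (subst (asm) nn_integral_Int) (auto simp: elog_def ennreal_mult_eq_top_iff)
    then have "AE x in N B. e2ennreal (- elog (w x)) \<noteq> \<infinity>"
      by (intro nn_integral_PInf_AE) (simp_all add: elog_def)
    then have pos: "AE x in N B. 0 < w x"
      using AE_space by eventually_elim (use w_nonneg in \<open>auto simp: order_less_le elog_def\<close>)
    have "(\<integral>\<^sup>+x. ennreal (- ln (w x)) \<partial>N B) = (\<integral>\<^sup>+x. e2ennreal (- elog (w x)) \<partial>N B)"
      by (intro nn_integral_cong_AE, use pos in eventually_elim) (simp add: elog_def ennreal.abs_eq)
    with top have n: "(\<integral>\<^sup>+x. ennreal (- ln (w x)) \<partial>N B) \<noteq> \<infinity>" by simp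
    have "(\<integral>\<^sup>+x. ennreal (ln (w x)) \<partial>N B) = (\<integral>\<^sup>+x. e2ennreal (elog (w x)) \<partial>N B)"
      by (intro nn_integral_cong_AE, use pos in eventually_elim) (simp add: elog_def ennreal.abs_eq)
    also have "\<dots> \<noteq> \<infinity>"
      using P B_measure(1) by (subst (asm) nn_integral_Int) (auto simp: elog_def ennreal_mult_eq_top_iff)
    finally have "integrable (N B) (\<lambda>x. ln (w x))"
      using n by (simp add: real_integrable_def)
    then have "integrable (N B) (\<lambda>x. ln (w x) - ln (a B))" by simp
    moreover have eq: "AE x in N B. ln (v B x) = ln (w x) - ln (a B)"
      using pos by eventually_elim (use a_pos in \<open>simp add: v_def ln_div\<close>)
    ultimately have "?int" by (subst integrable_cong_AE[OF _ _ eq]) auto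
    moreover have "?pos" using pos by eventually_elim (use a_pos in \<open>simp add: v_def\<close>)
    ultimately show False using False by simp
  qed
  with P have "log_avg M w B = - \<infinity>"
    using B_measure unfolding log_avg_def
    by (cases "\<integral>\<^sup>+x\<in>B. e2ennreal (elog (w x)) \<partial>M") auto
  then have "\<not> ?L" using a_pos by (simp add: eexp_def wavg_eq)
  with False show ?thesis by blast
qed

end

end

section \<open>The conditions in terms of the normalised density\<close>

lemma ennreal_mult_le_iff:
  assumes "0 < c" "0 \<le> d"
  shows "ennreal c * x \<le> ennreal d \<longleftrightarrow> x \<le> ennreal (d / c)"
  using assms by (cases x) (auto simp: ennreal_mult_top top_unique field_simps simp flip: ennreal_mult)

lemma ennreal_le_mult_iff:
  assumes "0 < c" "0 \<le> d"
  shows "ennreal d \<le> ennreal c * x \<longleftrightarrow> ennreal (d / c) \<le> x"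
  using assms by (cases x) (auto simp: ennreal_mult_top field_simps simp flip: ennreal_mult)

context weighted_basis
begin

text \<open>With \<open>r = p' - 1 = 1 / (p - 1)\<close> the powers of \<open>a B\<close> cancel and
  the product becomes the \<open>1 / r\<close>-th power of the negative moment; raising to the power
  \<open>r\<close> turns \<open>C\<close> into \<open>C powr r\<close>.\<close>

lemma satisfies_P1_iff:
  "satisfies P1 M \<B> w \<longleftrightarrow>
    (\<exists>r>0. \<exists>C>0. \<forall>B\<in>\<B>. (\<integral>\<^sup>+x. epowr (ennreal (v B x)) (- r) \<partial>N B) \<le> ennreal C)"
proof -
  have *: "wavg M w B * epowr (avg M B (\<lambda>x. epowr (ennreal (w x)) (- r))) (1 / r) \<le> ennreal C \<longleftrightarrow>
    (\<integral>\<^sup>+x. epowr (ennreal (v B x)) (- r) \<partial>N B) \<le> ennreal (C powr r)"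
    if B: "B \<in> \<B>" and "0 < r" "0 < C" for B r C
    using a_pos[OF B] that
    by (simp add: wavg_eq avg_epowr ennreal_mult_le_iff epowr_le_iff powr_divide powr_minus field_simps)
  show ?thesis
  proof
    assume "satisfies P1 M \<B> w"
    then obtain p p' C where p: "1 < p" "1 / p + 1 / p' = 1" and C: "0 < C"
      and le: "\<forall>B\<in>\<B>. wavg M w B * epowr (avg M B (\<lambda>x. epowr (ennreal (w x)) (1 - p'))) (p - 1) \<le> ennreal C"
      by auto
    define r where "r = 1 / (p - 1)"
    have r: "0 < r" "p - 1 = 1 / r" using p by (auto simp: r_def)
    have "1 / p' = (p - 1) / p" using p by (simp add: field_simps)
    then have "p' = p / (p - 1)" using p by (metis divide_divide_eq_right div_by_1 mult_1)
    then have "1 - p' = - r" using p by (simp add: r_def field_simps)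
    with le * r C show "\<exists>r>0. \<exists>C>0. \<forall>B\<in>\<B>. (\<integral>\<^sup>+x. epowr (ennreal (v B x)) (- r) \<partial>N B) \<le> ennreal C"
      by (intro exI[of _ r] exI[of _ "C powr r"] conjI) auto
  next
    assume "\<exists>r>0. \<exists>C>0. \<forall>B\<in>\<B>. (\<integral>\<^sup>+x. epowr (ennreal (v B x)) (- r) \<partial>N B) \<le> ennreal C"
    then obtain r C where r: "0 < r" and C: "0 < C"
      and le: "\<forall>B\<in>\<B>. (\<integral>\<^sup>+x. epowr (ennreal (v B x)) (- r) \<partial>N B) \<le> ennreal C"
      by auto
    show "satisfies P1 M \<B> w"
      unfolding satisfies.simps
    proof (intro exI conjI ballI)
      show "1 < 1 + 1 / r" "1 / (1 + 1 / r) + 1 / (1 + r) = 1" "0 < C powr (1 / r)"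
        using r C by (auto simp: field_simps)
      show "wavg M w B * epowr (avg M B (\<lambda>x. epowr (ennreal (w x)) (1 - (1 + r)))) (1 + 1 / r - 1)
          \<le> ennreal (C powr (1 / r))" if "B \<in> \<B>" for B
        using *[OF that r, of "C powr (1 / r)"] le that r C by (simp add: powr_powr)
    qed
  qed
qed

lemma satisfies_P1'_iff:
  "satisfies P1' M \<B> w \<longleftrightarrow>
    (\<exists>\<delta>>0. \<exists>C>0. \<forall>B\<in>\<B>. \<forall>E\<in>sets M. measure (N B) E \<le> C * measure (\<omega> B) E powr \<delta>)"
proof -
  have *: "emeasure M E / emeasure M B \<le> ennreal C * epowr (wint M w E / wint M w B) \<delta> \<longleftrightarrow>
      measure (N B) E \<le> C * measure (\<omega> B) E powr \<delta>"
    if "B \<in> \<B>" "E \<in> sets M" "E \<subseteq> B" "0 < C" "0 < \<delta>" for B E C \<delta>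
    using that by (simp add: emeasure_ratio wint_ratio epowr_ennreal flip: ennreal_mult)
  have **: "(\<forall>E\<in>sets M. E \<subseteq> B \<longrightarrow> measure (N B) E \<le> C * measure (\<omega> B) E powr \<delta>) \<longleftrightarrow>
      (\<forall>E\<in>sets M. measure (N B) E \<le> C * measure (\<omega> B) E powr \<delta>)" if B: "B \<in> \<B>" for B C \<delta>
    using prob_Int[OF B] \<omega>_Int[OF B] B_sets[OF B] by (metis Int_lower2 sets.Int)
  show ?thesis using * ** by (simp cong: conj_cong)
qed

lemma satisfies_P2_iff:
  "satisfies P2 M \<B> w \<longleftrightarrow>
    (\<exists>C>0. \<forall>B\<in>\<B>. (AE x in N B. 0 < v B x) \<and> integrable (N B) (\<lambda>x. ln (v B x)) \<and>
      - ln C \<le> (\<integral>x. ln (v B x) \<partial>N B))"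
  by (simp add: log_avg_le_iff cong: conj_cong)

lemma nn_integral_epowr:
  assumes "B \<in> \<B>" "0 < s"
  shows "(\<integral>\<^sup>+x. epowr (ennreal (v B x)) s \<partial>N B) = (\<integral>\<^sup>+x. ennreal (v B x powr s) \<partial>N B)"
  using mean_one.nonneg[OF mean_one[OF assms(1)]] assms(2)
  by (intro nn_integral_cong epowr_ennreal) auto

lemma satisfies_P2'_iff:
  "satisfies P2' M \<B> w \<longleftrightarrow>
    (\<exists>C>0. \<forall>B\<in>\<B>. \<forall>s. 0 < s \<and> s < 1 \<longrightarrow>
      ennreal (C powr (- s)) \<le> (\<integral>\<^sup>+x. ennreal (v B x powr s) \<partial>N B))"
proof -
  have "wavg M w B \<le> ennreal C * epowr (avg M B (\<lambda>x. epowr (ennreal (w x)) s)) (1 / s) \<longleftrightarrow>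
      ennreal (C powr (- s)) \<le> (\<integral>\<^sup>+x. ennreal (v B x powr s) \<partial>N B)"
    if B: "B \<in> \<B>" and "0 < s" "0 < C" for B s C
    using a_pos[OF B] that
    by (simp add: wavg_eq avg_epowr nn_integral_epowr ennreal_le_mult_iff ennreal_le_epowr_iff
        powr_divide powr_minus field_simps)
  then show ?thesis by (auto cong: conj_cong)
qed

text \<open>Write \<open>q = 1 + e\<close>; one of the factors \<open>v\<close> in
  \<open>v powr (1 + e)\<close> is absorbed by passing from \<open>N B\<close> to
  \<open>\<omega> B\<close>.\<close>

lemma satisfies_P3_iff:
  "satisfies P3 M \<B> w \<longleftrightarrow>
    (\<exists>e>0. \<exists>C>0. \<forall>B\<in>\<B>. (\<integral>\<^sup>+x. ennreal (v B x powr e) \<partial>\<omega> B) \<le> ennreal C)"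
proof -
  have *: "epowr (avg M B (\<lambda>x. epowr (ennreal (w x)) (1 + e))) (1 / (1 + e)) \<le> ennreal C * wavg M w B \<longleftrightarrow>
    (\<integral>\<^sup>+x. ennreal (v B x powr e) \<partial>\<omega> B) \<le> ennreal (C powr (1 + e))"
    if B: "B \<in> \<B>" and "0 < e" "0 < C" for B e C
  proof -
    interpret mean_one "N B" "v B" by (rule mean_one[OF B])
    have "(\<integral>\<^sup>+x. ennreal (v B x powr (1 + e)) \<partial>N B) = (\<integral>\<^sup>+x. ennreal (v B x powr e) \<partial>\<omega> B)"
      using nonneg \<open>0 < e\<close>
      by (subst nn_integral_density) (auto intro!: nn_integral_cong simp: powr_add simp flip: ennreal_mult)
    then show ?thesis
      using a_pos[OF B] that
      by (simp add: wavg_eq avg_epowr nn_integral_epowr ennreal_mult_le_iff epowr_le_iff powr_mult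
          flip: ennreal_mult)
  qed
  show ?thesis
  proof
    assume "satisfies P3 M \<B> w"
    then obtain q C where q: "1 < q" and C: "0 < C"
      and le: "\<forall>B\<in>\<B>. epowr (avg M B (\<lambda>x. epowr (ennreal (w x)) q)) (1 / q) \<le> ennreal C * wavg M w B"
      by auto
    show "\<exists>e>0. \<exists>C>0. \<forall>B\<in>\<B>. (\<integral>\<^sup>+x. ennreal (v B x powr e) \<partial>\<omega> B) \<le> ennreal C"
      using *[of _ "q - 1" C] q C le
      by (intro exI[of _ "q - 1"] exI[of _ "C powr q"] conjI) auto
  next
    assume "\<exists>e>0. \<exists>C>0. \<forall>B\<in>\<B>. (\<integral>\<^sup>+x. ennreal (v B x powr e) \<partial>\<omega> B) \<le> ennreal C"
    then obtain e C where e: "0 < e" and C: "0 < C"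
      and le: "\<forall>B\<in>\<B>. (\<integral>\<^sup>+x. ennreal (v B x powr e) \<partial>\<omega> B) \<le> ennreal C" by auto
    show "satisfies P3 M \<B> w"
      unfolding satisfies.simps
    proof (intro exI conjI ballI)
      show "1 < 1 + e" "0 < C powr (1 / (1 + e))" using e C by auto
      show "epowr (avg M B (\<lambda>x. epowr (ennreal (w x)) (1 + e))) (1 / (1 + e))
          \<le> ennreal (C powr (1 / (1 + e))) * wavg M w B" if "B \<in> \<B>" for B
        using *[OF that e, of "C powr (1 / (1 + e))"] le that e C by (simp add: powr_powr)
    qed
  qed
qed

lemma satisfies_P3'_iff:
  "satisfies P3' M \<B> w \<longleftrightarrow>
    (\<exists>\<delta>>0. \<exists>C>0. \<forall>B\<in>\<B>. \<forall>E\<in>sets M. measure (\<omega> B) E \<le> C * measure (N B) E powr \<delta>)"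
proof -
  have *: "wint M w E / wint M w B \<le> ennreal C * epowr (emeasure M E / emeasure M B) \<delta> \<longleftrightarrow>
      measure (\<omega> B) E \<le> C * measure (N B) E powr \<delta>"
    if "B \<in> \<B>" "E \<in> sets M" "E \<subseteq> B" "0 < C" "0 < \<delta>" for B E C \<delta>
    using that by (simp add: emeasure_ratio wint_ratio epowr_ennreal flip: ennreal_mult)
  have **: "(\<forall>E\<in>sets M. E \<subseteq> B \<longrightarrow> measure (\<omega> B) E \<le> C * measure (N B) E powr \<delta>) \<longleftrightarrow>
      (\<forall>E\<in>sets M. measure (\<omega> B) E \<le> C * measure (N B) E powr \<delta>)" if B: "B \<in> \<B>" for B C \<delta>
    using prob_Int[OF B] \<omega>_Int[OF B] B_sets[OF B] by (metis Int_lower2 sets.Int)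
  show ?thesis using * ** by (simp cong: conj_cong)
qed

lemma satisfies_P4_iff:
  "satisfies P4 M \<B> w \<longleftrightarrow>
    (\<exists>\<alpha> \<beta>. 0 < \<alpha> \<and> \<alpha> < 1 \<and> 0 < \<beta> \<and> \<beta> < 1 \<and>
      (\<forall>B\<in>\<B>. \<forall>E\<in>sets M. measure (N B) E < \<alpha> \<longrightarrow> measure (\<omega> B) E \<le> \<beta>))"
proof -
  have *: "(emeasure M E < ennreal \<alpha> * emeasure M B \<longrightarrow> wint M w E \<le> ennreal \<beta> * wint M w B) \<longleftrightarrow>
      (measure (N B) E < \<alpha> \<longrightarrow> measure (\<omega> B) E \<le> \<beta>)"
    if B: "B \<in> \<B>" and E: "E \<in> sets M" "E \<subseteq> B" and \<alpha>: "0 < \<alpha>" and \<beta>: "0 < \<beta>" for B E \<alpha> \<beta>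
  proof -
    have "E = E \<inter> B" using E by blast
    then have "emeasure M E = ennreal (measure (N B) E * measure M B)"
      "wint M w E = ennreal (measure (\<omega> B) E * (a B * measure M B))"
      using emeasure_Int[OF B E(1)] wint_Int[OF B E(1)] by simp_all
    then show ?thesis
      using B_measure[OF B] a_pos[OF B] \<alpha> \<beta> wint_eq[OF B]
      by (simp add: ennreal_less_iff flip: ennreal_mult)
  qed
  have **: "(\<forall>E\<in>sets M. E \<subseteq> B \<longrightarrow> (measure (N B) E < \<alpha> \<longrightarrow> measure (\<omega> B) E \<le> \<beta>)) \<longleftrightarrow>
      (\<forall>E\<in>sets M. measure (N B) E < \<alpha> \<longrightarrow> measure (\<omega> B) E \<le> \<beta>)" if B: "B \<in> \<B>" for B \<alpha> \<beta>
    using prob_Int[OF B] \<omega>_Int[OF B] B_sets[OF B] by (metis Int_lower2 sets.Int)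
  show ?thesis unfolding satisfies.simps using * ** by (simp cong: conj_cong)
qed

lemma satisfies_P4'_iff:
  "satisfies P4' M \<B> w \<longleftrightarrow>
    (\<exists>\<alpha> \<beta>. 0 < \<alpha> \<and> \<alpha> < 1 \<and> 0 < \<beta> \<and> \<beta> < 1 \<and>
      (\<forall>B\<in>\<B>. measure (N B) {x\<in>space M. v B x \<le> \<alpha>} \<le> \<beta>))"
proof -
  have "emeasure M {x\<in>B. ennreal (w x) \<le> ennreal \<alpha> * wavg M w B} \<le> ennreal \<beta> * emeasure M B \<longleftrightarrow>
      measure (N B) {x\<in>space M. v B x \<le> \<alpha>} \<le> \<beta>"
    if B: "B \<in> \<B>" and \<alpha>: "0 < \<alpha>" and \<beta>: "0 < \<beta>" for B \<alpha> \<beta>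
  proof -
    have "{x\<in>B. ennreal (w x) \<le> ennreal \<alpha> * wavg M w B} = {x\<in>B. w x \<le> \<alpha> * a B}"
      using a_pos[OF B] \<alpha> by (simp add: wavg_eq[OF B] flip: ennreal_mult)
    also have "\<dots> = {x\<in>space M. a B * v B x \<le> \<alpha> * a B} \<inter> B"
      by (rule level_eq[OF B])
    also have "{x\<in>space M. a B * v B x \<le> \<alpha> * a B} = {x\<in>space M. v B x \<le> \<alpha>}"
      using a_pos[OF B] by (simp add: mult.commute)
    finally show ?thesis
      using B_measure[OF B] \<beta> by (simp add: emeasure_Int[OF B] flip: ennreal_mult)
  qed
  then show ?thesis by (simp cong: conj_cong)
qed

text \<open>Replaces the infimum in the median by a single level. \<open>S\<close> is the set whose
  infimum is taken; both its lower bound and its nonemptiness have to be secured, as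
  \<open>Inf\<close> says nothing otherwise.\<close>

lemma satisfies_P5_iff:
  "satisfies P5 M \<B> w \<longleftrightarrow> (\<exists>c>0. \<forall>B\<in>\<B>. 1 / 2 \<le> measure (N B) {x\<in>space M. c < v B x})"
proof -
  define S where "S B = {t. emeasure M {x\<in>B. w x > t} < emeasure M B / 2}" for B
  have S_iff: "a B * t \<in> S B \<longleftrightarrow> measure (N B) {x\<in>space M. t < v B x} < 1 / 2" if B: "B \<in> \<B>" for B t
  proof -
    have "{x\<in>B. w x > a B * t} = {x\<in>space M. a B * v B x > a B * t} \<inter> B"
      by (rule level_eq[OF B])
    also have "\<dots> = {x\<in>space M. t < v B x} \<inter> B" using a_pos[OF B] by simp
    finally have eq: "emeasure M {x\<in>B. w x > a B * t}
        = ennreal (measure (N B) {x\<in>space M. t < v B x} * measure M B)"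
      by (simp add: emeasure_Int[OF B])
    have "emeasure M B / 2 = ennreal (measure M B / 2)"
      using B_measure[OF B] by (simp add: divide_ennreal flip: ennreal_numeral)
    with eq show ?thesis using B_measure[OF B] by (simp add: S_def ennreal_less_iff)
  qed
  \<comment> \<open>For negative \<open>t\<close> the superlevel set is the whole space, of
    probability 1, so \<open>t\<close> is not in \<open>S B\<close>.\<close>
  have nonneg: "0 \<le> t" if B: "B \<in> \<B>" and t: "t \<in> S B" for B t
  proof (rule ccontr)
    assume "\<not> 0 \<le> t"
    interpret mean_one "N B" "v B" by (rule mean_one[OF B])
    have "t / a B < 0" using \<open>\<not> 0 \<le> t\<close> a_pos[OF B] by (simp add: divide_neg_pos)
    then have "{x\<in>space M. t / a B < v B x} = space (N B)" using nonneg by force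
    then show False using S_iff[OF B, of "t / a B"] t a_pos[OF B] prob_space by simp
  qed
  have bdd: "bdd_below (S B)" if "B \<in> \<B>" for B using nonneg[OF that] by (rule bdd_belowI)
  have med: "median M w B = Inf (S B)" for B by (simp add: median_def S_def)
  show ?thesis
  proof
    assume "satisfies P5 M \<B> w"
    then obtain C where C: "0 < C" and le: "\<forall>B\<in>\<B>. wavg M w B \<le> ennreal (C * median M w B)" by auto
    show "\<exists>c>0. \<forall>B\<in>\<B>. 1 / 2 \<le> measure (N B) {x\<in>space M. c < v B x}"
    proof (intro exI[of _ "1 / (2 * C)"] conjI ballI)
      fix B assume B: "B \<in> \<B>"
      have "ennreal (a B) \<le> ennreal (C * median M w B)" using le B by (simp add: wavg_eq)
      then have m: "a B \<le> C * median M w B" using a_pos[OF B] by (simp add: ennreal_le_iff2)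
      \<comment> \<open>The factor 2 places the level strictly below the median, where membership in
        \<open>S B\<close> would contradict the infimum.\<close>
      have "a B * (1 / (2 * C)) \<notin> S B"
      proof
        assume "a B * (1 / (2 * C)) \<in> S B"
        then have "Inf (S B) \<le> a B * (1 / (2 * C))" by (rule cInf_lower[OF _ bdd[OF B]])
        then have "C * Inf (S B) \<le> C * (a B * (1 / (2 * C)))" using C by (intro mult_left_mono) auto
        then show False using m a_pos[OF B] C by (simp add: med)
      qed
      then show "1 / 2 \<le> measure (N B) {x\<in>space M. 1 / (2 * C) < v B x}"
        using S_iff[OF B, of "1 / (2 * C)"] by simp
    qed (use C in simp)
  next
    assume "\<exists>c>0. \<forall>B\<in>\<B>. 1 / 2 \<le> measure (N B) {x\<in>space M. c < v B x}"
    then obtain c where c: "0 < c" and le: "\<forall>B\<in>\<B>. 1 / 2 \<le> measure (N B) {x\<in>space M. c < v B x}" by auto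
    show "satisfies P5 M \<B> w"
      unfolding satisfies.simps
    proof (intro exI[of _ "1 / c"] conjI ballI)
      fix B assume B: "B \<in> \<B>"
      interpret mean_one "N B" "v B" by (rule mean_one[OF B])
      \<comment> \<open>Mean one gives \<open>prob {v > 3} \<le> 1 / 3 < 1 / 2\<close>, so 3 is a
        level that witnesses nonemptiness of \<open>S B\<close>.\<close>
      have "3 * prob {x\<in>space M. 3 < v B x} \<le> measure (\<omega> B) {x\<in>space M. 3 < v B x}"
        by (rule mult_prob_le_\<nu>) auto
      also have "\<dots> \<le> 1" by (rule \<nu>.prob_le_1)
      finally have "a B * 3 \<in> S B" using S_iff[OF B, of 3] by simp
      then have "S B \<noteq> {}" by blast
      moreover have "a B * c \<le> t" if "t \<in> S B" for t
      proof (rule ccontr)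
        assume "\<not> a B * c \<le> t"
        then have "t / a B \<le> c" using a_pos[OF B] by (simp add: field_simps)
        then have "prob {x\<in>space M. c < v B x} \<le> prob {x\<in>space M. t / a B < v B x}"
          by (intro finite_measure_mono) auto
        moreover have "prob {x\<in>space M. t / a B < v B x} < 1 / 2"
          using S_iff[OF B, of "t / a B"] that a_pos[OF B] by simp
        ultimately show False using le B by force
      qed
      ultimately have "a B * c \<le> median M w B" unfolding med by (rule cInf_greatest)
      then show "wavg M w B \<le> ennreal (1 / c * median M w B)"
        using c by (simp add: wavg_eq[OF B] ennreal_leI field_simps)
    qed (use c in simp)
  qed
qed

lemma satisfies_P6_iff:
  "satisfies P6 M \<B> w \<longleftrightarrow>
    (\<exists>C>0. \<forall>B\<in>\<B>. (\<integral>\<^sup>+x. ennreal (v B x * log_plus (v B x)) \<partial>N B) \<le> ennreal C)"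
proof -
  have "(\<integral>\<^sup>+x\<in>B. ennreal (w x * log_plus (w x / enn2real (wavg M w B))) \<partial>M) \<le> ennreal C * wint M w B \<longleftrightarrow>
      (\<integral>\<^sup>+x. ennreal (v B x * log_plus (v B x)) \<partial>N B) \<le> ennreal C"
    if B: "B \<in> \<B>" and C: "0 < C" for B C
  proof -
    have "(\<integral>\<^sup>+x\<in>B. ennreal (w x * log_plus (w x / enn2real (wavg M w B))) \<partial>M)
        = ennreal (measure M B) * (\<integral>\<^sup>+x. ennreal (w x * log_plus (v B x)) \<partial>N B)"
      unfolding a_def[symmetric] v_def[symmetric] by (rule nn_integral_Int[OF B]) measurable
    also have "(\<integral>\<^sup>+x. ennreal (w x * log_plus (v B x)) \<partial>N B)
        = (\<integral>\<^sup>+x. ennreal (a B) * ennreal (v B x * log_plus (v B x)) \<partial>N B)"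
      using a_pos[OF B] by (intro nn_integral_cong) (simp add: w_eq[OF B] mult.assoc flip: ennreal_mult')
    also have "\<dots> = ennreal (a B) * (\<integral>\<^sup>+x. ennreal (v B x * log_plus (v B x)) \<partial>N B)"
      by (rule nn_integral_cmult) measurable
    finally show ?thesis
      using B_measure[OF B] a_pos[OF B] C
      by (simp add: wint_eq[OF B] ennreal_mult_le_iff flip: ennreal_mult)
  qed
  then show ?thesis by (simp cong: conj_cong)
qed

text \<open>Substituting \<open>a B * l\<close> for the level makes both sides proportional to
  \<open>a B * measure M B\<close>. One direction is stated: in the examples (P8) is verified for
  \<open>w\<close> itself.\<close>

lemma satisfies_P8_imp:
  assumes "satisfies P8 M \<B> w"
  obtains C \<beta> where "0 < C" "0 < \<beta>"
    "\<And>B l. B \<in> \<B> \<Longrightarrow> 1 < l \<Longrightarrow>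
      measure (\<omega> B) {x\<in>space M. l \<le> v B x} \<le> C * l * measure (N B) {x\<in>space M. \<beta> * l \<le> v B x}"
proof -
  obtain C \<beta> where C: "0 < C" "0 < \<beta>" and le: "\<forall>B\<in>\<B>. \<forall>l. ennreal l > wavg M w B \<longrightarrow>
      wint M w {x\<in>B. w x \<ge> l} \<le> ennreal (C * l) * emeasure M {x\<in>B. w x \<ge> \<beta> * l}"
    using assms by auto
  have "measure (\<omega> B) {x\<in>space M. l \<le> v B x} \<le> C * l * measure (N B) {x\<in>space M. \<beta> * l \<le> v B x}"
    if B: "B \<in> \<B>" and l: "1 < l" for B l
  proof -
    have level: "{x\<in>B. w x \<ge> a B * t} = {x\<in>space M. t \<le> v B x} \<inter> B" for t
      using a_pos[OF B] level_eq[OF B, of "\<lambda>y. y \<ge> a B * t"] by simp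
    have "ennreal (a B * l) > wavg M w B"
      using a_pos[OF B] l by (simp add: wavg_eq[OF B] ennreal_less_iff)
    then have "wint M w {x\<in>B. w x \<ge> a B * l}
        \<le> ennreal (C * (a B * l)) * emeasure M {x\<in>B. w x \<ge> a B * (\<beta> * l)}"
      using le B by (metis mult.left_commute)
    then have "measure (\<omega> B) {x\<in>space M. l \<le> v B x} * (a B * measure M B)
        \<le> (C * (a B * l)) * (measure (N B) {x\<in>space M. \<beta> * l \<le> v B x} * measure M B)"
      using a_pos[OF B] C l unfolding level
      by (simp add: wint_Int[OF B] emeasure_Int[OF B] flip: ennreal_mult)
    also have "\<dots> = (C * l * measure (N B) {x\<in>space M. \<beta> * l \<le> v B x}) * (a B * measure M B)"
      by simp
    finally show ?thesis using a_pos[OF B] B_measure[OF B] by simp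
  qed
  with C show thesis by (rule that)
qed

section \<open>The valid implications, with constants uniform in the basis\<close>

theorem P1_imp_P1': "satisfies P1 M \<B> w \<Longrightarrow> satisfies P1' M \<B> w"
  unfolding satisfies_P1_iff satisfies_P1'_iff
proof (elim exE conjE)
  fix r C :: real
  assume r: "0 < r" and C: "0 < C"
    and le: "\<forall>B\<in>\<B>. (\<integral>\<^sup>+x. epowr (ennreal (v B x)) (- r) \<partial>N B) \<le> ennreal C"
  have "measure (N B) E \<le> (1 + C) * measure (\<omega> B) E powr (r / (1 + r))"
    if "B \<in> \<B>" "E \<in> sets M" for B E
    using that r C le by (intro mean_one.prob_le_of_neg_moment[OF mean_one]) auto
  then show "\<exists>\<delta>>0. \<exists>C>0. \<forall>B\<in>\<B>. \<forall>E\<in>sets M. measure (N B) E \<le> C * measure (\<omega> B) E powr \<delta>"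
    using r C by - (rule exI[of _ "r / (1 + r)"], intro conjI exI[of _ "1 + C"], auto)
qed

theorem P1'_imp_P1: "satisfies P1' M \<B> w \<Longrightarrow> satisfies P1 M \<B> w"
  unfolding satisfies_P1_iff satisfies_P1'_iff
proof (elim exE conjE)
  fix \<delta> C :: real
  assume \<delta>: "0 < \<delta>" and C: "0 < C"
    and le: "\<forall>B\<in>\<B>. \<forall>E\<in>sets M. measure (N B) E \<le> C * measure (\<omega> B) E powr \<delta>"
  \<comment> \<open>The constants of \<open>neg_moment_le_of_prob_le\<close>, named to show that
    they are built from \<open>\<delta>\<close> and \<open>C\<close> alone.\<close>
  define d where "d = min \<delta> (1/2)"
  define \<theta> where "\<theta> = d / (1 - d)"
  define K where "K = 1 + C powr (1 / (1 - d)) * 2 powr (\<theta> / 2) / (1 - 2 powr (- \<theta> / 2))"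
  have \<theta>: "0 < \<theta>" using \<delta> by (auto simp: \<theta>_def d_def)
  then have "2 powr (- \<theta> / 2) < (1::real)" using powr_less_mono[of "- \<theta> / 2" 0 "2::real"] by simp
  then have "0 < K" by (auto simp: K_def intro!: add_pos_nonneg)
  moreover have "(\<integral>\<^sup>+x. epowr (ennreal (v B x)) (- (\<theta> / 2)) \<partial>N B) \<le> ennreal K" if B: "B \<in> \<B>" for B
    using mean_one.neg_moment_le_of_prob_le[OF mean_one[OF B] \<delta> C] le B
    by (simp add: K_def \<theta>_def d_def)
  ultimately show "\<exists>r>0. \<exists>C>0. \<forall>B\<in>\<B>. (\<integral>\<^sup>+x. epowr (ennreal (v B x)) (- r) \<partial>N B) \<le> ennreal C"
    using \<theta> by - (rule exI[of _ "\<theta> / 2"], intro conjI exI[of _ K], auto)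
qed

theorem P2_imp_P2': "satisfies P2 M \<B> w \<Longrightarrow> satisfies P2' M \<B> w"
  unfolding satisfies_P2_iff satisfies_P2'_iff
proof (elim exE conjE)
  fix C :: real
  assume C: "0 < C" and le: "\<forall>B\<in>\<B>. (AE x in N B. 0 < v B x) \<and> integrable (N B) (\<lambda>x. ln (v B x)) \<and>
      - ln C \<le> (\<integral>x. ln (v B x) \<partial>N B)"
  have "ennreal (C powr (- s)) \<le> (\<integral>\<^sup>+x. ennreal (v B x powr s) \<partial>N B)" if "B \<in> \<B>" "0 < s" for B s
    using mean_one.power_mean_ge_of_ln_integral[OF mean_one, of B s "ln C"] le that C
    by (simp add: powr_def mult.commute)
  with C show "\<exists>C>0. \<forall>B\<in>\<B>. \<forall>s. 0 < s \<and> s < 1 \<longrightarrow>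
      ennreal (C powr (- s)) \<le> (\<integral>\<^sup>+x. ennreal (v B x powr s) \<partial>N B)"
    by blast
qed

theorem P2'_imp_P2: "satisfies P2' M \<B> w \<Longrightarrow> satisfies P2 M \<B> w"
  unfolding satisfies_P2_iff satisfies_P2'_iff
proof (elim exE conjE)
  fix C :: real
  assume C: "0 < C" and le: "\<forall>B\<in>\<B>. \<forall>s. 0 < s \<and> s < 1 \<longrightarrow>
      ennreal (C powr (- s)) \<le> (\<integral>\<^sup>+x. ennreal (v B x powr s) \<partial>N B)"
  then show "\<exists>C>0. \<forall>B\<in>\<B>. (AE x in N B. 0 < v B x) \<and> integrable (N B) (\<lambda>x. ln (v B x)) \<and>
      - ln C \<le> (\<integral>x. ln (v B x) \<partial>N B)"
    using mean_one.ln_integral_ge_of_power_mean[OF mean_one C] by blast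
qed

theorem P3_imp_P3': "satisfies P3 M \<B> w \<Longrightarrow> satisfies P3' M \<B> w"
  unfolding satisfies_P3_iff satisfies_P3'_iff
proof (elim exE conjE)
  fix e C :: real
  assume e: "0 < e" and C: "0 < C"
    and le: "\<forall>B\<in>\<B>. (\<integral>\<^sup>+x. ennreal (v B x powr e) \<partial>\<omega> B) \<le> ennreal C"
  have "measure (\<omega> B) E \<le> (1 + C) * measure (N B) E powr (e / (1 + e))"
    if "B \<in> \<B>" "E \<in> sets M" for B E
    using that e C le by (intro mean_one.\<nu>_le_of_moment[OF mean_one]) auto
  then show "\<exists>\<delta>>0. \<exists>C>0. \<forall>B\<in>\<B>. \<forall>E\<in>sets M. measure (\<omega> B) E \<le> C * measure (N B) E powr \<delta>"
    using e C by - (rule exI[of _ "e / (1 + e)"], intro conjI exI[of _ "1 + C"], auto)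
qed

theorem P3'_imp_P3: "satisfies P3' M \<B> w \<Longrightarrow> satisfies P3 M \<B> w"
  unfolding satisfies_P3_iff satisfies_P3'_iff
proof (elim exE conjE)
  fix \<delta> C :: real
  assume \<delta>: "0 < \<delta>" and C: "0 < C"
    and le: "\<forall>B\<in>\<B>. \<forall>E\<in>sets M. measure (\<omega> B) E \<le> C * measure (N B) E powr \<delta>"
  define d where "d = min \<delta> (1/2)"
  define \<theta> where "\<theta> = d / (1 - d)"
  define K where "K = 1 + C powr (1 / (1 - d)) * 2 powr (\<theta> / 2) / (1 - 2 powr (- \<theta> / 2))"
  have \<theta>: "0 < \<theta>" using \<delta> by (auto simp: \<theta>_def d_def)
  then have "2 powr (- \<theta> / 2) < (1::real)" using powr_less_mono[of "- \<theta> / 2" 0 "2::real"] by simp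
  then have "0 < K" by (auto simp: K_def intro!: add_pos_nonneg)
  moreover have "(\<integral>\<^sup>+x. ennreal (v B x powr (\<theta> / 2)) \<partial>\<omega> B) \<le> ennreal K" if B: "B \<in> \<B>" for B
    using mean_one.moment_le_of_\<nu>_le[OF mean_one[OF B] \<delta> C] le B
    by (simp add: K_def \<theta>_def d_def)
  ultimately show "\<exists>e>0. \<exists>C>0. \<forall>B\<in>\<B>. (\<integral>\<^sup>+x. ennreal (v B x powr e) \<partial>\<omega> B) \<le> ennreal C"
    using \<theta> by - (rule exI[of _ "\<theta> / 2"], intro conjI exI[of _ K], auto)
qed

theorem P4_imp_P4': "satisfies P4 M \<B> w \<Longrightarrow> satisfies P4' M \<B> w"
  unfolding satisfies_P4_iff satisfies_P4'_iff
proof (elim exE conjE)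
  fix \<alpha> \<beta> :: real
  assume \<alpha>: "0 < \<alpha>" "\<alpha> < 1" and \<beta>: "0 < \<beta>" "\<beta> < 1"
    and ac: "\<forall>B\<in>\<B>. \<forall>E\<in>sets M. measure (N B) E < \<alpha> \<longrightarrow> measure (\<omega> B) E \<le> \<beta>"
  have "measure (N B) {x\<in>space M. v B x \<le> (1 - \<beta>) / 2} \<le> 1 - \<alpha> / 2" if B: "B \<in> \<B>" for B
    using mean_one.prob_le_of_absolute_continuity[OF mean_one[OF B] \<alpha> \<beta>] ac B by simp
  with \<alpha> \<beta> show "\<exists>\<alpha> \<beta>. 0 < \<alpha> \<and> \<alpha> < 1 \<and> 0 < \<beta> \<and> \<beta> < 1 \<and>
      (\<forall>B\<in>\<B>. measure (N B) {x\<in>space M. v B x \<le> \<alpha>} \<le> \<beta>)"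
    by - (rule exI[of _ "(1 - \<beta>) / 2"], rule exI[of _ "1 - \<alpha> / 2"], auto)
qed

theorem P4'_imp_P4: "satisfies P4' M \<B> w \<Longrightarrow> satisfies P4 M \<B> w"
  unfolding satisfies_P4_iff satisfies_P4'_iff
proof (elim exE conjE)
  fix \<alpha> \<beta> :: real
  assume \<alpha>: "0 < \<alpha>" "\<alpha> < 1" and \<beta>: "0 < \<beta>" "\<beta> < 1"
    and le: "\<forall>B\<in>\<B>. measure (N B) {x\<in>space M. v B x \<le> \<alpha>} \<le> \<beta>"
  have "measure (\<omega> B) E \<le> 1 - \<alpha> * (1 - \<beta>) / 2"
    if B: "B \<in> \<B>" and "E \<in> sets M" "measure (N B) E < (1 - \<beta>) / 2" for B E
    using mean_one.absolute_continuity_of_prob_le[OF mean_one[OF B] \<alpha>(1)] le that by simp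
  moreover have "0 < \<alpha> * (1 - \<beta>)" "\<alpha> * (1 - \<beta>) < 1 * 1"
    using \<alpha> \<beta> by (simp, intro mult_strict_mono) auto
  ultimately show "\<exists>\<alpha> \<beta>. 0 < \<alpha> \<and> \<alpha> < 1 \<and> 0 < \<beta> \<and> \<beta> < 1 \<and>
      (\<forall>B\<in>\<B>. \<forall>E\<in>sets M. measure (N B) E < \<alpha> \<longrightarrow> measure (\<omega> B) E \<le> \<beta>)"
    using \<beta> by - (rule exI[of _ "(1 - \<beta>) / 2"], rule exI[of _ "1 - \<alpha> * (1 - \<beta>) / 2"], auto)
qed

theorem P1_imp_P2: "satisfies P1 M \<B> w \<Longrightarrow> satisfies P2 M \<B> w"
  unfolding satisfies_P1_iff satisfies_P2_iff
proof (elim exE conjE)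
  fix r C :: real
  assume r: "0 < r" and C: "0 < C"
    and le: "\<forall>B\<in>\<B>. (\<integral>\<^sup>+x. epowr (ennreal (v B x)) (- r) \<partial>N B) \<le> ennreal C"
  have "(AE x in N B. 0 < v B x) \<and> integrable (N B) (\<lambda>x. ln (v B x)) \<and>
      - ln (C powr (1 / r)) \<le> (\<integral>x. ln (v B x) \<partial>N B)" if B: "B \<in> \<B>" for B
  proof -
    interpret mean_one "N B" "v B" by (rule mean_one[OF B])
    have pos: "AE x in N B. 0 < v B x" using AE_pos_of_neg_moment[OF r] le B by blast
    have "AE x in N B. ennreal (v B x powr (- r)) = ennreal ((1 / v B x) powr r)"
      using pos by eventually_elim (simp add: powr_minus_divide powr_divide)
    then have eq: "(\<integral>\<^sup>+x. ennreal (v B x powr (- r)) \<partial>N B) = (\<integral>\<^sup>+x. ennreal ((1 / v B x) powr r) \<partial>N B)"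
      by (rule nn_integral_cong_AE)
    have "(\<integral>\<^sup>+x. ennreal (v B x powr (- r)) \<partial>N B) \<le> ennreal C"
      using bspec[OF le B] unfolding nn_integral_epowr_neg[OF r pos] eq .
    with pos ln_integral_ge_of_neg_moment[OF r pos C] C show ?thesis by (simp add: ln_powr)
  qed
  with C show "\<exists>C>0. \<forall>B\<in>\<B>. (AE x in N B. 0 < v B x) \<and> integrable (N B) (\<lambda>x. ln (v B x)) \<and>
      - ln C \<le> (\<integral>x. ln (v B x) \<partial>N B)"
    by (intro exI[of _ "C powr (1 / r)"]) auto
qed

theorem P2_imp_P5: "satisfies P2 M \<B> w \<Longrightarrow> satisfies P5 M \<B> w"
  unfolding satisfies_P2_iff satisfies_P5_iff
proof (elim exE conjE)
  fix C :: real
  assume C: "0 < C" and le: "\<forall>B\<in>\<B>. (AE x in N B. 0 < v B x) \<and> integrable (N B) (\<lambda>x. ln (v B x)) \<and>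
      - ln C \<le> (\<integral>x. ln (v B x) \<partial>N B)"
  \<comment> \<open>The absolute value supplies the nonnegative \<open>k\<close> that
    \<open>median_of_ln_integral\<close> asks for.\<close>
  have "1 / 2 \<le> measure (N B) {x\<in>space M. exp (- 2 * \<bar>ln C\<bar> - 2) < v B x}" if "B \<in> \<B>" for B
    using mean_one.median_of_ln_integral[OF mean_one, of B "\<bar>ln C\<bar>"] le that by fastforce
  then show "\<exists>c>0. \<forall>B\<in>\<B>. 1 / 2 \<le> measure (N B) {x\<in>space M. c < v B x}"
    by (intro exI[of _ "exp (- 2 * \<bar>ln C\<bar> - 2)"]) auto
qed

text \<open>(P5) keeps \<open>v\<close> above a fixed level on half of each \<open>B\<close>, which
  is (P4') with \<open>\<beta> = 1/2\<close>; the minimum with 1/2 keeps \<open>\<alpha>\<close>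
  below 1.\<close>

theorem P5_imp_P4: "satisfies P5 M \<B> w \<Longrightarrow> satisfies P4 M \<B> w"
proof (rule P4'_imp_P4)
  assume "satisfies P5 M \<B> w"
  then obtain c where c: "0 < c" and le: "\<forall>B\<in>\<B>. 1 / 2 \<le> measure (N B) {x\<in>space M. c < v B x}"
    unfolding satisfies_P5_iff by blast
  define \<alpha> where "\<alpha> = min c (1/2)"
  have "measure (N B) {x\<in>space M. v B x \<le> \<alpha>} \<le> 1 / 2" if B: "B \<in> \<B>" for B
  proof -
    interpret mean_one "N B" "v B" by (rule mean_one[OF B])
    have "prob {x\<in>space M. v B x \<le> \<alpha>} \<le> prob (space (N B) - {x\<in>space M. c < v B x})"
      by (intro finite_measure_mono) (auto simp: \<alpha>_def)
    also have "\<dots> = 1 - prob {x\<in>space M. c < v B x}" by (rule prob_compl) simp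
    also have "\<dots> \<le> 1 / 2" using le B by simp
    finally show ?thesis .
  qed
  then show "satisfies P4' M \<B> w"
    unfolding satisfies_P4'_iff using c
    by - (rule exI[of _ \<alpha>], rule exI[of _ "1/2"], (auto simp: \<alpha>_def))
qed

theorem P3_imp_P6: "satisfies P3 M \<B> w \<Longrightarrow> satisfies P6 M \<B> w"
  unfolding satisfies_P3_iff satisfies_P6_iff
proof (elim exE conjE)
  fix e C :: real
  assume e: "0 < e" and C: "0 < C"
    and le: "\<forall>B\<in>\<B>. (\<integral>\<^sup>+x. ennreal (v B x powr e) \<partial>\<omega> B) \<le> ennreal C"
  then show "\<exists>C>0. \<forall>B\<in>\<B>. (\<integral>\<^sup>+x. ennreal (v B x * log_plus (v B x)) \<partial>N B) \<le> ennreal C"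
    using mean_one.LlogL_of_moment[OF mean_one e] by (intro exI[of _ "C / e"]) auto
qed

theorem P6_imp_P4: "satisfies P6 M \<B> w \<Longrightarrow> satisfies P4 M \<B> w"
  unfolding satisfies_P6_iff satisfies_P4_iff
proof (elim exE conjE)
  fix C :: real
  assume C: "0 < C"
    and le: "\<forall>B\<in>\<B>. (\<integral>\<^sup>+x. ennreal (v B x * log_plus (v B x)) \<partial>N B) \<le> ennreal C"
  have "exp (- 4 * C) / 4 < 1" using C by (simp add: less_trans[of _ 1])
  with C le show "\<exists>\<alpha> \<beta>. 0 < \<alpha> \<and> \<alpha> < 1 \<and> 0 < \<beta> \<and> \<beta> < 1 \<and>
      (\<forall>B\<in>\<B>. \<forall>E\<in>sets M. measure (N B) E < \<alpha> \<longrightarrow> measure (\<omega> B) E \<le> \<beta>)"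
    using mean_one.absolute_continuity_of_LlogL[OF mean_one C]
    by - (rule exI[of _ "exp (- 4 * C) / 4"], rule exI[of _ "1/2"], auto)
qed

theorem P8_imp_P3: "satisfies P8 M \<B> w \<Longrightarrow> satisfies P3 M \<B> w"
proof -
  assume "satisfies P8 M \<B> w"
  then obtain C \<beta> where C: "0 < C" and \<beta>: "0 < \<beta>" and weak: "\<And>B l. B \<in> \<B> \<Longrightarrow> 1 < l \<Longrightarrow>
      measure (\<omega> B) {x\<in>space M. l \<le> v B x} \<le> C * l * measure (N B) {x\<in>space M. \<beta> * l \<le> v B x}"
    by (rule satisfies_P8_imp) blast
  \<comment> \<open>\<open>b\<close>, \<open>J\<close> and hence the exponent \<open>e\<close>
    depend on \<open>C\<close> and \<open>\<beta>\<close> only, so one \<open>e\<close> serves all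
    \<open>B\<close>; the resulting moment bound is even an absolute constant.\<close>
  define b where "b = min \<beta> (1/2)"
  define J where "J = nat \<lceil>2 * C / (b * (1 - b))\<rceil>"
  define e where "e = ln 2 / (2 * ln (1 / b ^ J))"
  have b: "0 < b" "b < 1" using \<beta> by (auto simp: b_def)
  have "0 < J" using C b by (simp add: J_def)
  then have "b ^ J < 1" "0 < b ^ J" using b by (auto simp: power_less_one_iff)
  then have "0 < e" by (simp add: e_def)
  moreover have "(\<integral>\<^sup>+x. ennreal (v B x powr e) \<partial>\<omega> B) \<le> ennreal (1 + sqrt 2 / (1 - sqrt 2 / 2))"
    if B: "B \<in> \<B>" for B
    using mean_one.moment_le_of_weak_type[OF mean_one[OF B] C \<beta>] weak[OF B]
    by (simp add: e_def J_def b_def)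
  moreover have "0 < 1 + sqrt 2 / (1 - sqrt 2 / 2)"
    using real_sqrt_less_mono[of 2 4] by (intro add_pos_nonneg) auto
  ultimately show ?thesis unfolding satisfies_P3_iff by blast
qed

end

section \<open>Atomic measures on the real line\<close>

text \<open>A point of \<open>B\<close> lies in no other set of the basis, so the maximal function
  of \<open>w\<close> restricted to \<open>B\<close> is the constant \<open>wavg M w B\<close> on
  \<open>B\<close>; hence \<open>C = 1\<close>.\<close>

lemma (in weighted_basis) satisfies_P7_of_disjoint:
  assumes disj: "disjoint \<B>"
  shows "satisfies P7 M \<B> w"
proof -
  have "(\<integral>\<^sup>+x\<in>B. maximal M \<B> (\<lambda>y. ennreal (w y) * indicator B y) x \<partial>M) \<le> wint M w B"
    if B: "B \<in> \<B>" for B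
  proof -
    have "maximal M \<B> (\<lambda>y. ennreal (w y) * indicator B y) x = wavg M w B" if "x \<in> B" for x
    proof -
      have "{B'\<in>\<B>. x \<in> B'} = {B}" using disjointD[OF disj _ B] B that by blast
      then show ?thesis
        by (simp add: maximal_def avg_def wavg_def wint_def mult.assoc flip: indicator_inter_arith)
    qed
    then have "(\<integral>\<^sup>+x\<in>B. maximal M \<B> (\<lambda>y. ennreal (w y) * indicator B y) x \<partial>M)
        = (\<integral>\<^sup>+x. wavg M w B * indicator B x \<partial>M)"
      by (intro nn_integral_cong) (auto split: split_indicator)
    also have "\<dots> = wavg M w B * emeasure M B"
      using B_sets[OF B] by (rule nn_integral_cmult_indicator)
    also have "\<dots> = wint M w B"
      using B_measure[OF B] a_pos[OF B] by (simp add: wavg_eq[OF B] wint_eq[OF B] ennreal_mult)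
    finally show ?thesis by simp
  qed
  then show ?thesis by (auto intro!: exI[of _ 1])
qed

text \<open>The family lives on an arbitrary index type and is transported to the real line along \<open>e\<close>.\<close>

locale atomic_weight =
  fixes e :: "'b \<Rightarrow> real" and m u :: "'b \<Rightarrow> real" and \<A> :: "'b set set"
  assumes inj: "inj e" and countable: "countable (UNIV :: 'b set)"
    and finite: "A \<in> \<A> \<Longrightarrow> finite A"
    and m_pos: "0 < m i" and u_nonneg: "0 \<le> u i"
    and total_pos: "A \<in> \<A> \<Longrightarrow> 0 < (\<Sum>i\<in>A. m i * u i)"
begin

text \<open>The space consists only of points covered by the family, so the basis covers it with no
  exception, and every subset is measurable.\<close>

definition P :: "real measure" where
  "P = point_measure (e ` \<Union>\<A>) (\<lambda>x. ennreal (m (inv e x)))"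

definition W :: "real \<Rightarrow> real" where "W x = u (inv e x)"

lemma inv_e [simp]: "inv e (e i) = i"
  by (rule inv_f_f[OF inj])

lemma W_e [simp]: "W (e i) = u i"
  by (simp add: W_def)

lemma sets_P: "sets P = Pow (e ` \<Union>\<A>)" and space_P: "space P = e ` \<Union>\<A>"
  by (simp_all add: P_def sets_point_measure space_point_measure)

lemma nn_integral_P:
  assumes "A \<in> \<A>" "S \<subseteq> A"
  shows "(\<integral>\<^sup>+x\<in>e ` S. f x \<partial>P) = (\<Sum>i\<in>S. ennreal (m i) * f (e i))"
proof -
  have S: "finite S" using finite assms finite_subset by blast
  have "(\<integral>\<^sup>+x\<in>e ` S. f x \<partial>P)
      = (\<integral>\<^sup>+x. ennreal (m (inv e x)) * (f x * indicator (e ` S) x) \<partial>count_space (e ` \<Union>\<A>))"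
    unfolding P_def point_measure_def by (subst nn_integral_density) auto
  also have "\<dots> = (\<Sum>x\<in>e ` S. ennreal (m (inv e x)) * (f x * indicator (e ` S) x))"
    using S assms by (intro nn_integral_count_space') auto
  also have "\<dots> = (\<Sum>i\<in>S. ennreal (m i) * f (e i))"
    using inj by (subst sum.reindex) (auto intro: inj_on_subset simp: o_def)
  finally show ?thesis .
qed

lemma emeasure_P:
  assumes "A \<in> \<A>" "S \<subseteq> A"
  shows "emeasure P (e ` S) = ennreal (\<Sum>i\<in>S. m i)"
proof -
  have "e ` S \<in> sets P" using assms by (auto simp: sets_P)
  then show ?thesis
    using nn_integral_P[OF assms, of "\<lambda>_. 1"] nn_integral_indicator[of "e ` S" P] m_pos
    by (simp add: less_imp_le)
qed

lemma wint_P: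
  assumes "A \<in> \<A>" "S \<subseteq> A"
  shows "wint P W (e ` S) = ennreal (\<Sum>i\<in>S. m i * u i)"
  unfolding wint_def nn_integral_P[OF assms]
  using m_pos u_nonneg by (subst sum_ennreal[symmetric]) (auto simp: ennreal_mult less_imp_le)

definition mass :: "'b set \<Rightarrow> real" where "mass A = (\<Sum>i\<in>A. m i)"
definition mean :: "'b set \<Rightarrow> real" where "mean A = (\<Sum>i\<in>A. m i * u i) / mass A"

lemma mass_pos: "A \<in> \<A> \<Longrightarrow> 0 < mass A"
  unfolding mass_def using m_pos finite total_pos[of A] by (intro sum_pos) auto

sublocale weighted_basis P "image e ` \<A>" W
proof
  show "weight P (image e ` \<A>) W"
    unfolding weight_def
  proof (intro conjI ballI)
    show "W \<in> borel_measurable P" by (simp add: P_def)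
    show "0 \<le> W x" for x using u_nonneg by (simp add: W_def)
    fix B assume "B \<in> image e ` \<A>"
    then obtain A where "A \<in> \<A>" "B = e ` A" by blast
    then show "0 < wint P W B" "wint P W B < \<infinity>" using total_pos by (simp_all add: wint_P[OF _ order_refl])
  qed
  have "0 < emeasure P (e ` A) \<and> emeasure P (e ` A) < \<infinity>" if "A \<in> \<A>" for A
    using emeasure_P[OF that order_refl] mass_pos[OF that] by (simp add: mass_def)
  moreover have "AE x in P. x \<in> \<Union>(image e ` \<A>)"
    using AE_space by eventually_elim (auto simp: space_P)
  ultimately show "basis P (image e ` \<A>)"
    unfolding basis_def by (auto simp: sets_P)
qed

lemma sigma_finite_P: "sigma_finite_measure P"
proof
  have c: "countable (e ` \<Union>\<A>)" by (intro countable_image countable_subset[OF _ countable]) auto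
  show "\<exists>A. countable A \<and> A \<subseteq> sets P \<and> \<Union> A = space P \<and> (\<forall>a\<in>A. emeasure P a \<noteq> \<infinity>)"
  proof (intro exI[of _ "(\<lambda>x. {x}) ` (e ` \<Union>\<A>)"] conjI ballI)
    fix E assume "E \<in> (\<lambda>x. {x}) ` (e ` \<Union>\<A>)"
    then obtain i A where "E = e ` {i}" "i \<in> A" "A \<in> \<A>" by auto
    then show "emeasure P E \<noteq> \<infinity>" using emeasure_P[of A "{i}"] by simp
  qed (use c in \<open>auto simp: sets_P space_P\<close>)
qed

context
  fixes A assumes A: "A \<in> \<A>"
begin

lemma eA: "e ` A \<in> image e ` \<A>"
  using A by blast

lemma measure_eA: "measure P (e ` A) = mass A"
  using emeasure_P[OF A order_refl] mass_pos[OF A] by (simp add: measure_def mass_def)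

lemma a_eq: "a (e ` A) = mean A"
proof -
  have "ennreal (a (e ` A) * mass A) = ennreal (\<Sum>i\<in>A. m i * u i)"
    using wint_P[OF A order_refl] wint_eq[OF eA] measure_eA by simp
  then have "a (e ` A) * mass A = (\<Sum>i\<in>A. m i * u i)"
    using a_pos[OF eA] mass_pos[OF A] total_pos[OF A] by (subst (asm) ennreal_inj) auto
  then show ?thesis using mass_pos[OF A] by (simp add: mean_def field_simps)
qed

lemma mean_pos: "0 < mean A"
  using a_pos[OF eA] by (simp add: a_eq)

lemma v_eq: "v (e ` A) (e i) = u i / mean A"
  by (simp add: v_def a_eq)

lemma nn_integral_N: "(\<integral>\<^sup>+x. f x \<partial>N (e ` A)) = (\<Sum>i\<in>A. ennreal (m i) * f (e i)) / ennreal (mass A)"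
proof -
  have [measurable]: "f \<in> borel_measurable P" by (simp add: P_def)
  show ?thesis
    using avg_eq[OF eA, of f] nn_integral_P[OF A order_refl, of f] emeasure_P[OF A order_refl]
    by (simp add: avg_def mass_def)
qed

lemma nn_integral_N_real:
  assumes "\<And>i. i \<in> A \<Longrightarrow> 0 \<le> f (e i)"
  shows "(\<integral>\<^sup>+x. ennreal (f x) \<partial>N (e ` A)) = ennreal ((\<Sum>i\<in>A. m i * f (e i)) / mass A)"
proof -
  have "(\<Sum>i\<in>A. ennreal (m i) * ennreal (f (e i))) = ennreal (\<Sum>i\<in>A. m i * f (e i))"
    using assms m_pos by (subst sum_ennreal[symmetric]) (auto simp: ennreal_mult less_imp_le intro!: sum.cong)
  then show ?thesis
    using assms m_pos mass_pos[OF A]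
    by (simp add: nn_integral_N divide_ennreal sum_nonneg less_imp_le)
qed

lemma nn_integral_\<omega>_real:
  assumes "\<And>i. i \<in> A \<Longrightarrow> 0 \<le> f (e i)"
  shows "(\<integral>\<^sup>+x. ennreal (f x) \<partial>\<omega> (e ` A)) = ennreal ((\<Sum>i\<in>A. m i * (u i / mean A * f (e i))) / mass A)"
proof -
  have [measurable]: "f \<in> borel_measurable P" by (simp add: P_def)
  have "(\<integral>\<^sup>+x. ennreal (f x) \<partial>\<omega> (e ` A)) = (\<integral>\<^sup>+x. ennreal (v (e ` A) x) * ennreal (f x) \<partial>N (e ` A))"
    by (subst nn_integral_density) auto
  also have "\<dots> = (\<integral>\<^sup>+x. ennreal (v (e ` A) x * f x) \<partial>N (e ` A))"
    unfolding nn_integral_N using assms u_nonneg mean_pos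
    by (intro arg_cong2[of _ _ _ _ "(/)"] sum.cong) (auto simp: v_eq simp flip: ennreal_mult)
  also have "\<dots> = ennreal ((\<Sum>i\<in>A. m i * (u i / mean A * f (e i))) / mass A)"
    using assms u_nonneg mean_pos by (subst nn_integral_N_real) (auto simp: v_eq)
  finally show ?thesis .
qed

lemma integrable_N: "integrable (N (e ` A)) f"
  and integral_N: "(\<integral>x. f x \<partial>N (e ` A)) = (\<Sum>i\<in>A. m i * f (e i)) / mass A"
proof -
  have [measurable]: "f \<in> borel_measurable P" by (simp add: P_def)
  have pos: "(\<integral>\<^sup>+x. ennreal (g x) \<partial>N (e ` A)) = ennreal ((\<Sum>i\<in>A. m i * max 0 (g (e i))) / mass A)" for g
  proof -
    have "(\<integral>\<^sup>+x. ennreal (g x) \<partial>N (e ` A)) = (\<integral>\<^sup>+x. ennreal (max 0 (g x)) \<partial>N (e ` A))"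
      by (intro nn_integral_cong) (simp add: max_def ennreal_neg)
    then show ?thesis by (simp add: nn_integral_N_real)
  qed
  show "integrable (N (e ` A)) f" by (simp add: real_integrable_def pos)
  then have "(\<integral>x. f x \<partial>N (e ` A)) = (\<Sum>i\<in>A. m i * max 0 (f (e i))) / mass A
      - (\<Sum>i\<in>A. m i * max 0 (- f (e i))) / mass A"
    using m_pos mass_pos[OF A]
    by (simp add: real_lebesgue_integral_def pos sum_nonneg less_imp_le)
  also have "\<dots> = (\<Sum>i\<in>A. m i * f (e i)) / mass A"
    by (simp add: max_def if_distrib flip: diff_divide_distrib sum_subtractf cong: if_cong)
  finally show "(\<integral>x. f x \<partial>N (e ` A)) = (\<Sum>i\<in>A. m i * f (e i)) / mass A" .
qed

lemma measure_N:
  assumes E: "E \<subseteq> space P"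
  shows "measure (N (e ` A)) E = (\<Sum>i | i \<in> A \<and> e i \<in> E. m i) / mass A"
proof -
  interpret mean_one "N (e ` A)" "v (e ` A)" by (rule mean_one[OF eA])
  have E': "E \<in> sets P" using E by (simp add: sets_P space_P)
  have "ennreal (prob E) = (\<integral>\<^sup>+x. ennreal (indicator E x) \<partial>N (e ` A))"
    using E' by (simp add: emeasure_eq_measure ennreal_indicator)
  also have "\<dots> = ennreal ((\<Sum>i\<in>A. m i * indicator E (e i)) / mass A)"
    by (rule nn_integral_N_real) simp
  also have "(\<Sum>i\<in>A. m i * indicator E (e i)) = (\<Sum>i | i \<in> A \<and> e i \<in> E. m i)"
    using finite[OF A] by (intro sum.mono_neutral_cong_right) auto
  finally show ?thesis
    using m_pos mass_pos[OF A] by (simp add: sum_nonneg less_imp_le)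
qed

lemma measure_\<omega>:
  assumes E: "E \<subseteq> space P"
  shows "measure (\<omega> (e ` A)) E = (\<Sum>i | i \<in> A \<and> e i \<in> E. m i * (u i / mean A)) / mass A"
proof -
  interpret mean_one "N (e ` A)" "v (e ` A)" by (rule mean_one[OF eA])
  have E': "E \<in> sets P" using E by (simp add: sets_P space_P)
  have "ennreal (measure (\<omega> (e ` A)) E) = (\<integral>\<^sup>+x. ennreal (indicator E x) \<partial>\<omega> (e ` A))"
    using E' by (simp add: \<nu>.emeasure_eq_measure ennreal_indicator)
  also have "\<dots> = ennreal ((\<Sum>i\<in>A. m i * (u i / mean A * indicator E (e i))) / mass A)"
    by (rule nn_integral_\<omega>_real) simp
  also have "(\<Sum>i\<in>A. m i * (u i / mean A * indicator E (e i)))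
      = (\<Sum>i | i \<in> A \<and> e i \<in> E. m i * (u i / mean A))"
    using finite[OF A] by (intro sum.mono_neutral_cong_right) auto
  finally show ?thesis
    using m_pos u_nonneg mean_pos mass_pos[OF A] by (simp add: sum_nonneg less_imp_le)
qed

lemma level_eA: "{x\<in>e ` A. Q (W x)} = e ` {i\<in>A. Q (u i)}"
  by auto

end

text \<open>The case \<open>r = 1\<close>, that is \<open>p = p' = 2\<close>, which the examples
  satisfying (P1) all meet.\<close>

lemma satisfies_P1I:
  assumes C: "0 < C" and u: "\<And>i. 0 < u i"
    and le: "\<And>A. A \<in> \<A> \<Longrightarrow> mean A * (\<Sum>i\<in>A. m i / u i) \<le> C * mass A"
  shows "satisfies P1 P (image e ` \<A>) W"
  unfolding satisfies_P1_iff
proof (rule exI[of _ "1::real"], intro conjI exI[of _ C] ballI C)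
  fix B assume "B \<in> image e ` \<A>"
  then obtain A where A: "A \<in> \<A>" and B: "B = e ` A" by blast
  note mean = mean_pos[OF A]
  have inverse: "epowr (ennreal (u i / mean A)) (- 1) = ennreal (mean A / u i)" for i
    using epowr_ennreal_neg[of "u i / mean A" 1] u[of i] mean by simp
  have "(\<integral>\<^sup>+x. epowr (ennreal (v B x)) (- 1) \<partial>N B)
      = (\<Sum>i\<in>A. ennreal (m i) * ennreal (mean A / u i)) / ennreal (mass A)"
    unfolding B nn_integral_N[OF A] v_eq[OF A] inverse ..
  also have "\<dots> = ennreal (mean A * (\<Sum>i\<in>A. m i / u i)) / ennreal (mass A)"
    using u mean m_pos
    by (subst sum_distrib_left, subst sum_ennreal[symmetric])
       (auto simp: less_imp_le mult.commute simp flip: ennreal_mult)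
  also have "\<dots> \<le> ennreal C"
  proof -
    have "0 \<le> mean A * (\<Sum>i\<in>A. m i / u i)"
      using u mean m_pos by (intro mult_nonneg_nonneg sum_nonneg) (auto simp: less_imp_le)
    then show ?thesis
      using le[OF A] mass_pos[OF A] by (simp add: divide_ennreal ennreal_leI divide_le_eq)
  qed
  finally show "(\<integral>\<^sup>+x. epowr (ennreal (v B x)) (- 1) \<partial>N B) \<le> ennreal C" .
qed simp

text \<open>The same level set may be used on both sides: \<open>\<beta> = 1\<close> suffices for
  the examples.\<close>

lemma satisfies_P8I:
  assumes C: "0 < C"
    and le: "\<And>A t. A \<in> \<A> \<Longrightarrow> mean A < t \<Longrightarrow>
      (\<Sum>i | i \<in> A \<and> t \<le> u i. m i * u i) \<le> C * t * (\<Sum>i | i \<in> A \<and> t \<le> u i. m i)"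
  shows "satisfies P8 P (image e ` \<A>) W"
  unfolding satisfies.simps
proof (rule exI[of _ C], intro conjI exI[of _ "1::real"] ballI C allI impI)
  fix B t assume "B \<in> image e ` \<A>" and t: "wavg P W B < ennreal t"
  then obtain A where A: "A \<in> \<A>" and B: "B = e ` A" by blast
  have mt: "mean A < t" "0 < t"
    using t mean_pos[OF A] by (auto simp: B wavg_eq[OF eA[OF A]] a_eq[OF A] ennreal_less_iff)
  have S: "{i\<in>A. t \<le> u i} \<subseteq> A" by auto
  show "wint P W {x\<in>B. t \<le> W x} \<le> ennreal (C * t) * emeasure P {x\<in>B. 1 * t \<le> W x}"
    unfolding B level_eA[OF A] mult_1 wint_P[OF A S] emeasure_P[OF A S]
    using le[OF A mt(1)] C mt m_pos by (simp add: sum_nonneg less_imp_le flip: ennreal_mult)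
qed simp

lemma fails_for_general_basesI:
  assumes "satisfies PA P (image e ` \<A>) W" "\<not> satisfies PB P (image e ` \<A>) W"
  shows "fails_for_general_bases TYPE(real) PA PB"
  unfolding fails_for_general_bases_def using sigma_finite_P basis weight assms by blast

end

lemma log_plus_nonneg: "0 \<le> log_plus t"
  by (simp add: log_plus_def)

text \<open>Disjoint blocks of two atoms: one of mass \<open>1\<close> carrying the value \<open>l n\<close>, and one of mass
  \<open>\<epsilon> n\<close> carrying the value \<open>h n\<close>.\<close>

locale two_level =
  fixes l \<epsilon> h :: "nat \<Rightarrow> real"
  assumes l_nonneg: "0 \<le> l n" and \<epsilon>_pos: "0 < \<epsilon> n" and h_pos: "0 < h n"
begin

definition blk :: "nat \<Rightarrow> (nat \<times> bool) set" where "blk n = {(n, False), (n, True)}"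

sublocale atomic_weight "\<lambda>i. real (to_nat i)"
  "\<lambda>(n, b). if b then \<epsilon> n else 1" "\<lambda>(n, b). if b then h n else l n" "range blk"
proof
  show "inj (\<lambda>i :: nat \<times> bool. real (to_nat i))"
    by (auto intro!: injI)
qed (use l_nonneg \<epsilon>_pos h_pos in \<open>auto simp: blk_def less_imp_le add_nonneg_pos split: prod.split\<close>)

lemma blk: "blk n \<in> range blk"
  by simp

lemma sum_blk: "(\<Sum>i\<in>blk n. f i) = f (n, False) + f (n, True)"
  by (simp add: blk_def)

lemma sum_blk_filter: "(\<Sum>i | i \<in> blk n \<and> Q i. f i)
    = (if Q (n, False) then f (n, False) else 0) + (if Q (n, True) then f (n, True) else 0)"
  by (subst sum.inter_filter) (auto simp: blk_def)

definition \<mu> :: "nat \<Rightarrow> real" where "\<mu> n = (l n + \<epsilon> n * h n) / (1 + \<epsilon> n)"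

lemma mass_blk: "mass (blk n) = 1 + \<epsilon> n"
  by (simp add: mass_def sum_blk)

lemma mean_blk: "mean (blk n) = \<mu> n"
  by (simp add: mean_def mass_blk sum_blk \<mu>_def)

lemma \<mu>_pos: "0 < \<mu> n"
  using mean_pos[OF blk, of n] by (simp add: mean_blk)

abbreviation sat :: "condition \<Rightarrow> bool" where
  "sat PA \<equiv> satisfies PA P (image (\<lambda>i. real (to_nat i)) ` range blk) W"

lemma sat_P7: "sat P7"
proof (rule satisfies_P7_of_disjoint, rule disjointI)
  fix B B' assume "B \<in> image (\<lambda>i. real (to_nat i)) ` range blk"
    "B' \<in> image (\<lambda>i. real (to_nat i)) ` range blk" "B \<noteq> B'"
  then obtain n n' where "B = (\<lambda>i. real (to_nat i)) ` blk n" "B' = (\<lambda>i. real (to_nat i)) ` blk n'"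
    "n \<noteq> n'" by blast
  then show "B \<inter> B' = {}" by (auto simp: blk_def)
qed

lemma sat_P1:
  assumes "\<And>n. 0 < l n" "0 < C" "\<And>n. \<mu> n * (1 / l n + \<epsilon> n / h n) \<le> C * (1 + \<epsilon> n)"
  shows "sat P1"
  using assms h_pos
  by (intro satisfies_P1I[of C]) (auto simp: sum_blk mass_blk mean_blk split: prod.split)

lemma sat_P6_iff:
  "sat P6 \<longleftrightarrow> (\<exists>C>0. \<forall>n. l n / \<mu> n * log_plus (l n / \<mu> n)
    + \<epsilon> n * (h n / \<mu> n * log_plus (h n / \<mu> n)) \<le> C * (1 + \<epsilon> n))"
proof -
  have "(\<integral>\<^sup>+x. ennreal (v ((\<lambda>i. real (to_nat i)) ` blk n) x
        * log_plus (v ((\<lambda>i. real (to_nat i)) ` blk n) x)) \<partial>N ((\<lambda>i. real (to_nat i)) ` blk n)) \<le> ennreal C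
      \<longleftrightarrow> l n / \<mu> n * log_plus (l n / \<mu> n) + \<epsilon> n * (h n / \<mu> n * log_plus (h n / \<mu> n)) \<le> C * (1 + \<epsilon> n)"
    if "0 < C" for n C
    using that \<mu>_pos l_nonneg h_pos \<epsilon>_pos[of n]
    by (subst nn_integral_N_real[OF blk])
       (auto simp: v_eq[OF blk] sum_blk mass_blk mean_blk divide_le_eq less_imp_le
         intro!: divide_nonneg_nonneg mult_nonneg_nonneg log_plus_nonneg)
  then show ?thesis unfolding satisfies_P6_iff by (simp cong: conj_cong)
qed

lemma sat_P3_iff:
  "sat P3 \<longleftrightarrow> (\<exists>e>0. \<exists>C>0. \<forall>n. l n / \<mu> n * (l n / \<mu> n) powr e
    + \<epsilon> n * (h n / \<mu> n * (h n / \<mu> n) powr e) \<le> C * (1 + \<epsilon> n))"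
proof -
  have "(\<integral>\<^sup>+x. ennreal (v ((\<lambda>i. real (to_nat i)) ` blk n) x powr e) \<partial>\<omega> ((\<lambda>i. real (to_nat i)) ` blk n)) \<le> ennreal C
      \<longleftrightarrow> l n / \<mu> n * (l n / \<mu> n) powr e + \<epsilon> n * (h n / \<mu> n * (h n / \<mu> n) powr e) \<le> C * (1 + \<epsilon> n)"
    if "0 < C" for n C e
    using that \<epsilon>_pos[of n]
    by (subst nn_integral_\<omega>_real[OF blk])
       (auto simp: v_eq[OF blk] sum_blk mass_blk mean_blk divide_le_eq less_imp_le)
  then show ?thesis unfolding satisfies_P3_iff by (simp cong: conj_cong)
qed

lemma measure_level:
  "measure (N ((\<lambda>i. real (to_nat i)) ` blk n)) {x\<in>space P. Q (v ((\<lambda>i. real (to_nat i)) ` blk n) x)}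
    = ((if Q (l n / \<mu> n) then 1 else 0) + (if Q (h n / \<mu> n) then \<epsilon> n else 0)) / (1 + \<epsilon> n)"
  "measure (\<omega> ((\<lambda>i. real (to_nat i)) ` blk n)) {x\<in>space P. Q (v ((\<lambda>i. real (to_nat i)) ` blk n) x)}
    = ((if Q (l n / \<mu> n) then l n / \<mu> n else 0) + (if Q (h n / \<mu> n) then \<epsilon> n * (h n / \<mu> n) else 0)) / (1 + \<epsilon> n)"
proof -
  have eq: "{i. i \<in> blk n \<and> real (to_nat i) \<in> {x\<in>space P. Q (v ((\<lambda>i. real (to_nat i)) ` blk n) x)}}
    = {i. i \<in> blk n \<and> Q (v ((\<lambda>i. real (to_nat i)) ` blk n) (real (to_nat i)))}"
    by (auto simp: space_P)
  show "measure (N ((\<lambda>i. real (to_nat i)) ` blk n)) {x\<in>space P. Q (v ((\<lambda>i. real (to_nat i)) ` blk n) x)}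
    = ((if Q (l n / \<mu> n) then 1 else 0) + (if Q (h n / \<mu> n) then \<epsilon> n else 0)) / (1 + \<epsilon> n)"
    by (subst measure_N[OF blk], blast, unfold eq sum_blk_filter) (simp add: v_eq[OF blk] mass_blk mean_blk)
  show "measure (\<omega> ((\<lambda>i. real (to_nat i)) ` blk n)) {x\<in>space P. Q (v ((\<lambda>i. real (to_nat i)) ` blk n) x)}
    = ((if Q (l n / \<mu> n) then l n / \<mu> n else 0) + (if Q (h n / \<mu> n) then \<epsilon> n * (h n / \<mu> n) else 0)) / (1 + \<epsilon> n)"
    by (subst measure_\<omega>[OF blk], blast, unfold eq sum_blk_filter) (simp add: v_eq[OF blk] mass_blk mean_blk)
qed

lemma sat_P8:
  assumes "0 < C" "\<And>n t. \<mu> n < t \<Longrightarrow> (if t \<le> l n then l n else 0) + (if t \<le> h n then \<epsilon> n * h n else 0)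
    \<le> C * t * ((if t \<le> l n then 1 else 0) + (if t \<le> h n then \<epsilon> n else 0))"
  shows "sat P8"
proof (rule satisfies_P8I[OF assms(1)])
  fix A t assume "A \<in> range blk" "mean A < t"
  then obtain n where n: "A = blk n" "\<mu> n < t" by (auto simp: mean_blk)
  show "(\<Sum>i | i \<in> A \<and> t \<le> (case i of (n, b) \<Rightarrow> if b then h n else l n).
      (case i of (n, b) \<Rightarrow> if b then \<epsilon> n else 1) * (case i of (n, b) \<Rightarrow> if b then h n else l n))
    \<le> C * t * (\<Sum>i | i \<in> A \<and> t \<le> (case i of (n, b) \<Rightarrow> if b then h n else l n).
      (case i of (n, b) \<Rightarrow> if b then \<epsilon> n else 1))"
    using assms(2)[OF n(2)] unfolding n(1) sum_blk_filter by (auto split: if_splits)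
qed

text \<open>(P2) makes the density positive almost everywhere, but it vanishes on the atom of mass
  1.\<close>

lemma not_sat_P2:
  assumes "l n = 0"
  shows "\<not> sat P2"
proof
  let ?B = "(\<lambda>i. real (to_nat i)) ` blk n"
  assume "sat P2"
  then have pos: "AE x in N ?B. 0 < v ?B x" unfolding satisfies_P2_iff by blast
  interpret mean_one "N ?B" "v ?B" by (rule mean_one[OF eA[OF blk]])
  have "prob {x\<in>space (N ?B). 0 < v ?B x} = 1"
    by (subst prob_Collect_eq_1) (use pos in auto)
  then have "\<epsilon> n / (1 + \<epsilon> n) = 1"
    using measure_level(1)[where Q = "\<lambda>y. 0 < y" and n = n] assms h_pos \<mu>_pos by simp
  then show False using \<epsilon>_pos[of n] by (simp add: divide_eq_eq split: if_splits)
qed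

end

section \<open>Two-atom counterexamples\<close>

text \<open>The high atom carries half of the weight of its block, so the L log L mean grows like
  \<open>ln (k n) / 2\<close>. The means of \<open>w\<close> and of \<open>1 / w\<close> stay
  bounded.\<close>

lemma P1_not_P6: "fails_for_general_bases TYPE(real) P1 P6"
proof -
  define k where "k n = real n + 1" for n
  have k: "1 \<le> k n" for n by (simp add: k_def)
  interpret two_level "\<lambda>_. 1" "\<lambda>n. 1 / k n" k
    using k by unfold_locales (auto intro: order_less_le_trans[OF zero_less_one])
  have \<mu>: "\<mu> n = 2 / (1 + 1 / k n)" for n using k[of n] by (simp add: \<mu>_def)
  have \<mu>2: "\<mu> n \<le> 2" for n
  proof -
    have q: "0 \<le> 1 / k n" using k[of n] by simp
    then have p: "0 < 1 + 1 / k n" by (intro add_pos_nonneg) auto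
    show ?thesis unfolding \<mu> pos_divide_le_eq[OF p] using q by simp
  qed
  have "sat P1"
  proof (rule sat_P1)
    fix n
    have "1 / k n / k n \<le> 1" using k[of n] mult_mono[of 1 "k n" 1 "k n"] by (simp add: divide_le_eq)
    then have "\<mu> n * (1 / 1 + 1 / k n / k n) \<le> 2 * (1 + 1)"
      using k[of n] \<mu>2 by (intro mult_mono) auto
    also have "\<dots> \<le> 4 * (1 + 1 / k n)" using k[of n] by simp
    finally show "\<mu> n * (1 / 1 + 1 / k n / k n) \<le> 4 * (1 + 1 / k n)" .
  qed auto
  moreover have "\<not> sat P6"
  proof
    assume "sat P6"
    then obtain C where C: "0 < C" and le: "\<And>n. 1 / \<mu> n * log_plus (1 / \<mu> n)
        + 1 / k n * (k n / \<mu> n * log_plus (k n / \<mu> n)) \<le> C * (1 + 1 / k n)"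
      unfolding sat_P6_iff by blast
    \<comment> \<open>\<open>k n / 2\<close> bounds the normalised height below, so its logarithm
      exceeds \<open>4 * C + 1\<close>; half of this is already more than the available
      \<open>2 * C\<close>.\<close>
    obtain n where "2 * exp (4 * C + 1) < real n" using reals_Archimedean2 by blast
    then have n: "2 * exp (4 * C + 1) < k n" by (simp add: k_def)
    have "exp (4 * C + 1) \<le> k n / 2" using n by simp
    also have "\<dots> \<le> k n / \<mu> n" using \<mu>2[of n] \<mu>_pos[of n] k[of n] by (intro divide_left_mono) auto
    finally have "4 * C + 1 \<le> ln (k n / \<mu> n)"
      using \<mu>_pos[of n] k[of n] by (subst ln_ge_iff) auto
    then have L: "4 * C + 1 \<le> log_plus (k n / \<mu> n)"
      using \<mu>_pos[of n] k[of n] by (auto simp: log_plus_def)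
    have "(4 * C + 1) / 2 \<le> log_plus (k n / \<mu> n) / \<mu> n"
      using L C \<mu>2[of n] \<mu>_pos[of n] by (intro frac_le) auto
    also have "\<dots> = 1 / k n * (k n / \<mu> n * log_plus (k n / \<mu> n))" using k[of n] by simp
    also have "\<dots> \<le> 1 / \<mu> n * log_plus (1 / \<mu> n) + 1 / k n * (k n / \<mu> n * log_plus (k n / \<mu> n))"
      using \<mu>_pos[of n] by (simp add: log_plus_nonneg)
    also have "\<dots> \<le> C * (1 + 1 / k n)" by (rule le)
    also have "\<dots> \<le> C * (1 + 1)" using C k[of n] by (intro mult_left_mono) auto
    finally show False by simp
  qed
  ultimately show ?thesis by (rule fails_for_general_basesI)
qed

text \<open>Identical blocks: the weight is an indicator filling a third of the block, so its median
  is 0. With only one positive value, a level \<open>t\<close> between the mean \<open>1/3\<close>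
  and 1 satisfies \<open>1 \<le> 3 * t\<close>, which is (P8).\<close>

lemma P8_not_P5: "fails_for_general_bases TYPE(real) P8 P5"
proof -
  interpret two_level "\<lambda>_. 0" "\<lambda>_. 1 / 2" "\<lambda>_. 1" by unfold_locales auto
  have \<mu>: "\<mu> n = 1 / 3" for n by (simp add: \<mu>_def)
  have "sat P8"
  proof (rule sat_P8[of 3])
    fix n t assume "\<mu> n < t"
    then have "1 / 3 < t" by (simp add: \<mu>)
    then show "(if t \<le> 0 then 0 else 0) + (if t \<le> 1 then 1 / 2 * 1 else 0)
        \<le> 3 * t * ((if t \<le> 0 then 1 else 0) + (if t \<le> 1 then 1 / 2 else 0))"
      by auto
  qed simp
  moreover have "\<not> sat P5"
  proof
    assume "sat P5"
    then obtain c where c: "0 < c" and le: "1 / 2 \<le> measure (N ((\<lambda>i. real (to_nat i)) ` blk 0))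
        {x\<in>space P. c < v ((\<lambda>i. real (to_nat i)) ` blk 0) x}"
      unfolding satisfies_P5_iff by blast
    show False
      using le c unfolding measure_level(1)[where Q = "\<lambda>y. c < y"] by (auto split: if_splits)
  qed
  ultimately show ?thesis by (rule fails_for_general_basesI)
qed

text \<open>All means are 1; the high atom occupies the fraction \<open>1 / (k n + 1)\<close> of its
  block but carries the fraction \<open>k n / (k n + 1)\<close> of the weight.\<close>

lemma P7_not_P4: "fails_for_general_bases TYPE(real) P7 P4"
proof -
  define k where "k n = real n + 1" for n
  have k: "1 \<le> k n" for n by (simp add: k_def)
  interpret two_level "\<lambda>n. 1 / k n" "\<lambda>n. 1 / k n" k
    using k by unfold_locales (auto simp: less_imp_le intro: order_less_le_trans[OF zero_less_one] order_trans[OF zero_le_one])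
  have \<mu>: "\<mu> n = 1" for n
  proof -
    have "0 < 1 + 1 / k n" using k[of n] by (intro add_pos_nonneg) auto
    then show ?thesis using k[of n] by (simp add: \<mu>_def add.commute)
  qed
  have "\<not> sat P4"
  proof
    assume "sat P4"
    then obtain \<alpha> \<beta> where ab: "0 < \<alpha>" "\<beta> < 1" and le: "\<And>n E. E \<in> sets P \<Longrightarrow>
        measure (N ((\<lambda>i. real (to_nat i)) ` blk n)) E < \<alpha> \<Longrightarrow>
        measure (\<omega> ((\<lambda>i. real (to_nat i)) ` blk n)) E \<le> \<beta>"
      unfolding satisfies_P4_iff by blast
    obtain n where "max (1 / \<alpha>) (1 / (1 - \<beta>)) < real n" using reals_Archimedean2 by blast
    then have n: "1 / \<alpha> < real n" "1 / (1 - \<beta>) < real n" by auto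
    moreover have "0 < 1 / \<alpha>" using ab by simp
    ultimately have n: "1 / \<alpha> < k n" "1 / (1 - \<beta>) < k n" "1 < k n" unfolding k_def by linarith+
    let ?E = "{x\<in>space P. 1 < v ((\<lambda>i. real (to_nat i)) ` blk n) x}"
    have "measure (N ((\<lambda>i. real (to_nat i)) ` blk n)) ?E = 1 / k n / (1 + 1 / k n)"
      unfolding measure_level(1)[where Q = "\<lambda>y. 1 < y"] using n by (simp add: \<mu>)
    also have "\<dots> \<le> 1 / k n" using n by (simp add: field_simps)
    also have "\<dots> < \<alpha>" using n ab by (simp add: field_simps)
    finally have "measure (\<omega> ((\<lambda>i. real (to_nat i)) ` blk n)) ?E \<le> \<beta>"
      by (intro le) (auto simp: sets_P space_P)
    then have "1 / (1 + 1 / k n) \<le> \<beta>"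
      unfolding measure_level(2)[where Q = "\<lambda>y. 1 < y"] using n by (simp add: \<mu>)
    then show False using n ab by (simp add: field_simps)
  qed
  with sat_P7 show ?thesis by (rule fails_for_general_basesI)
qed

text \<open>The second moment stays bounded because \<open>\<epsilon> h\<^sup>2 = 1\<close> in the
  block data, but there are no values between 1 and \<open>k n\<close>. At a fixed level
  \<open>t\<close> the weight above is of order \<open>1 / k n\<close>, the measure above only of
  order \<open>1 / (k n)\<^sup>2\<close>.\<close>

lemma P3_not_P8: "fails_for_general_bases TYPE(real) P3 P8"
proof -
  define k where "k n = real n + 1" for n
  have k: "1 \<le> k n" for n by (simp add: k_def)
  interpret two_level "\<lambda>_. 1" "\<lambda>n. 1 / (k n)\<^sup>2" k
    using k by unfold_locales (auto intro: order_less_le_trans[OF zero_less_one] simp: k_def)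
  have "1 / (k n)\<^sup>2 * k n = 1 / k n" for n using k[of n] by (simp add: power2_eq_square)
  then have \<mu>: "\<mu> n = (1 + 1 / k n) / (1 + 1 / (k n)\<^sup>2)" for n
    by (simp only: \<mu>_def)
  have kk: "k n \<le> (k n)\<^sup>2" for n using k[of n] by (simp add: power2_eq_square)
  then have kk': "1 / (k n)\<^sup>2 \<le> 1 / k n" for n using k[of n] by (intro divide_left_mono) auto
  have \<mu>1: "1 \<le> \<mu> n" for n
    unfolding \<mu> using kk'[of n] by (subst le_divide_eq) (auto simp: add_pos_nonneg)
  have \<mu>2: "\<mu> n \<le> 2" for n
  proof -
    have "1 / k n \<le> 1" using k[of n] by simp
    then have "1 + 1 / k n \<le> 2 * 1" using add_left_mono[of "1 / k n" 1 1] by (simp only: mult_1_right one_add_one)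
    also have "\<dots> \<le> 2 * (1 + 1 / (k n)\<^sup>2)" by (intro mult_left_mono) auto
    finally have le: "1 + 1 / k n \<le> 2 * (1 + 1 / (k n)\<^sup>2)" .
    have p: "0 < 1 + 1 / (k n)\<^sup>2" by (intro add_pos_nonneg) auto
    show ?thesis unfolding \<mu> pos_divide_le_eq[OF p] by (rule le)
  qed
  have "sat P3"
    unfolding sat_P3_iff
  proof (rule exI[of _ 1], intro conjI exI[of _ 2] allI)
    fix n
    have "1 / \<mu> n * (1 / \<mu> n) powr 1 \<le> 1 * 1"
      using \<mu>1[of n] by (intro mult_mono) auto
    moreover have "1 / (k n)\<^sup>2 * (k n / \<mu> n * (k n / \<mu> n) powr 1) = 1 / \<mu> n * (1 / \<mu> n)"
      using k[of n] \<mu>1[of n] by (simp add: power2_eq_square)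
    moreover have "1 / \<mu> n * (1 / \<mu> n) \<le> 1 * 1"
      using \<mu>1[of n] by (intro mult_mono) auto
    ultimately have "1 / \<mu> n * (1 / \<mu> n) powr 1 + 1 / (k n)\<^sup>2 * (k n / \<mu> n * (k n / \<mu> n) powr 1) \<le> 2"
      by linarith
    also have "\<dots> \<le> 2 * (1 + 1 / (k n)\<^sup>2)" by simp
    finally show "1 / \<mu> n * (1 / \<mu> n) powr 1 + 1 / (k n)\<^sup>2 * (k n / \<mu> n * (k n / \<mu> n) powr 1)
      \<le> 2 * (1 + 1 / (k n)\<^sup>2)" .
  qed auto
  moreover have "\<not> sat P8"
  proof
    assume "sat P8"
    then obtain C \<beta> where C: "0 < C" "0 < \<beta>" and weak: "\<And>n t. 1 < t \<Longrightarrow>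
        measure (\<omega> ((\<lambda>i. real (to_nat i)) ` blk n)) {x\<in>space P. t \<le> v ((\<lambda>i. real (to_nat i)) ` blk n) x}
        \<le> C * t * measure (N ((\<lambda>i. real (to_nat i)) ` blk n))
            {x\<in>space P. \<beta> * t \<le> v ((\<lambda>i. real (to_nat i)) ` blk n) x}"
      by (rule satisfies_P8_imp) blast
    \<comment> \<open>Both \<open>t\<close> and \<open>\<beta> * t\<close> exceed 1, so the low
      atom, whose normalised value is at most 1, is left out on either side.\<close>
    define t where "t = max 2 (2 / \<beta>)"
    have t: "1 < t" "1 < \<beta> * t" using C by (auto simp: t_def max_def field_simps)
    obtain n where "max (2 * t) (2 * C * t) < real n" using reals_Archimedean2 by blast
    then have n: "2 * t < k n" "2 * C * t < k n" by (auto simp: k_def)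
    have "k n / 2 \<le> k n / \<mu> n" using \<mu>2[of n] \<mu>1[of n] k[of n] by (intro divide_left_mono) auto
    moreover from this n(1) have "t \<le> k n / \<mu> n" by linarith
    ultimately have h: "k n / 2 \<le> k n / \<mu> n" "t \<le> k n / \<mu> n" .
    have l: "1 / \<mu> n \<le> 1" using \<mu>1[of n] by simp
    have "1 / (k n)\<^sup>2 * (k n / \<mu> n) / (1 + 1 / (k n)\<^sup>2)
        = measure (\<omega> ((\<lambda>i. real (to_nat i)) ` blk n)) {x\<in>space P. t \<le> v ((\<lambda>i. real (to_nat i)) ` blk n) x}"
      unfolding measure_level(2)[where Q = "\<lambda>y. t \<le> y"] using h l t by auto
    also note weak[OF t(1), of n]
    also have "measure (N ((\<lambda>i. real (to_nat i)) ` blk n)) {x\<in>space P. \<beta> * t \<le> v ((\<lambda>i. real (to_nat i)) ` blk n) x}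
        \<le> 1 / (k n)\<^sup>2 / (1 + 1 / (k n)\<^sup>2)"
      unfolding measure_level(1)[where Q = "\<lambda>y. \<beta> * t \<le> y"] using l t by auto
    finally have "1 / (k n)\<^sup>2 * (k n / \<mu> n) / (1 + 1 / (k n)\<^sup>2)
        \<le> C * t * (1 / (k n)\<^sup>2 / (1 + 1 / (k n)\<^sup>2))"
      using C t by (simp add: mult_left_mono)
    then have "(k n / \<mu> n) * (1 / (k n)\<^sup>2 / (1 + 1 / (k n)\<^sup>2))
        \<le> C * t * (1 / (k n)\<^sup>2 / (1 + 1 / (k n)\<^sup>2))" by (simp add: ac_simps)
    moreover have "0 < 1 / (k n)\<^sup>2 / (1 + 1 / (k n)\<^sup>2)"
      using k[of n] by (intro divide_pos_pos add_pos_nonneg) auto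
    ultimately have "k n / \<mu> n \<le> C * t" by (subst (asm) mult_le_cancel_right_pos)
    then show False using h n by simp
  qed
  ultimately show ?thesis by (rule fails_for_general_basesI)
qed

text \<open>The high atom carries weight \<open>1 / k n\<close> at height \<open>exp (k n)\<close>:
  multiplied by the logarithm \<open>k n\<close> this is bounded, multiplied by
  \<open>exp (e * k n)\<close> it is not, for any \<open>e > 0\<close>.\<close>

lemma P6_not_P3: "fails_for_general_bases TYPE(real) P6 P3"
proof -
  define k where "k n = real n + 2" for n
  have k: "2 \<le> k n" for n by (simp add: k_def)
  define \<epsilon> where "\<epsilon> n = exp (- k n) / k n" for n
  have \<epsilon>: "0 < \<epsilon> n" "\<epsilon> n \<le> 1 / k n" "\<epsilon> n \<le> 1" for n
  proof -
    show "0 < \<epsilon> n" using k[of n] by (simp add: \<epsilon>_def)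
    show *: "\<epsilon> n \<le> 1 / k n" unfolding \<epsilon>_def using k[of n] by (intro divide_right_mono) auto
    have "1 / k n \<le> 1" using k[of n] by simp
    with * show "\<epsilon> n \<le> 1" by simp
  qed
  interpret two_level "\<lambda>_. 1" \<epsilon> "\<lambda>n. exp (k n)" using \<epsilon> by unfold_locales auto
  have \<epsilon>h: "\<epsilon> n * exp (k n) = 1 / k n" for n by (simp add: \<epsilon>_def exp_minus)
  have \<mu>: "\<mu> n = (1 + 1 / k n) / (1 + \<epsilon> n)" for n by (simp add: \<mu>_def \<epsilon>h)
  have \<mu>1: "1 \<le> \<mu> n" for n unfolding \<mu> using \<epsilon>[of n] by (subst le_divide_eq) auto
  have \<mu>2: "\<mu> n \<le> 2" for n
  proof -
    have "1 / k n \<le> 1" using k[of n] by simp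
    then show ?thesis unfolding \<mu> using \<epsilon>[of n] by (subst divide_le_eq) auto
  qed
  have "sat P6"
    unfolding sat_P6_iff
  proof (rule exI[of _ 1], intro conjI allI)
    fix n
    have "ln (1 / \<mu> n) \<le> 0" using \<mu>1[of n] by (simp add: ln_div)
    then have 1: "log_plus (1 / \<mu> n) = 0" by (simp add: log_plus_def)
    have "ln (exp (k n) / \<mu> n) \<le> k n" using \<mu>1[of n] by (simp add: ln_div)
    then have "log_plus (exp (k n) / \<mu> n) \<le> k n" using k[of n] by (simp add: log_plus_def)
    then have "\<epsilon> n * (exp (k n) / \<mu> n * log_plus (exp (k n) / \<mu> n)) \<le> \<epsilon> n * (exp (k n) / \<mu> n * k n)"
      using \<epsilon>[of n] \<mu>1[of n] by (intro mult_left_mono) auto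
    also have "\<dots> = (\<epsilon> n * exp (k n)) * k n / \<mu> n" by simp
    also have "\<dots> = 1 / \<mu> n" unfolding \<epsilon>h using k[of n] by simp
    also have "\<dots> \<le> 1 * (1 + \<epsilon> n)" using \<mu>1[of n] \<epsilon>[of n] by (rule_tac order_trans[of _ 1]) auto
    finally show "1 / \<mu> n * log_plus (1 / \<mu> n)
        + \<epsilon> n * (exp (k n) / \<mu> n * log_plus (exp (k n) / \<mu> n)) \<le> 1 * (1 + \<epsilon> n)"
      unfolding 1 by simp
  qed simp
  moreover have "\<not> sat P3"
  proof
    assume "sat P3"
    then obtain e C where e: "0 < e" and C: "0 < C" and le: "\<And>n. 1 / \<mu> n * (1 / \<mu> n) powr e
        + \<epsilon> n * (exp (k n) / \<mu> n * (exp (k n) / \<mu> n) powr e) \<le> C * (1 + \<epsilon> n)"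
      unfolding sat_P3_iff by blast
    \<comment> \<open>The quadratic Taylor bound for \<open>exp\<close> and
      \<open>k n - 1 \<ge> k n / 2\<close> will give
      \<open>k n * e\<^sup>2 / 16 \<le> 2 * C\<close>.\<close>
    obtain n where "32 * C / e\<^sup>2 < real n" using reals_Archimedean2 by blast
    then have "32 * C < real n * e\<^sup>2" using e by (simp add: field_simps)
    also have "\<dots> \<le> k n * e\<^sup>2" by (intro mult_right_mono) (auto simp: k_def)
    finally have n: "32 * C < k n * e\<^sup>2" .
    have "exp (k n - 1) = exp (k n) / exp 1" by (rule exp_diff)
    also have "\<dots> \<le> exp (k n) / 2"
      using exp_ge_add_one_self[of 1] by (intro divide_left_mono) auto
    also have "\<dots> \<le> exp (k n) / \<mu> n" using \<mu>2[of n] \<mu>1[of n] by (intro divide_left_mono) auto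
    finally have "exp (k n - 1) powr e \<le> (exp (k n) / \<mu> n) powr e" using e by (intro powr_mono2) auto
    then have A: "exp (e * (k n - 1)) \<le> (exp (k n) / \<mu> n) powr e" by (simp add: powr_def)
    have "0 \<le> e * (k n - 1)" using e k[of n] by simp
    then have "(e * (k n - 1))\<^sup>2 / 2 \<le> exp (e * (k n - 1))"
      using exp_lower_Taylor_quadratic[of "e * (k n - 1)"] by linarith
    moreover have "(e * (k n / 2))\<^sup>2 \<le> (e * (k n - 1))\<^sup>2"
      using e k[of n] by (intro power_mono mult_left_mono) auto
    ultimately have B: "(e * k n)\<^sup>2 / 8 \<le> (exp (k n) / \<mu> n) powr e"
      using A by (simp add: power_mult_distrib power_divide)
    have "k n * e\<^sup>2 / 16 = 1 / k n / 2 * ((e * k n)\<^sup>2 / 8)"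
      using k[of n] by (simp add: power2_eq_square)
    also have "\<dots> \<le> 1 / k n / \<mu> n * (exp (k n) / \<mu> n) powr e"
      using k[of n] \<mu>1[of n] \<mu>2[of n] by (intro mult_mono B divide_left_mono) auto
    also have "\<dots> = \<epsilon> n * exp (k n) / \<mu> n * (exp (k n) / \<mu> n) powr e" unfolding \<epsilon>h ..
    also have "\<dots> = \<epsilon> n * (exp (k n) / \<mu> n * (exp (k n) / \<mu> n) powr e)" by (simp add: mult.assoc)
    also have "\<dots> \<le> 1 / \<mu> n * (1 / \<mu> n) powr e
        + \<epsilon> n * (exp (k n) / \<mu> n * (exp (k n) / \<mu> n) powr e)"
      using \<mu>1[of n] by simp
    also have "\<dots> \<le> C * (1 + \<epsilon> n)" by (rule le)
    also have "\<dots> \<le> C * (1 + 1)" using C \<epsilon>[of n] by (intro mult_left_mono) auto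
    finally show False using n by simp
  qed
  ultimately show ?thesis by (rule fails_for_general_basesI)
qed

text \<open>Half of each block has \<open>v = 2\<close>, which is just enough for the median
  condition with \<open>\<ge> 1 / 2\<close>; the other half has \<open>v = 0\<close>.\<close>

lemma P5_not_P2: "fails_for_general_bases TYPE(real) P5 P2"
proof -
  interpret two_level "\<lambda>_. 0" "\<lambda>_. 1" "\<lambda>_. 1" by unfold_locales auto
  have \<mu>: "\<mu> n = 1 / 2" for n by (simp add: \<mu>_def)
  have "sat P5"
    unfolding satisfies_P5_iff
  proof (intro exI[of _ 1] conjI ballI)
    fix B assume "B \<in> image (\<lambda>i. real (to_nat i)) ` range blk"
    then obtain n where B: "B = (\<lambda>i. real (to_nat i)) ` blk n" by blast
    show "1 / 2 \<le> measure (N B) {x\<in>space P. 1 < v B x}"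
      unfolding B measure_level(1)[where Q = "\<lambda>y. 1 < y"] by (simp add: \<mu>)
  qed simp
  moreover have "\<not> sat P2" by (rule not_sat_P2) simp
  ultimately show ?thesis by (rule fails_for_general_basesI)
qed

text \<open>The tiny value \<open>exp (- k n)\<close> sits on the fraction
  \<open>1 / (1 + k n)\<close> of the block: its logarithm averages to at least -1, but no power of
  its exponentially small weight bounds that fraction.\<close>

lemma P2_not_P1: "fails_for_general_bases TYPE(real) P2 P1"
proof -
  define k where "k n = real n + 1" for n
  have k: "1 \<le> k n" for n by (simp add: k_def)
  interpret two_level "\<lambda>n. exp (- k n)" k "\<lambda>_. 1"
    using k by unfold_locales (auto intro: order_less_le_trans[OF zero_less_one])
  have \<mu>: "\<mu> n = (exp (- k n) + k n) / (1 + k n)" for n by (simp add: \<mu>_def)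
  have \<mu>1: "\<mu> n \<le> 1" for n using k[of n] by (simp add: \<mu> divide_le_eq)
  have \<mu>2: "1 / 2 \<le> \<mu> n" for n
  proof -
    have "1 / 2 * (1 + k n) \<le> k n" using k[of n] by simp
    also have "\<dots> \<le> exp (- k n) + k n" by simp
    finally show ?thesis using k[of n] by (simp add: \<mu> pos_le_divide_eq)
  qed
  have "sat P2"
    unfolding satisfies_P2_iff
  proof (intro exI[of _ "exp 1"] conjI ballI)
    fix B assume "B \<in> image (\<lambda>i. real (to_nat i)) ` range blk"
    then obtain n where B: "B = (\<lambda>i. real (to_nat i)) ` blk n" by blast
    have "0 < v B x" for x
      unfolding B v_def a_eq[OF blk] mean_blk W_def using \<mu>_pos by (simp split: prod.split)
    then show "AE x in N B. 0 < v B x" by simp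
    show "integrable (N B) (\<lambda>x. ln (v B x))" unfolding B by (rule integrable_N[OF blk])
    have l: "- k n \<le> ln (exp (- k n) / \<mu> n)" and h: "0 \<le> ln (1 / \<mu> n)"
      using \<mu>1[of n] \<mu>_pos[of n] by (simp_all add: ln_div)
    have "- (1 + k n) \<le> - k n + k n * 0" using k[of n] by simp
    also have "\<dots> \<le> ln (exp (- k n) / \<mu> n) + k n * ln (1 / \<mu> n)"
      using l h k[of n] by (intro add_mono mult_left_mono) auto
    finally show "- ln (exp 1) \<le> (\<integral>x. ln (v B x) \<partial>N B)"
      unfolding B integral_N[OF blk] using k[of n]
      by (simp add: sum_blk v_eq[OF blk] mean_blk mass_blk le_divide_eq)
  qed simp
  moreover have "\<not> sat P1"
  proof
    assume "sat P1"
    \<comment> \<open>Refuting (P1') needs one test set per block and treats all exponents at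
      once.\<close>
    then have "sat P1'" by (rule P1_imp_P1')
    then obtain \<delta> C where \<delta>: "0 < \<delta>" and C: "0 < C" and le: "\<And>n E. E \<in> sets P \<Longrightarrow>
        measure (N ((\<lambda>i. real (to_nat i)) ` blk n)) E
          \<le> C * measure (\<omega> ((\<lambda>i. real (to_nat i)) ` blk n)) E powr \<delta>"
      unfolding satisfies_P1'_iff by blast
    define K where "K = C * 2 powr \<delta>"
    \<comment> \<open>The estimates below reduce to
      \<open>exp (\<delta> * k n) \<le> 2 * K * k n\<close>; against
      \<open>(\<delta> * k n)\<^sup>2 / 2\<close> this would force
      \<open>k n * \<delta>\<^sup>2 \<le> 4 * K\<close>.\<close>
    obtain n where "4 * K / \<delta>\<^sup>2 < real n" using reals_Archimedean2 by blast
    then have "4 * K < real n * \<delta>\<^sup>2" using \<delta> by (simp add: field_simps)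
    also have "\<dots> \<le> k n * \<delta>\<^sup>2" by (intro mult_right_mono) (auto simp: k_def)
    finally have n: "4 * K < k n * \<delta>\<^sup>2" .
    let ?E = "{x\<in>space P. v ((\<lambda>i. real (to_nat i)) ` blk n) x < 1}"
    have "exp (- k n) < 1 / 2"
    proof -
      have "exp 1 \<le> exp (k n)" using k[of n] by simp
      moreover have "2 < exp (1::real)" using exp_lower_Taylor_quadratic[of 1] by simp
      ultimately have "2 < exp (k n)" by linarith
      then show ?thesis by (simp add: exp_minus field_simps)
    qed
    then have l: "exp (- k n) / \<mu> n < 1" using \<mu>2[of n] \<mu>_pos[of n] by (simp add: divide_less_eq)
    have h: "\<not> 1 / \<mu> n < 1" using \<mu>1[of n] \<mu>_pos[of n] by (simp add: divide_less_eq)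
    have "1 / (1 + k n) = measure (N ((\<lambda>i. real (to_nat i)) ` blk n)) ?E"
      unfolding measure_level(1)[where Q = "\<lambda>y. y < 1"] using l h by simp
    also have "\<dots> \<le> C * measure (\<omega> ((\<lambda>i. real (to_nat i)) ` blk n)) ?E powr \<delta>"
      by (rule le) (auto simp: sets_P space_P)
    also have "measure (\<omega> ((\<lambda>i. real (to_nat i)) ` blk n)) ?E = exp (- k n) / \<mu> n / (1 + k n)"
      unfolding measure_level(2)[where Q = "\<lambda>y. y < 1"] using l h by simp
    also have "C * (exp (- k n) / \<mu> n / (1 + k n)) powr \<delta> \<le> C * (2 * exp (- k n)) powr \<delta>"
    proof (intro mult_left_mono powr_mono2)
      have "exp (- k n) / \<mu> n / (1 + k n) \<le> exp (- k n) / \<mu> n / 1"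
        using k[of n] \<mu>_pos[of n] by (intro divide_left_mono) auto
      also have "\<dots> \<le> exp (- k n) / (1 / 2) / 1"
        using \<mu>2[of n] \<mu>_pos[of n] by (intro divide_right_mono divide_left_mono) auto
      finally show "exp (- k n) / \<mu> n / (1 + k n) \<le> 2 * exp (- k n)" by simp
    qed (use C \<delta> k[of n] \<mu>_pos[of n] in auto)
    also have "\<dots> = K * exp (- (\<delta> * k n))"
      by (simp add: powr_mult K_def) (simp add: powr_def)
    finally have "1 / (1 + k n) * exp (\<delta> * k n) \<le> K * exp (- (\<delta> * k n)) * exp (\<delta> * k n)"
      by (intro mult_right_mono) auto
    moreover have "exp (- (\<delta> * k n)) * exp (\<delta> * k n) = 1" by (simp flip: exp_add)
    ultimately have "1 / (1 + k n) * exp (\<delta> * k n) \<le> K" by (simp only: mult.assoc mult_1_right)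
    then have E: "exp (\<delta> * k n) \<le> K * (1 + k n)"
      using k[of n] by (simp add: pos_divide_le_eq)
    have "0 \<le> \<delta> * k n" using \<delta> k[of n] by simp
    then have "(\<delta> * k n)\<^sup>2 / 2 \<le> exp (\<delta> * k n)"
      using exp_lower_Taylor_quadratic[of "\<delta> * k n"] by linarith
    also note E
    also have "K * (1 + k n) \<le> K * (2 * k n)" using k[of n] C by (intro mult_left_mono) (auto simp: K_def)
    finally have "k n * (k n * \<delta>\<^sup>2) \<le> k n * (4 * K)" by (simp add: power2_eq_square ac_simps)
    then show False using n k[of n] by (simp add: mult_le_cancel_left)
  qed
  ultimately show ?thesis by (rule fails_for_general_basesI)
qed

text \<open>Block \<open>n\<close> has one atom of mass \<open>1 / 4 ^ k\<close> and value \<open>2 ^ k\<close> for each \<open>1 \<le> k \<le> n\<close>, and its mass \<open>1\<close>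
  at the value \<open>1\<close> is cut into \<open>8 ^ n\<close> atoms. Pairing each of the latter with the top atom gives
  sets on which the average is about \<open>2 ^ n\<close>.\<close>

locale multi_level
begin

definition mm :: "nat \<times> nat \<times> nat \<Rightarrow> real" where
  "mm = (\<lambda>(n, k, i). if k = 0 then 1 / 8 ^ n else 1 / 4 ^ k)"
definition uu :: "nat \<times> nat \<times> nat \<Rightarrow> real" where
  "uu = (\<lambda>(n, k, i). 2 ^ k)"
definition blk :: "nat \<Rightarrow> (nat \<times> nat \<times> nat) set" where
  "blk n = (\<lambda>i. (n, 0, i)) ` {..<8 ^ n} \<union> (\<lambda>k. (n, k, 0)) ` {1..n}"
definition pair :: "nat \<Rightarrow> nat \<Rightarrow> (nat \<times> nat \<times> nat) set" where
  "pair n i = {(n, 0, i), (n, n, 0)}"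
text \<open>\<open>1 \<le> n\<close> keeps the top atom \<open>(n, n, 0)\<close> apart from the base
  atoms, whose second index is 0. Base atoms have mass \<open>1 / 8 ^ n\<close> so that in a pair
  the top atom, of mass \<open>1 / 4 ^ n\<close>, dominates, while the pair still satisfies
  (P1).\<close>

definition AA :: "(nat \<times> nat \<times> nat) set set" where
  "AA = {blk n | n. 1 \<le> n} \<union> {pair n i | n i. 1 \<le> n \<and> i < 8 ^ n}"

lemma AA_cases:
  assumes "A \<in> AA"
  obtains n where "1 \<le> n" "A = blk n" | n i where "1 \<le> n" "i < 8 ^ n" "A = pair n i"
  using assms by (auto simp: AA_def)

lemma blk_AA: "1 \<le> n \<Longrightarrow> blk n \<in> AA" and pair_AA: "1 \<le> n \<Longrightarrow> i < 8 ^ n \<Longrightarrow> pair n i \<in> AA"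
  by (auto simp: AA_def)

lemma mm_pos: "0 < mm i" and uu_ge1: "1 \<le> uu i"
  by (auto simp: mm_def uu_def split: prod.split)

lemma finite_AA: "A \<in> AA \<Longrightarrow> finite A"
  by (auto simp: AA_def blk_def pair_def)

lemma sum_blk: "(\<Sum>i\<in>blk n. f i) = (\<Sum>i<8 ^ n. f (n, 0, i)) + (\<Sum>k=1..n. f (n, k, 0))"
  unfolding blk_def by (subst sum.union_disjoint) (auto simp: sum.reindex inj_on_def)

lemma sum_pair: "1 \<le> n \<Longrightarrow> (\<Sum>j\<in>pair n i. f j) = f (n, 0, i) + f (n, n, 0)"
  by (simp add: pair_def)

sublocale atomic_weight "\<lambda>i. real (to_nat i)" mm uu AA
proof
  show "inj (\<lambda>i :: nat \<times> nat \<times> nat. real (to_nat i))" by (auto intro!: injI)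
  show "0 < mm i" for i by (rule mm_pos)
  show "0 \<le> uu i" for i using uu_ge1[of i] by simp
  fix A assume A: "A \<in> AA"
  show "finite A" by (rule finite_AA[OF A])
  have "A \<noteq> {}" using A by (auto simp: AA_def blk_def pair_def)
  then show "0 < (\<Sum>i\<in>A. mm i * uu i)"
    using finite_AA[OF A] mm_pos uu_ge1
    by (intro sum_pos mult_pos_pos) (auto intro: less_le_trans[OF zero_less_one])
qed simp

lemma sum_half: "1 \<le> j \<Longrightarrow> (\<Sum>k=j..n. 1 / 2 ^ k) \<le> (2 / 2 ^ j :: real)"
proof -
  \<comment> \<open>The induction needs the exact value with its negative remainder.\<close>
  have "(\<Sum>k=j..n. 1 / 2 ^ k) \<le> (2 / 2 ^ j - 1 / 2 ^ n :: real)" if "j \<le> n"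
    using that
  proof (induction n rule: dec_induct)
    case (step i)
    have "(\<Sum>k=j..Suc i. 1 / 2 ^ k) = (\<Sum>k=j..i. 1 / 2 ^ k) + (1 / 2 ^ i / 2 :: real)"
      using step.hyps by simp
    with step.IH show ?case by simp
  qed simp
  then show ?thesis by (cases "j \<le> n") (auto intro: order_trans)
qed

lemma mass_le_total: "A \<in> AA \<Longrightarrow> mass A \<le> (\<Sum>i\<in>A. mm i * uu i)"
  unfolding mass_def
  by (intro sum_mono) (use mult_left_mono[OF uu_ge1 less_imp_le[OF mm_pos]] in simp)

lemma mean_ge1: "A \<in> AA \<Longrightarrow> 1 \<le> mean A"
  using mass_le_total mass_pos by (simp add: mean_def le_divide_eq)

lemma sum_inverse_le: "A \<in> AA \<Longrightarrow> (\<Sum>i\<in>A. mm i / uu i) \<le> mass A"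
  unfolding mass_def
proof (intro sum_mono)
  fix i
  have "mm i / uu i \<le> mm i / 1"
    using mm_pos[of i] uu_ge1[of i] by (intro divide_left_mono) auto
  then show "mm i / uu i \<le> mm i" by simp
qed

lemma total_blk: "(\<Sum>i\<in>blk n. mm i * uu i) = 1 + (\<Sum>k=1..n. 1 / 2 ^ k)"
proof -
  have "(\<Sum>k=1..n. mm (n, k, 0) * uu (n, k, 0)) = (\<Sum>k=1..n. 1 / 2 ^ k)"
  proof (intro sum.cong refl)
    fix k :: nat assume "k \<in> {1..n}"
    have "(4::real) ^ k = 2 ^ k * 2 ^ k" by (simp flip: power_mult_distrib)
    then show "mm (n, k, 0) * uu (n, k, 0) = 1 / 2 ^ k" using \<open>k \<in> _\<close> by (simp add: mm_def uu_def)
  qed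
  then show ?thesis by (simp add: sum_blk) (simp add: mm_def uu_def)
qed

lemma total_blk_le: "(\<Sum>i\<in>blk n. mm i * uu i) \<le> 2"
  using sum_half[of 1 n] by (simp add: total_blk)

lemma mass_blk: "1 \<le> mass (blk n)"
  unfolding mass_def sum_blk by (simp add: mm_def sum_nonneg)

lemma mass_pair: "1 \<le> n \<Longrightarrow> mass (pair n i) = 1 / 8 ^ n + 1 / 4 ^ n"
  by (simp add: mass_def sum_pair) (simp add: mm_def)

lemma total_pair: "1 \<le> n \<Longrightarrow> (\<Sum>j\<in>pair n i. mm j * uu j) = 1 / 8 ^ n + 2 ^ n / 4 ^ n"
  by (simp add: sum_pair) (simp add: mm_def uu_def)

lemma eight: "(8::real) ^ n = 2 ^ n * 4 ^ n"
  by (simp flip: power_mult_distrib)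

lemma mean_pair_le: "1 \<le> n \<Longrightarrow> mean (pair n i) \<le> 2 ^ n"
proof -
  assume n: "1 \<le> n"
  have "1 / 8 ^ n + 2 ^ n / 4 ^ n \<le> 2 ^ n * (1 / 8 ^ n + 1 / 4 ^ n :: real)"
    by (simp add: distrib_left divide_right_mono)
  then show "mean (pair n i) \<le> 2 ^ n"
    unfolding mean_def mass_pair[OF n] total_pair[OF n]
    by (subst pos_divide_le_eq) (auto intro!: add_pos_pos)
qed

lemma mean_pair_ge: "1 \<le> n \<Longrightarrow> 2 ^ n / 2 \<le> mean (pair n i)"
proof -
  assume n: "1 \<le> n"
  have "2 ^ n / 2 * (1 / 8 ^ n + 1 / 4 ^ n) = 1 / 4 ^ n / 2 + 2 ^ n / 4 ^ n / (2::real)"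
    by (simp add: eight field_simps)
  also have "\<dots> \<le> 2 ^ n / 4 ^ n / 2 + 2 ^ n / 4 ^ n / 2"
    by (intro add_right_mono divide_right_mono) auto
  also have "\<dots> \<le> 1 / 8 ^ n + 2 ^ n / 4 ^ n" by simp
  finally show "2 ^ n / 2 \<le> mean (pair n i)"
    unfolding mean_def mass_pair[OF n] total_pair[OF n]
    by (subst pos_le_divide_eq) (auto intro!: add_pos_pos)
qed

text \<open>Full blocks have mean at most 2. In a pair the base and the top atom each contribute
  \<open>1 / 8 ^ n\<close> to the integral of \<open>1 / w\<close>, and the mean
  \<open>2 ^ n\<close> brings this back to the mass \<open>1 / 4 ^ n\<close> of the top
  atom.\<close>

lemma sat_P1: "satisfies P1 P (image (\<lambda>i. real (to_nat i)) ` AA) W"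
proof (rule satisfies_P1I[of 2])
  show "0 < uu i" for i using uu_ge1[of i] by simp
  fix A assume A: "A \<in> AA"
  from A show "mean A * (\<Sum>i\<in>A. mm i / uu i) \<le> 2 * mass A"
  proof (cases rule: AA_cases)
    case (1 n)
    have "mean A \<le> 2"
      unfolding mean_def 1 using total_blk_le[of n] mass_blk[of n] by (simp add: divide_le_eq)
    then show ?thesis
      using sum_inverse_le[OF A] mm_pos uu_ge1 mean_ge1[OF A]
      by (intro mult_mono sum_nonneg divide_nonneg_nonneg) (auto simp: less_imp_le intro: order_trans[OF zero_le_one])
  next
    case (2 n i)
    have "mean A * (\<Sum>i\<in>A. mm i / uu i) \<le> 2 ^ n * (\<Sum>i\<in>A. mm i / uu i)"
      unfolding 2 using mm_pos uu_ge1 mean_pair_le[OF 2(1)]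
      by (intro mult_right_mono sum_nonneg divide_nonneg_nonneg) (auto simp: less_imp_le intro: order_trans[OF zero_le_one])
    also have "\<dots> = 2 ^ n * (1 / 8 ^ n + 1 / 4 ^ n / 2 ^ n)"
      unfolding 2 sum_pair[OF 2(1)] using 2(1) by (simp add: mm_def uu_def)
    also have "\<dots> = 2 * (1 / 4 ^ n)" by (simp add: eight field_simps)
    also have "\<dots> \<le> 2 * mass A" unfolding 2 mass_pair[OF 2(1)] by simp
    finally show ?thesis .
  qed
qed simp

text \<open>The intermediate atoms are there for this condition. Values grow by a factor 2, so the
  first value above \<open>t\<close> is at most \<open>2 * t\<close>, and the weight above it is a
  geometric sum dominated by that first atom. In a pair, \<open>t\<close> exceeds the mean and is
  thus within a factor 2 of the top value.\<close>

lemma sat_P8: "satisfies P8 P (image (\<lambda>i. real (to_nat i)) ` AA) W"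
proof (rule satisfies_P8I[of 4])
  fix A t assume A: "A \<in> AA" and t: "mean A < t"
  have t1: "1 < t" using mean_ge1[OF A] t by simp
  from A show "(\<Sum>i | i \<in> A \<and> t \<le> uu i. mm i * uu i) \<le> 4 * t * (\<Sum>i | i \<in> A \<and> t \<le> uu i. mm i)"
  proof (cases rule: AA_cases)
    case (2 n i)
    \<comment> \<open>All means are at least 1, so \<open>t > 1\<close> and the base atoms drop
      out.\<close>
    have eq: "{j. j \<in> A \<and> t \<le> uu j} = (if t \<le> 2 ^ n then {(n, n, 0)} else {})"
      unfolding 2 using t1 by (auto simp: pair_def uu_def)
    have "2 ^ n \<le> 4 * t" using mean_pair_ge[OF 2(1), of i] t mean_ge1[OF A] unfolding 2 by linarith
    then have "1 / 4 ^ n * 2 ^ n \<le> 1 / 4 ^ n * (4 * t)" by (intro mult_left_mono) auto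
    then show ?thesis unfolding eq using 2(1) by (simp add: mm_def uu_def)
  next
    case (1 n)
    have eq: "{j. j \<in> A \<and> t \<le> uu j} = (\<lambda>k. (n, k, 0)) ` {k\<in>{1..n}. t \<le> 2 ^ k}"
      unfolding 1 using t1 by (auto simp: blk_def uu_def)
    have sums: "(\<Sum>i | i \<in> A \<and> t \<le> uu i. f i) = (\<Sum>k\<in>{k\<in>{1..n}. t \<le> 2 ^ k}. f (n, k, 0))" for f :: "_ \<Rightarrow> real"
      unfolding eq by (subst sum.reindex) (auto simp: inj_on_def)
    show ?thesis
    proof (cases "{k\<in>{1..n}. t \<le> 2 ^ k} = {}")
      case True
      show ?thesis unfolding sums True by simp
    next
      case False
      \<comment> \<open>The first level reaching \<open>t\<close>; by minimality it overshoots by at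
        most a factor 2, and \<open>t > 1\<close> rules out level 0.\<close>
      define j where "j = (LEAST k. t \<le> 2 ^ k)"
      obtain k0 where k0: "k0 \<in> {1..n}" "t \<le> 2 ^ k0" using False by blast
      have j: "t \<le> 2 ^ j" unfolding j_def by (rule LeastI) (rule k0)
      have "j \<noteq> 0" using j t1 by (cases j) auto
      have "j \<le> n" using Least_le[of "\<lambda>k. t \<le> 2 ^ k", OF k0(2)] k0(1) by (simp add: j_def)
      have "\<not> t \<le> 2 ^ (j - 1)"
        using not_less_Least[of "j - 1" "\<lambda>k. t \<le> 2 ^ k"] \<open>j \<noteq> 0\<close> by (simp add: j_def)
      moreover have "2 ^ j = 2 * (2::real) ^ (j - 1)"
        using \<open>j \<noteq> 0\<close> by (cases j) auto
      ultimately have tj: "2 ^ j \<le> 2 * t" by simp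
      have set: "{k\<in>{1..n}. t \<le> 2 ^ k} = {j..n}"
      proof (intro set_eqI iffI)
        fix k assume "k \<in> {k\<in>{1..n}. t \<le> 2 ^ k}"
        then show "k \<in> {j..n}" using Least_le[of "\<lambda>k. t \<le> 2 ^ k" k] by (simp add: j_def)
      next
        fix k assume k: "k \<in> {j..n}"
        then have "(2::real) ^ j \<le> 2 ^ k" by (intro power_increasing) auto
        with j have "t \<le> 2 ^ k" by (rule order_trans)
        then show "k \<in> {k\<in>{1..n}. t \<le> 2 ^ k}" using k \<open>j \<noteq> 0\<close> by auto
      qed
      have "(\<Sum>i | i \<in> A \<and> t \<le> uu i. mm i * uu i) = (\<Sum>k=j..n. 1 / 2 ^ k)"
        unfolding sums set
      proof (intro sum.cong refl)
        fix k assume "k \<in> {j..n}"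
        have "(4::real) ^ k = 2 ^ k * 2 ^ k" by (simp flip: power_mult_distrib)
        then show "mm (n, k, 0) * uu (n, k, 0) = 1 / 2 ^ k"
          using \<open>k \<in> _\<close> \<open>j \<noteq> 0\<close> by (simp add: mm_def uu_def)
      qed
      also have "\<dots> \<le> 2 / 2 ^ j" using \<open>j \<noteq> 0\<close> by (intro sum_half) simp
      also have "\<dots> = 2 * 2 ^ j * (1 / 4 ^ j)"
      proof -
        have "(4::real) ^ j = 2 ^ j * 2 ^ j" by (simp flip: power_mult_distrib)
        then show ?thesis by simp
      qed
      also have "\<dots> \<le> 4 * t * (1 / 4 ^ j)" using tj by (intro mult_right_mono) auto
      also have "\<dots> \<le> 4 * t * (\<Sum>i | i \<in> A \<and> t \<le> uu i. mm i)"
      proof (intro mult_left_mono)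
        have "1 / 4 ^ j = mm (n, j, 0)" using \<open>j \<noteq> 0\<close> by (simp add: mm_def)
        also have "\<dots> \<le> (\<Sum>k=j..n. mm (n, k, 0))"
          using \<open>j \<le> n\<close> mm_pos by (intro member_le_sum) (auto simp: less_imp_le)
        finally show "1 / 4 ^ j \<le> (\<Sum>i | i \<in> A \<and> t \<le> uu i. mm i)" unfolding sums set .
      qed (use t1 in simp)
      finally show ?thesis .
    qed
  qed
qed simp

text \<open>Testing on a full block, the pair through each base atom makes the maximal function at
  least \<open>2 ^ n / 2\<close> there, although the block has weight at most 2.\<close>

lemma not_P7: "\<not> satisfies P7 P (image (\<lambda>i. real (to_nat i)) ` AA) W"
proof
  let ?e = "\<lambda>i :: nat \<times> nat \<times> nat. real (to_nat i)"
  assume "satisfies P7 P (image ?e ` AA) W"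
  then obtain C where C: "0 < C" and le: "\<forall>B\<in>image ?e ` AA.
      (\<integral>\<^sup>+x\<in>B. maximal P (image ?e ` AA) (\<lambda>y. ennreal (W y) * indicator B y) x \<partial>P) \<le> ennreal C * wint P W B"
    by auto
  obtain n0 where n0: "4 * C < 2 ^ n0" using real_arch_pow[of 2 "4 * C"] by auto
  \<comment> \<open>The successor ensures \<open>1 \<le> n\<close> without spoiling the growth
    bound.\<close>
  define n where "n = Suc n0"
  have n: "1 \<le> n" "4 * C < 2 ^ n" using n0 less_trans[OF n0, of "2 ^ n"] by (auto simp: n_def)
  let ?max = "maximal P (image ?e ` AA) (\<lambda>y. ennreal (W y) * indicator (?e ` blk n) y)"
  have max: "ennreal (2 ^ n / 2) \<le> ?max (?e (n, 0, i))" if i: "i < 8 ^ n" for i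
  proof -
    have pair: "pair n i \<in> AA" by (rule pair_AA[OF n(1) i])
    have sub: "pair n i \<subseteq> blk n" using i n by (auto simp: pair_def blk_def)
    have "ennreal (2 ^ n / 2) \<le> ennreal (mean (pair n i))"
      by (intro ennreal_leI mean_pair_ge n)
    also have "\<dots> = wavg P W (?e ` pair n i)" by (simp add: wavg_eq[OF eA[OF pair]] a_eq[OF pair])
    also have "\<dots> = avg P (?e ` pair n i) (\<lambda>y. ennreal (W y) * indicator (?e ` blk n) y)"
      unfolding wavg_def avg_def wint_def using sub
      by (intro arg_cong2[of _ _ _ _ "(/)"] nn_integral_cong refl) (auto split: split_indicator)
    also have "\<dots> \<le> ?max (?e (n, 0, i))"
      unfolding maximal_def by (intro SUP_upper CollectI conjI eA[OF pair] imageI) (simp add: pair_def)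
    finally show ?thesis .
  qed
  \<comment> \<open>The base atoms have total mass 1, so they alone already account for
    \<open>2 ^ n / 2\<close> in the integral.\<close>
  have "ennreal (2 ^ n / 2) = (\<Sum>i<8 ^ n. ennreal (mm (n, 0, i)) * ennreal (2 ^ n / 2))"
  proof -
    have "(\<Sum>i<8 ^ n. ennreal (mm (n, 0, i)) * ennreal (2 ^ n / 2))
        = ennreal (\<Sum>i<(8::nat) ^ n. 1 / 8 ^ n * (2 ^ n / 2))"
      by (subst sum_ennreal[symmetric]) (auto simp: mm_def simp flip: ennreal_mult)
    then show ?thesis by simp
  qed
  also have "\<dots> \<le> (\<Sum>i<8 ^ n. ennreal (mm (n, 0, i)) * ?max (?e (n, 0, i)))"
    by (intro sum_mono mult_left_mono max) auto
  also have "\<dots> \<le> (\<Sum>i\<in>blk n. ennreal (mm i) * ?max (?e i))"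
    unfolding sum_blk by simp
  also have "\<dots> = (\<integral>\<^sup>+x\<in>?e ` blk n. ?max x \<partial>P)"
    by (rule nn_integral_P[OF blk_AA[OF n(1)] order_refl, symmetric])
  also have "\<dots> \<le> ennreal C * wint P W (?e ` blk n)"
    using le blk_AA[OF n(1)] by blast
  also have "\<dots> \<le> ennreal C * ennreal 2"
    unfolding wint_P[OF blk_AA[OF n(1)] order_refl]
    by (intro mult_left_mono ennreal_leI total_blk_le) simp
  also have "\<dots> = ennreal (C * 2)" using C by (simp add: ennreal_mult)
  finally show False using n C by simp
qed

end

lemma P1_P8_not_P7:
  "fails_for_general_bases TYPE(real) P1 P7" "fails_for_general_bases TYPE(real) P8 P7"
proof -
  interpret multi_level .
  show "fails_for_general_bases TYPE(real) P1 P7" using sat_P1 not_P7 by (rule fails_for_general_basesI)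
  show "fails_for_general_bases TYPE(real) P8 P7" using sat_P8 not_P7 by (rule fails_for_general_basesI)
qed

section \<open>The classification\<close>

lemma holds_for_general_basesI:
  assumes "\<And>(M :: 'a measure) \<B> w. weighted_basis M \<B> w \<Longrightarrow> satisfies PA M \<B> w \<Longrightarrow> satisfies PB M \<B> w"
  shows "holds_for_general_bases TYPE('a) PA PB"
  unfolding holds_for_general_bases_def using assms by (auto simp: weighted_basis_def)

lemma fails_mono:
  assumes "fails_for_general_bases TYPE('a) PA PB"
    and "holds_for_general_bases TYPE('a) PA PA'" "holds_for_general_bases TYPE('a) PB' PB"
  shows "fails_for_general_bases TYPE('a) PA' PB'"
  using assms unfolding holds_for_general_bases_def fails_for_general_bases_def by blast

lemma holds_equivalences:
  "holds_for_general_bases TYPE('a) P1 P1'" "holds_for_general_bases TYPE('a) P1' P1"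
  "holds_for_general_bases TYPE('a) P2 P2'" "holds_for_general_bases TYPE('a) P2' P2"
  "holds_for_general_bases TYPE('a) P3 P3'" "holds_for_general_bases TYPE('a) P3' P3"
  "holds_for_general_bases TYPE('a) P4 P4'" "holds_for_general_bases TYPE('a) P4' P4"
  by (rule holds_for_general_basesI,
      erule (1) weighted_basis.P1_imp_P1' weighted_basis.P1'_imp_P1 weighted_basis.P2_imp_P2'
        weighted_basis.P2'_imp_P2 weighted_basis.P3_imp_P3' weighted_basis.P3'_imp_P3
        weighted_basis.P4_imp_P4' weighted_basis.P4'_imp_P4)+

lemma holds_basic:
  "holds_for_general_bases TYPE('a) P1 P2" "holds_for_general_bases TYPE('a) P2 P5"
  "holds_for_general_bases TYPE('a) P5 P4" "holds_for_general_bases TYPE('a) P3 P6"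
  "holds_for_general_bases TYPE('a) P6 P4" "holds_for_general_bases TYPE('a) P8 P3"
  by (rule holds_for_general_basesI,
      erule (1) weighted_basis.P1_imp_P2 weighted_basis.P2_imp_P5 weighted_basis.P5_imp_P4
        weighted_basis.P3_imp_P6 weighted_basis.P6_imp_P4 weighted_basis.P8_imp_P3)+

lemma holds_valid:
  assumes "PA = PB \<or> (PA, PB) \<in> valid_implications"
  shows "holds_for_general_bases TYPE('a) PA PB"
  using assms holds_basic[where 'a = 'a]
  unfolding valid_implications_def holds_for_general_bases_def by (elim disjE insertE emptyE) auto

lemma fails_failing:
  assumes "(PA, PB) \<in> failing_implications"
  shows "fails_for_general_bases TYPE(real) PA PB"
proof -
  have mono: "fails_for_general_bases TYPE(real) PA PB"
    if "fails_for_general_bases TYPE(real) PA' PB'"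
      "PA' = PA \<or> (PA', PA) \<in> valid_implications" "PB = PB' \<or> (PB, PB') \<in> valid_implications" for PA' PB'
    using that(1) holds_valid[OF that(2)] holds_valid[OF that(3)] by (rule fails_mono)
  \<comment> \<open>Each group is handled by one example: its premises follow from that example's
    premise, and its conclusions imply that example's conclusion.\<close>
  consider "PA \<in> {P1, P2, P4, P5}" "PB \<in> {P3, P6, P8}" | "PA \<in> {P1, P2, P4, P5}" "PB = P7"
    | "PA \<in> {P3, P6, P8}" "PB = P7" | "PA \<in> {P3, P4, P6, P8}" "PB \<in> {P1, P2, P5}"
    | "PA = P7" "PB \<in> {P1, P2, P3, P4, P5, P6, P8}" | "PA \<in> {P4, P5}" "PB \<in> {P1, P2}"
    | "PA = P2" "PB = P1" | "PA = P3" "PB = P8" | "PA = P6" "PB \<in> {P3, P8}"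
    using assms unfolding failing_implications_def by blast
  then show ?thesis
  proof cases
    case 1 then show ?thesis by (intro mono[OF P1_not_P6]) (auto simp: valid_implications_def)
  next
    case 2 then show ?thesis by (intro mono[OF P1_P8_not_P7(1)]) (auto simp: valid_implications_def)
  next
    case 3 then show ?thesis by (intro mono[OF P1_P8_not_P7(2)]) (auto simp: valid_implications_def)
  next
    case 4 then show ?thesis by (intro mono[OF P8_not_P5]) (auto simp: valid_implications_def)
  next
    case 5 then show ?thesis by (intro mono[OF P7_not_P4]) (auto simp: valid_implications_def)
  next
    case 6 then show ?thesis by (intro mono[OF P5_not_P2]) (auto simp: valid_implications_def)
  next
    case 7 then show ?thesis by (intro mono[OF P2_not_P1]) auto
  next
    case 8 then show ?thesis by (intro mono[OF P3_not_P8]) auto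
  next
    case 9 then show ?thesis by (intro mono[OF P6_not_P3]) (auto simp: valid_implications_def)
  qed
qed

theorem theorem1p1:
  shows "(\<forall>(PA, PB) \<in> {(P1, P1'), (P2, P2'), (P3, P3'), (P4, P4')}.
            holds_for_general_bases TYPE('a) PA PB \<and> holds_for_general_bases TYPE('a) PB PA)
       \<and> (\<forall>(PA, PB) \<in> valid_implications. holds_for_general_bases TYPE('a) PA PB)
       \<and> (\<forall>PA \<in> main_conditions. \<forall>PB \<in> main_conditions.
            PA \<noteq> PB \<and> (PA, PB) \<notin> valid_implications \<longrightarrow> fails_for_general_bases TYPE(real) PA PB)
       \<and> (\<forall>(PA, PB) \<in> failing_implications. fails_for_general_bases TYPE(real) PA PB)"
proof (intro conjI)
  show "\<forall>(PA, PB) \<in> {(P1, P1'), (P2, P2'), (P3, P3'), (P4, P4')}.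
      holds_for_general_bases TYPE('a) PA PB \<and> holds_for_general_bases TYPE('a) PB PA"
    using holds_equivalences[where 'a = 'a] by simp
  show "\<forall>(PA, PB) \<in> valid_implications. holds_for_general_bases TYPE('a) PA PB"
    using holds_valid by blast
  show "\<forall>(PA, PB) \<in> failing_implications. fails_for_general_bases TYPE(real) PA PB"
    using fails_failing by blast
  \<comment> \<open>A finite check that the explicit table is exhaustive, pair by pair.\<close>
  have "(PA, PB) \<in> failing_implications"
    if "PA \<in> main_conditions" "PB \<in> main_conditions" "PA \<noteq> PB" "(PA, PB) \<notin> valid_implications" for PA PB
    using that unfolding main_conditions_def valid_implications_def failing_implications_def
    by (elim insertE emptyE) simp_all
  then show "\<forall>PA \<in> main_conditions. \<forall>PB \<in> main_conditions.
      PA \<noteq> PB \<and> (PA, PB) \<notin> valid_implications \<longrightarrow> fails_for_general_bases TYPE(real) PA PB"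
    using fails_failing by blast
qed

end
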